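(* Fix an integer $\delta\ge1$. There is a constant $K_\delta$ such that for every $L$ the following holds on the $3$-dimensional nearest-neighbour qubit lattice $\{0,\dots,L-1\}^3$ ($N=L^3$). Let $P$ be the set of unordered pairs $\{x,y\}$ of distinct sites with $\|x-y\|_\infty\le\delta$, and for each $\{x,y\}\in P$ let $H_{xy}$ be any Hermitian, fermion-parity-even operator in the algebra generated by $c_x,c_y,c_x^\dagger,c_y^\dagger$, and $\theta_{xy}\in\mathbb R$. Then there exist canonical orderings $m_0,m_1$, an enumeration $p_1,\dots,p_{|P|}$ of $P$, and a circuit $V$ of at most $K_\delta N$ single-qubit gates and nearest-neighbour CNOT gates, of depth at most $K_\delta L=K_\delta N^{1/3}$, such that $V\Phi_{m_0}=\Phi_{m_1}\,e^{-i\theta_{p_{|P|}}H_{p_{|P|}}}\cdots e^{-i\theta_{p_1}H_{p_1}}$.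
   Context: Qubits sit on $\{0,\dots,L-1\}^3$; two-qubit gates are allowed only between sites at $\ell_1$-distance 1. There is one fermionic mode per site with ladder operators $c_x,c_x^\dagger$, $n_x=c_x^\dagger c_x$; parity-even means commuting with $(-1)^{n_x+n_y}$. A canonical ordering is a bijection $m$ from sites to $\{0,\dots,N-1\}$. The JW isometry $\Phi_m$ is the unique unitary from Fock space to the $N$-qubit space with $\Phi_m|\mathrm{vac}\rangle=|0\cdots0\rangle$ and $\Phi_mc_x\Phi_m^\dagger=\tfrac12(X_x+iY_x)\prod_{y:m(y)<m(x)}Z_y$. *)

theory Defs
  imports Complex_Main
begin

type_synonym site = "nat \<times> nat \<times> nat"
type_synonym cfg = "site set"   \<comment> \<open>occupied modes / qubits in state 1\<close>
type_synonym op = "cfg \<Rightarrow> cfg \<Rightarrow> complex"  \<comment> \<open>matrix A T S = <T|A|S>\<close>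

definition lattice :: "nat \<Rightarrow> site set" where
  "lattice L = {0..<L} \<times> {0..<L} \<times> {0..<L}"

definition ndist :: "nat \<Rightarrow> nat \<Rightarrow> nat" where
  "ndist a b = (if a \<le> b then b - a else a - b)"

definition dist_inf :: "site \<Rightarrow> site \<Rightarrow> nat" where
  "dist_inf x y = (case x of (a,b,c) \<Rightarrow> case y of (a',b',c') \<Rightarrow>
      max (ndist a a') (max (ndist b b') (ndist c c')))"

definition dist_l1 :: "site \<Rightarrow> site \<Rightarrow> nat" where
  "dist_l1 x y = (case x of (a,b,c) \<Rightarrow> case y of (a',b',c') \<Rightarrow>
      ndist a a' + ndist b b' + ndist c c')"

definition idm :: op where
  "idm T S = (if T = S then 1 else 0)"

definition mmult :: "nat \<Rightarrow> op \<Rightarrow> op \<Rightarrow> op" where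
  "mmult L A B = (\<lambda>T S. \<Sum>U\<in>Pow (lattice L). A T U * B U S)"

definition madd :: "op \<Rightarrow> op \<Rightarrow> op" where
  "madd A B = (\<lambda>T S. A T S + B T S)"

definition smult :: "complex \<Rightarrow> op \<Rightarrow> op" where
  "smult c A = (\<lambda>T S. c * A T S)"

definition adj :: "op \<Rightarrow> op" where
  "adj A = (\<lambda>T S. cnj (A S T))"

definition mpow :: "nat \<Rightarrow> op \<Rightarrow> nat \<Rightarrow> op" where
  "mpow L A k = ((mmult L A) ^^ k) idm"

definition mexp :: "nat \<Rightarrow> op \<Rightarrow> op" where
  "mexp L A = (\<lambda>T S. \<Sum>k. mpow L A k T S / of_nat (fact k))"

definition opeq :: "nat \<Rightarrow> op \<Rightarrow> op \<Rightarrow> bool" where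
  "opeq L A B \<longleftrightarrow> (\<forall>T\<in>Pow (lattice L). \<forall>S\<in>Pow (lattice L). A T S = B T S)"

definition supported :: "nat \<Rightarrow> op \<Rightarrow> bool" where
  "supported L A \<longleftrightarrow> (\<forall>T S. (T \<notin> Pow (lattice L) \<or> S \<notin> Pow (lattice L)) \<longrightarrow> A T S = 0)"

definition unitary_op :: "nat \<Rightarrow> op \<Rightarrow> bool" where
  "unitary_op L U \<longleftrightarrow> opeq L (mmult L U (adj U)) idm \<and> opeq L (mmult L (adj U) U) idm"

section \<open>Fock space (concrete model, basis indexed by occupied sets, fixed reference order)\<close>

definition ref_idx :: "nat \<Rightarrow> site \<Rightarrow> nat" where
  "ref_idx L x = (case x of (a,b,c) \<Rightarrow> a*L*L + b*L + c)"

definition ann :: "nat \<Rightarrow> site \<Rightarrow> op" where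
  "ann L x = (\<lambda>T S. if x \<in> S \<and> T = S - {x}
       then (-1) ^ card {y\<in>S. ref_idx L y < ref_idx L x} else 0)"

definition cre :: "nat \<Rightarrow> site \<Rightarrow> op" where
  "cre L x = adj (ann L x)"

definition num :: "nat \<Rightarrow> site \<Rightarrow> op" where
  "num L x = mmult L (cre L x) (ann L x)"

text \<open>(-1)^(n_x + n_y) = (1 - 2 n_x)(1 - 2 n_y), as n_x is a projection.\<close>
definition parity2 :: "nat \<Rightarrow> site \<Rightarrow> site \<Rightarrow> op" where
  "parity2 L x y = mmult L (madd idm (smult (-2) (num L x))) (madd idm (smult (-2) (num L y)))"

inductive_set alg2 :: "nat \<Rightarrow> site \<Rightarrow> site \<Rightarrow> op set" for L x y where
  a_id: "idm \<in> alg2 L x y"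
| a_cx: "ann L x \<in> alg2 L x y"
| a_cy: "ann L y \<in> alg2 L x y"
| a_cdx: "cre L x \<in> alg2 L x y"
| a_cdy: "cre L y \<in> alg2 L x y"
| a_add: "A \<in> alg2 L x y \<Longrightarrow> B \<in> alg2 L x y \<Longrightarrow> madd A B \<in> alg2 L x y"
| a_smult: "A \<in> alg2 L x y \<Longrightarrow> smult c A \<in> alg2 L x y"
| a_mult: "A \<in> alg2 L x y \<Longrightarrow> B \<in> alg2 L x y \<Longrightarrow> mmult L A B \<in> alg2 L x y"

definition admissible_term :: "nat \<Rightarrow> site \<Rightarrow> site \<Rightarrow> op \<Rightarrow> bool" where
  "admissible_term L x y H \<longleftrightarrow>
     H \<in> alg2 L x y \<and> opeq L (adj H) H \<and>
     opeq L (mmult L H (parity2 L x y)) (mmult L (parity2 L x y) H)"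

definition pairs :: "nat \<Rightarrow> nat \<Rightarrow> site set set" where
  "pairs L \<delta> = {{x, y} | x y. x \<in> lattice L \<and> y \<in> lattice L \<and> x \<noteq> y \<and> dist_inf x y \<le> \<delta>}"

definition pauliX :: "site \<Rightarrow> op" where
  "pauliX x = (\<lambda>T S. if T = S - {x} \<union> ({x} - S) then 1 else 0)"

definition pauliY :: "site \<Rightarrow> op" where
  "pauliY x = (\<lambda>T S. if T = S - {x} \<union> ({x} - S) then (if x \<in> S then - \<i> else \<i>) else 0)"

text \<open>prod_{y : m y < m x} Z_y (diagonal, written out).\<close>
definition Zstring :: "nat \<Rightarrow> (site \<Rightarrow> nat) \<Rightarrow> site \<Rightarrow> op" where
  "Zstring L m x = (\<lambda>T S. if T = S then (-1) ^ card {y\<in>S \<inter> lattice L. m y < m x} else 0)"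

definition canonical_ordering :: "nat \<Rightarrow> (site \<Rightarrow> nat) \<Rightarrow> bool" where
  "canonical_ordering L m \<longleftrightarrow> bij_betw m (lattice L) {0..<L^3}"

definition is_JW :: "nat \<Rightarrow> (site \<Rightarrow> nat) \<Rightarrow> op \<Rightarrow> bool" where
  "is_JW L m \<Phi> \<longleftrightarrow> supported L \<Phi> \<and> unitary_op L \<Phi> \<and>
     (\<forall>T\<in>Pow (lattice L). \<Phi> T {} = (if T = {} then 1 else 0)) \<and>
     (\<forall>x\<in>lattice L. opeq L (mmult L (mmult L \<Phi> (ann L x)) (adj \<Phi>))
        (mmult L (smult (1/2) (madd (pauliX x) (smult \<i> (pauliY x)))) (Zstring L m x)))"

definition JW :: "nat \<Rightarrow> (site \<Rightarrow> nat) \<Rightarrow> op" where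
  "JW L m = (THE \<Phi>. is_JW L m \<Phi>)"

datatype gate = Single site "bool \<Rightarrow> bool \<Rightarrow> complex" | CNOT site site

fun gate_support :: "gate \<Rightarrow> site set" where
  "gate_support (Single q u) = {q}"
| "gate_support (CNOT c t) = {c, t}"

fun gate_op :: "gate \<Rightarrow> op" where
  "gate_op (Single q u) = (\<lambda>T S. if T - {q} = S - {q} then u (q \<in> T) (q \<in> S) else 0)"
| "gate_op (CNOT c t) = (\<lambda>T S. if T = (if c \<in> S then S - {t} \<union> ({t} - S) else S) then 1 else 0)"

definition unitary2 :: "(bool \<Rightarrow> bool \<Rightarrow> complex) \<Rightarrow> bool" where
  "unitary2 u \<longleftrightarrow> (\<forall>a b. (\<Sum>c\<in>UNIV. u c a * cnj (u c b)) = (if a = b then 1 else 0))"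

fun valid_gate :: "nat \<Rightarrow> gate \<Rightarrow> bool" where
  "valid_gate L (Single q u) \<longleftrightarrow> q \<in> lattice L \<and> unitary2 u"
| "valid_gate L (CNOT c t) \<longleftrightarrow> c \<in> lattice L \<and> t \<in> lattice L \<and> dist_l1 c t = 1"

type_synonym circuit = "gate list list"

definition valid_layer :: "nat \<Rightarrow> gate list \<Rightarrow> bool" where
  "valid_layer L gs \<longleftrightarrow> (\<forall>g\<in>set gs. valid_gate L g) \<and>
     (\<forall>i<length gs. \<forall>j<length gs. i \<noteq> j \<longrightarrow> gate_support (gs!i) \<inter> gate_support (gs!j) = {})"

definition valid_circuit :: "nat \<Rightarrow> circuit \<Rightarrow> bool" where
  "valid_circuit L V \<longleftrightarrow> (\<forall>l\<in>set V. valid_layer L l)"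

definition gate_count :: "circuit \<Rightarrow> nat" where
  "gate_count V = sum_list (map length V)"

definition depth :: "circuit \<Rightarrow> nat" where
  "depth V = length V"

definition circ_op :: "nat \<Rightarrow> circuit \<Rightarrow> op" where
  "circ_op L V = foldl (\<lambda>U g. mmult L (gate_op g) U) idm (concat V)"

definition evolution :: "nat \<Rightarrow> (site set \<Rightarrow> op) \<Rightarrow> (site set \<Rightarrow> real) \<Rightarrow> site set list \<Rightarrow> op" where
  "evolution L H \<theta> ps = foldl (\<lambda>U p. mmult L (mexp L (smult (- \<i> * complex_of_real (\<theta> p)) (H p))) U) idm ps"

end

(* Take both orderings to be the reference ordering, for which the Jordan-Wigner isometry is the
   identity; it then suffices to write the evolution itself as a circuit, for a suitable order of the
   pairs.  Moving the modes x, y to the front of the ordering is a diagonal sign s, and an admissible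
   term equals s B s where B acts on the qubits x, y only and preserves their joint parity.  Its
   exponential therefore has the same form with unitary 2x2 blocks.

   For a class of parallel nearest-neighbour bonds {x, x + e} with one fixed parity of the coordinate
   in direction e, reorder the modes so that the two ends of every bond become consecutive.  The
   inversion sign q of this single reordering can replace s for all bonds of the class at once, up to
   signs inside B.  The sign q is a quadratic form coupling u_k with w_i for i < k along parallel
   lines u, w (and whole rows for the slowest direction), so conjugating nearest-neighbour
   controlled-Z gates by CNOT prefix-sum chains implements it with O(N) gates in depth O(L).

   Distant pairs are sorted into finitely many families of equal offsets in a grid of period
   2 * Suc delta.  Layers of fermionic swaps, which are gates of the above kind on bonds, bring the
   two members of every pair of a family closer one unit step at a time. *)

theory Submission
  imports Defs
begin

text \<open>In any linear ordering of this kind the Jordan-Wigner string between neighbours in the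
  slowest direction runs through about L^2 modes, and there are about L^3 terms, so paying for
  strings term by term breaks both bounds. What saves the count is that two reorderings which both
  make the ends of a bond adjacent differ, as far as this bond is concerned, by a sign that does not
  distinguish its ends. So one reordering serves all bonds of a class and is paid for once before
  and once after the layer. Terms of different families need not commute, which is where the freedom
  to choose the enumeration enters: whole families are executed one after another. The number of
  families and the number of swap layers that each of them needs depend on \<delta> alone, and so
  does the constant. The period is even so that all translates of a unit step have the same
  coordinate parity and lie in one bond class; it exceeds \<delta> so that different translates of a
  pair cannot meet.\<close>

section \<open>Operator algebra\<close>

lemma finite_lattice [simp]: "finite (lattice L)"
  by (simp add: lattice_def)

lemma opeqI: "(\<And>T S. T \<subseteq> lattice L \<Longrightarrow> S \<subseteq> lattice L \<Longrightarrow> A T S = B T S) \<Longrightarrow> opeq L A B"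
  by (auto simp: opeq_def)

lemma opeqD: "opeq L A B \<Longrightarrow> T \<subseteq> lattice L \<Longrightarrow> S \<subseteq> lattice L \<Longrightarrow> A T S = B T S"
  by (auto simp: opeq_def)

lemma opeq_refl [simp, intro]: "opeq L A A"
  by (simp add: opeq_def)

lemma opeq_sym: "opeq L A B \<Longrightarrow> opeq L B A"
  by (simp add: opeq_def)

lemma opeq_trans [trans]: "opeq L A B \<Longrightarrow> opeq L B C \<Longrightarrow> opeq L A C"
  by (simp add: opeq_def)

lemma mmult_assoc: "mmult L (mmult L A B) C = mmult L A (mmult L B C)"
proof (intro ext)
  fix T S
  have "mmult L (mmult L A B) C T S
      = (\<Sum>U\<in>Pow (lattice L). \<Sum>W\<in>Pow (lattice L). A T W * B W U * C U S)"
    by (simp add: mmult_def sum_distrib_right)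
  also have "\<dots> = (\<Sum>W\<in>Pow (lattice L). \<Sum>U\<in>Pow (lattice L). A T W * B W U * C U S)"
    by (rule sum.swap)
  also have "\<dots> = mmult L A (mmult L B C) T S"
    by (simp add: mmult_def sum_distrib_left mult.assoc)
  finally show "mmult L (mmult L A B) C T S = mmult L A (mmult L B C) T S" .
qed

lemma opeq_mmult: "opeq L A A' \<Longrightarrow> opeq L B B' \<Longrightarrow> opeq L (mmult L A B) (mmult L A' B')"
  by (auto simp: opeq_def mmult_def intro!: sum.cong)

lemma opeq_mmult_l: "opeq L A A' \<Longrightarrow> opeq L (mmult L A B) (mmult L A' B)"
  by (rule opeq_mmult) auto

lemma opeq_mmult_r: "opeq L B B' \<Longrightarrow> opeq L (mmult L A B) (mmult L A B')"
  by (rule opeq_mmult) auto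

lemma mmult_idm_left [simp]: "opeq L (mmult L idm A) A"
proof (rule opeqI)
  fix T S assume "T \<subseteq> lattice L"
  have "mmult L idm A T S = (\<Sum>U\<in>Pow (lattice L). if U = T then A U S else 0)"
    unfolding mmult_def idm_def by (intro sum.cong) auto
  then show "mmult L idm A T S = A T S"
    using \<open>T \<subseteq> lattice L\<close> by simp
qed

lemma mmult_idm_right [simp]: "opeq L (mmult L A idm) A"
proof (rule opeqI)
  fix T S assume "S \<subseteq> lattice L"
  have "mmult L A idm T S = (\<Sum>U\<in>Pow (lattice L). if U = S then A T U else 0)"
    unfolding mmult_def idm_def by (intro sum.cong) auto
  then show "mmult L A idm T S = A T S"
    using \<open>S \<subseteq> lattice L\<close> by simp
qed

lemma mmult_cancel:
  assumes "opeq L (mmult L B C) idm"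
  shows "opeq L (mmult L B (mmult L C D)) D"
  using opeq_trans[OF opeq_mmult_l[OF assms] mmult_idm_left] by (simp add: mmult_assoc)

lemma adj_mmult: "adj (mmult L A B) = mmult L (adj B) (adj A)"
  by (intro ext) (simp add: adj_def mmult_def mult.commute)

lemma adj_adj [simp]: "adj (adj A) = A"
  by (simp add: adj_def)

lemma adj_idm [simp]: "adj idm = idm"
  by (auto simp: adj_def idm_def fun_eq_iff)

lemma opeq_adj: "opeq L A B \<Longrightarrow> opeq L (adj A) (adj B)"
  by (auto simp: opeq_def adj_def)

lemma mmult_madd_left: "mmult L (madd A B) C = madd (mmult L A C) (mmult L B C)"
  by (intro ext) (simp add: mmult_def madd_def sum.distrib distrib_right)

lemma mmult_madd_right: "mmult L A (madd B C) = madd (mmult L A B) (mmult L A C)"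
  by (intro ext) (simp add: mmult_def madd_def sum.distrib distrib_left)

lemma mmult_smult_left: "mmult L (smult c A) B = smult c (mmult L A B)"
  by (intro ext) (simp add: mmult_def smult_def sum_distrib_left mult.assoc)

lemma mmult_smult_right: "mmult L A (smult c B) = smult c (mmult L A B)"
  by (intro ext) (simp add: mmult_def smult_def sum_distrib_left ac_simps)

lemma opeq_madd: "opeq L A A' \<Longrightarrow> opeq L B B' \<Longrightarrow> opeq L (madd A B) (madd A' B')"
  by (auto simp: opeq_def madd_def)

lemma opeq_smult: "opeq L A A' \<Longrightarrow> opeq L (smult c A) (smult c A')"
  by (auto simp: opeq_def smult_def)

text \<open>The head of the list acts first. This is the order of \<open>circ_op\<close> and
  \<open>evolution\<close>, so both become instances (\<open>circ_op_oprod\<close>,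
  \<open>evolution_oprod\<close>).\<close>

definition oprod :: "nat \<Rightarrow> op list \<Rightarrow> op" where
  "oprod L As = foldl (\<lambda>U A. mmult L A U) idm As"

lemma oprod_Nil [simp]: "oprod L [] = idm"
  by (simp add: oprod_def)

lemma foldl_mmult: "opeq L (foldl (\<lambda>U A. mmult L A U) B As) (mmult L (oprod L As) B)"
proof (induction As arbitrary: B)
  case Nil
  show ?case unfolding foldl.simps oprod_Nil by (rule opeq_sym[OF mmult_idm_left])
next
  case (Cons A As)
  have "opeq L (oprod L (A # As)) (mmult L (oprod L As) A)"
    unfolding oprod_def foldl.simps
    using opeq_trans[OF Cons.IH[of "mmult L A idm"] opeq_mmult_r[OF mmult_idm_right]]
    by (simp add: oprod_def)
  then have "opeq L (mmult L (oprod L (A # As)) B) (mmult L (mmult L (oprod L As) A) B)"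
    by (rule opeq_mmult_l)
  then have "opeq L (mmult L (oprod L As) (mmult L A B)) (mmult L (oprod L (A # As)) B)"
    unfolding mmult_assoc by (rule opeq_sym)
  with Cons.IH[of "mmult L A B"] show ?case
    unfolding foldl.simps by (rule opeq_trans)
qed

lemma oprod_Cons: "opeq L (oprod L (A # As)) (mmult L (oprod L As) A)"
  using opeq_trans[OF foldl_mmult[of L "mmult L A idm" As] opeq_mmult_r[OF mmult_idm_right]]
  by (simp add: oprod_def)

lemma oprod_append: "opeq L (oprod L (As @ Bs)) (mmult L (oprod L Bs) (oprod L As))"
  using foldl_mmult[of L "oprod L As" Bs] by (simp add: oprod_def)

lemma oprod_single [simp]: "opeq L (oprod L [A]) A"
  by (simp add: oprod_def)

lemma oprod_cong:
  "(\<And>a. a \<in> set as \<Longrightarrow> opeq L (f a) (g a)) \<Longrightarrow> opeq L (oprod L (map f as)) (oprod L (map g as))"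
proof (induction as)
  case (Cons a as)
  have "opeq L (oprod L (f a # map f as)) (mmult L (oprod L (map f as)) (f a))"
    by (rule oprod_Cons)
  also have "opeq L \<dots> (mmult L (oprod L (map g as)) (g a))"
    by (rule opeq_mmult) (use Cons in auto)
  also have "opeq L \<dots> (oprod L (g a # map g as))"
    by (rule opeq_sym[OF oprod_Cons])
  finally show ?case by simp
qed auto

lemma circ_op_oprod: "circ_op L V = oprod L (map gate_op (concat V))"
  by (simp add: circ_op_def oprod_def foldl_map)

text \<open>The sandwiched factors telescope: the second identity cancels \<open>F\<close> against
  \<open>F'\<close> between neighbours, the first one settles the empty product.\<close>

lemma oprod_conj:
  assumes "opeq L (mmult L F' F) idm" "opeq L (mmult L F F') idm"
  shows "opeq L (oprod L (map (\<lambda>a. mmult L F' (mmult L (A a) F)) as))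
    (mmult L F' (mmult L (oprod L (map A as)) F))"
proof (induction as)
  case Nil
  have "opeq L (mmult L F' (mmult L idm F)) (mmult L F' F)"
    by (rule opeq_mmult_r) simp
  with assms(1) have "opeq L (mmult L F' (mmult L idm F)) idm"
    by (rule opeq_trans[rotated])
  then show ?case unfolding list.map oprod_Nil by (rule opeq_sym)
next
  case (Cons a as)
  let ?G = "\<lambda>a. mmult L F' (mmult L (A a) F)" and ?P = "oprod L (map A as)"
  have "opeq L (oprod L (map ?G (a # as))) (mmult L (oprod L (map ?G as)) (?G a))"
    using oprod_Cons by simp
  also have "opeq L \<dots> (mmult L (mmult L F' (mmult L ?P F)) (?G a))"
    by (rule opeq_mmult_l[OF Cons])
  also have "opeq L \<dots> (mmult L F' (mmult L ?P (mmult L (A a) F)))"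
    unfolding mmult_assoc by (intro opeq_mmult_r mmult_cancel assms)
  also have "opeq L \<dots> (mmult L F' (mmult L (oprod L (map A (a # as))) F))"
    using opeq_mmult_r[OF opeq_mmult_l[OF opeq_sym[OF oprod_Cons[of L "A a" "map A as"]]]]
    by (simp add: mmult_assoc)
  finally show ?case .
qed

lemma commute_oprod:
  assumes "\<And>A. A \<in> set As \<Longrightarrow> opeq L (mmult L A B) (mmult L B A)"
  shows "opeq L (mmult L (oprod L As) B) (mmult L B (oprod L As))"
  using assms
proof (induction As)
  case Nil
  show ?case unfolding oprod_Nil by (rule opeq_trans[OF mmult_idm_left opeq_sym[OF mmult_idm_right]])
next
  case (Cons A As)
  have "opeq L (mmult L (oprod L (A # As)) B) (mmult L (oprod L As) (mmult L A B))"
    unfolding mmult_assoc[symmetric] by (rule opeq_mmult_l[OF oprod_Cons])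
  also have "opeq L \<dots> (mmult L (oprod L As) (mmult L B A))"
    by (rule opeq_mmult_r) (use Cons in auto)
  also have "opeq L \<dots> (mmult L B (mmult L (oprod L As) A))"
    unfolding mmult_assoc[symmetric] by (rule opeq_mmult_l) (use Cons in auto)
  also have "opeq L \<dots> (mmult L B (oprod L (A # As)))"
    by (rule opeq_mmult_r[OF opeq_sym[OF oprod_Cons]])
  finally show ?case .
qed

lemma adj_oprod: "opeq L (adj (oprod L As)) (oprod L (map adj (rev As)))"
proof (induction As)
  case (Cons A As)
  have "opeq L (adj (oprod L (A # As))) (mmult L (adj A) (adj (oprod L As)))"
    using opeq_adj[OF oprod_Cons] by (simp add: adj_mmult)
  also have "opeq L \<dots> (mmult L (adj A) (oprod L (map adj (rev As))))"
    by (rule opeq_mmult_r[OF Cons])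
  also have "opeq L \<dots> (oprod L (map adj (rev As) @ [adj A]))"
    by (rule opeq_sym[OF opeq_trans[OF oprod_append opeq_mmult_l[OF oprod_single]]])
  finally show ?case by simp
qed simp

section \<open>Circuits\<close>

text \<open>\<open>A\<close> is a matrix \<open>h\<close> on the qubits in \<open>X\<close> tensored
  with the identity on the others.\<close>

definition local_on :: "site set \<Rightarrow> op \<Rightarrow> bool" where
  "local_on X A \<longleftrightarrow> (\<exists>h. \<forall>T S. A T S = (if T - X = S - X then h (T \<inter> X) (S \<inter> X) else 0))"

lemma local_on_product:
  assumes a: "\<And>T S. A T S = (if T - X = S - X then a (T \<inter> X) (S \<inter> X) else 0)"
    and b: "\<And>T S. B T S = (if T - Y = S - Y then b (T \<inter> Y) (S \<inter> Y) else 0)"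
    and "X \<inter> Y = {}" "T \<subseteq> lattice L" "S \<subseteq> lattice L"
  shows "mmult L A B T S =
    (if T - (X \<union> Y) = S - (X \<union> Y) then a (T \<inter> X) (S \<inter> X) * b (T \<inter> Y) (S \<inter> Y) else 0)"
proof -
  \<comment> \<open>Only one intermediate configuration contributes: \<open>B\<close> acts first and
    changes only \<open>Y\<close>, so on \<open>X\<close> it still agrees with \<open>S\<close>, and
    off \<open>X\<close> it already agrees with \<open>T\<close>.\<close>
  define U0 where "U0 = (T - X) \<union> (S \<inter> X)"
  have eq: "A T U * B U S = (if U = U0 then A T U * B U S else 0)" for U
  proof (cases "T - X = U - X \<and> U - Y = S - Y")
    case True
    then have "U = U0" using assms(3) unfolding U0_def by blast
    then show ?thesis by simp
  qed (auto simp: a b)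
  have "mmult L A B T S = A T U0 * B U0 S"
    unfolding mmult_def by (subst eq) (use assms(4,5) in \<open>auto simp: U0_def\<close>)
  moreover have "T - X = U0 - X" "U0 \<inter> X = S \<inter> X" "U0 \<inter> Y = T \<inter> Y"
    using assms(3) unfolding U0_def by blast+
  moreover have "U0 - Y = S - Y \<longleftrightarrow> T - (X \<union> Y) = S - (X \<union> Y)"
    using assms(3) unfolding U0_def by blast
  ultimately show ?thesis by (auto simp: a b)
qed

lemma local_on_commute:
  assumes "local_on X A" "local_on Y B" "X \<inter> Y = {}"
  shows "opeq L (mmult L A B) (mmult L B A)"
proof -
  obtain a where a: "\<And>T S. A T S = (if T - X = S - X then a (T \<inter> X) (S \<inter> X) else 0)"
    using assms(1) unfolding local_on_def by blast
  obtain b where b: "\<And>T S. B T S = (if T - Y = S - Y then b (T \<inter> Y) (S \<inter> Y) else 0)"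
    using assms(2) unfolding local_on_def by blast
  have YX: "Y \<inter> X = {}" using assms(3) by blast
  show ?thesis
    by (rule opeqI)
      (simp add: local_on_product[OF a b assms(3)] local_on_product[OF b a YX] Un_commute mult.commute)
qed

lemma gate_op_local: "local_on (gate_support g) (gate_op g)"
proof (cases g)
  case (Single q u)
  show ?thesis unfolding local_on_def
    by (rule exI[of _ "\<lambda>T S. u (q \<in> T) (q \<in> S)"]) (simp add: Single)
next
  case (CNOT c t)
  have "(T = (if c \<in> S then S - {t} \<union> ({t} - S) else S)) \<longleftrightarrow>
      T - {c, t} = S - {c, t} \<and>
      T \<inter> {c, t} = (if c \<in> S \<inter> {c, t} then S \<inter> {c, t} - {t} \<union> ({t} - S \<inter> {c, t}) else S \<inter> {c, t})"
    for T S :: cfg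
    by (auto split: if_splits)
  then show ?thesis unfolding local_on_def
    by (intro exI[of _ "\<lambda>T S. if T = (if c \<in> S then S - {t} \<union> ({t} - S) else S) then 1 else 0"])
      (simp add: CNOT)
qed

text \<open>The depth is prescribed exactly while gates are only bounded: parallel composition zips
  two circuits layer by layer and needs equal lengths, which empty layers provide
  (\<open>impl_mono\<close>). The set \<open>X\<close> of touched qubits certifies that zipped
  layers are disjoint.\<close>

definition realizes :: "nat \<Rightarrow> site set \<Rightarrow> nat \<Rightarrow> nat \<Rightarrow> op \<Rightarrow> circuit \<Rightarrow> bool" where
  "realizes L X d g U V \<longleftrightarrow> valid_circuit L V \<and> (\<forall>l\<in>set V. \<forall>a\<in>set l. gate_support a \<subseteq> X) \<and>
     length V = d \<and> gate_count V \<le> g \<and> opeq L (circ_op L V) U"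

definition impl :: "nat \<Rightarrow> site set \<Rightarrow> nat \<Rightarrow> nat \<Rightarrow> op \<Rightarrow> bool" where
  "impl L X d g U \<longleftrightarrow> (\<exists>V. realizes L X d g U V)"

lemma realizesD:
  assumes "realizes L X d g U V"
  shows "valid_circuit L V" "\<forall>l\<in>set V. \<forall>a\<in>set l. gate_support a \<subseteq> X"
    "length V = d" "gate_count V \<le> g" "opeq L (circ_op L V) U"
  using assms by (auto simp only: realizes_def)

lemma impl_cong: "impl L X d g U \<Longrightarrow> opeq L U U' \<Longrightarrow> impl L X d g U'"
  unfolding impl_def realizes_def by (blast intro: opeq_trans)

lemma valid_layer_Nil [simp]: "valid_layer L []"
  by (simp add: valid_layer_def)

lemma impl_mono:
  assumes "impl L X d g U" "X \<subseteq> X'" "d \<le> d'" "g \<le> g'"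
  shows "impl L X' d' g' U"
proof -
  obtain V where "realizes L X d g U V" using assms(1) unfolding impl_def ..
  note V = realizesD[OF this]
  let ?W = "V @ replicate (d' - d) []"
  have "concat ?W = concat V" by simp
  then have "circ_op L ?W = circ_op L V" by (simp add: circ_op_def)
  moreover have "gate_count ?W = gate_count V"
    by (simp add: gate_count_def sum_list_replicate)
  moreover have "gate_support a \<subseteq> X'" if "l \<in> set ?W" "a \<in> set l" for l a
    using that V(2) assms(2) by (cases "l \<in> set V") (blast, auto)
  moreover have "valid_circuit L ?W" "length ?W = d'"
    using V assms by (auto simp: valid_circuit_def)
  ultimately show ?thesis
    unfolding impl_def realizes_def using V(4,5) assms(4) by (intro exI[of _ ?W]) (simp del: set_append)
qed

lemma impl_idm: "impl L X 0 0 idm"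
  unfolding impl_def realizes_def
  by (intro exI[of _ "[]"]) (simp add: valid_circuit_def gate_count_def circ_op_def)

lemma impl_gate:
  assumes "valid_gate L a"
  shows "impl L (gate_support a) 1 1 (gate_op a)"
  unfolding impl_def realizes_def
  by (intro exI[of _ "[[a]]"])
    (use assms in \<open>simp add: valid_circuit_def valid_layer_def gate_count_def circ_op_def\<close>)

lemma impl_seq:
  assumes "impl L X d g U" "impl L X d' g' U'"
  shows "impl L X (d + d') (g + g') (mmult L U' U)"
proof -
  obtain V where "realizes L X d g U V" using assms(1) unfolding impl_def ..
  note V = realizesD[OF this]
  obtain V' where "realizes L X d' g' U' V'" using assms(2) unfolding impl_def ..
  note V' = realizesD[OF this]
  have "opeq L (circ_op L (V @ V')) (mmult L (circ_op L V') (circ_op L V))"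
    using oprod_append[of L "map gate_op (concat V)" "map gate_op (concat V')"]
    by (simp add: circ_op_oprod)
  also have "opeq L \<dots> (mmult L U' U)" by (rule opeq_mmult) (use V V' in auto)
  finally have "opeq L (circ_op L (V @ V')) (mmult L U' U)" .
  moreover have "\<forall>l\<in>set (V @ V'). \<forall>a\<in>set l. gate_support a \<subseteq> X"
    unfolding set_append using V(2) V'(2) by blast
  moreover have "valid_circuit L (V @ V')" "length (V @ V') = d + d'" "gate_count (V @ V') \<le> g + g'"
    using V V' by (auto simp: valid_circuit_def gate_count_def)
  ultimately show ?thesis
    unfolding impl_def realizes_def by blast
qed

lemma valid_layer_sorted_wrt:
  "valid_layer L l \<longleftrightarrow> (\<forall>a\<in>set l. valid_gate L a) \<and>
    sorted_wrt (\<lambda>a b. gate_support a \<inter> gate_support b = {}) l"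
  unfolding valid_layer_def sorted_wrt_iff_nth_less
proof (intro conj_cong refl iffI allI impI)
  fix i j
  assume *: "\<forall>i j. i < j \<longrightarrow> j < length l \<longrightarrow> gate_support (l ! i) \<inter> gate_support (l ! j) = {}"
    "i < length l" "j < length l" "i \<noteq> j"
  show "gate_support (l ! i) \<inter> gate_support (l ! j) = {}"
    using *(1)[rule_format, of i j] *(1)[rule_format, of j i] *(2-4)
    by (cases i j rule: linorder_cases) (simp_all add: Int_commute)
qed simp

lemma valid_layer_append:
  assumes "valid_layer L k" "valid_layer L l"
    "\<And>a b. a \<in> set k \<Longrightarrow> b \<in> set l \<Longrightarrow> gate_support a \<inter> gate_support b = {}"
  shows "valid_layer L (k @ l)"
  using assms unfolding valid_layer_sorted_wrt sorted_wrt_append set_append by blast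

text \<open>Gates on disjoint supports commute, so the first layer of \<open>V\<close> can be
  carried past the whole circuit on \<open>Y\<close>.\<close>

lemma circ_op_parallel:
  assumes "length V = length W"
    "\<forall>l\<in>set V. \<forall>a\<in>set l. gate_support a \<subseteq> X" "\<forall>l\<in>set W. \<forall>a\<in>set l. gate_support a \<subseteq> Y"
    "X \<inter> Y = {}"
  shows "opeq L (circ_op L (map2 (@) V W)) (mmult L (circ_op L V) (circ_op L W))"
  using assms
proof (induction V W rule: list_induct2)
  case Nil
  show ?case by (simp add: circ_op_def opeq_sym[OF mmult_idm_left])
next
  case (Cons k V l W)
  let ?G = "\<lambda>l. oprod L (map gate_op l)"
  have cons: "opeq L (circ_op L (l # V)) (mmult L (circ_op L V) (?G l))" for l V
    using oprod_append[of L "map gate_op l" "map gate_op (concat V)"] by (simp add: circ_op_oprod)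
  have G_W: "opeq L (mmult L (?G k) (circ_op L (l # W))) (mmult L (circ_op L (l # W)) (?G k))"
  proof (rule commute_oprod)
    fix A assume "A \<in> set (map gate_op k)"
    then obtain a where a: "a \<in> set k" "A = gate_op a" by auto
    have "opeq L (mmult L B A) (mmult L A B)"
      if B: "B \<in> set (map gate_op (concat (l # W)))" for B
    proof -
      obtain b where b: "B = gate_op b" "gate_support b \<subseteq> Y"
        using B Cons.prems(2) by auto
      have "gate_support a \<subseteq> X" using a Cons.prems(1) by auto
      with b have "gate_support b \<inter> gate_support a = {}" using Cons.prems(3) by blast
      then show ?thesis
        unfolding a b by (rule local_on_commute[OF gate_op_local gate_op_local])
    qed
    then have "opeq L (mmult L (circ_op L (l # W)) A) (mmult L A (circ_op L (l # W)))"
      unfolding circ_op_oprod by (rule commute_oprod)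
    then show "opeq L (mmult L A (circ_op L (l # W))) (mmult L (circ_op L (l # W)) A)"
      by (rule opeq_sym)
  qed
  have "opeq L (circ_op L (map2 (@) (k # V) (l # W)))
      (mmult L (circ_op L (map2 (@) V W)) (?G (k @ l)))"
    using cons[of "k @ l" "map2 (@) V W"] by simp
  also have "opeq L \<dots> (mmult L (mmult L (circ_op L V) (circ_op L W)) (mmult L (?G l) (?G k)))"
  proof (rule opeq_mmult)
    show "opeq L (circ_op L (map2 (@) V W)) (mmult L (circ_op L V) (circ_op L W))"
      by (rule Cons.IH) (use Cons.prems in auto)
    show "opeq L (?G (k @ l)) (mmult L (?G l) (?G k))"
      using oprod_append by simp
  qed
  also have "\<dots> = mmult L (circ_op L V) (mmult L (mmult L (circ_op L W) (?G l)) (?G k))"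
    by (simp add: mmult_assoc)
  also have "opeq L \<dots> (mmult L (circ_op L V) (mmult L (circ_op L (l # W)) (?G k)))"
    by (intro opeq_mmult_r opeq_mmult_l opeq_sym[OF cons])
  also have "opeq L \<dots> (mmult L (circ_op L V) (mmult L (?G k) (circ_op L (l # W))))"
    by (intro opeq_mmult_r opeq_sym[OF G_W])
  also have "opeq L \<dots> (mmult L (circ_op L (k # V)) (circ_op L (l # W)))"
    unfolding mmult_assoc[symmetric] by (intro opeq_mmult_l opeq_sym[OF cons])
  finally show ?case .
qed

lemma impl_par:
  assumes "impl L X d g U" "impl L Y d g' U'" "X \<inter> Y = {}"
  shows "impl L (X \<union> Y) d (g + g') (mmult L U U')"
proof -
  obtain V where "realizes L X d g U V" using assms(1) unfolding impl_def ..
  note V = realizesD[OF this]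
  obtain W where "realizes L Y d g' U' W" using assms(2) unfolding impl_def ..
  note W = realizesD[OF this]
  let ?Z = "map2 (@) V W"
  have len: "length V = length W" using V W by simp
  have "opeq L (circ_op L ?Z) (mmult L (circ_op L V) (circ_op L W))"
    by (rule circ_op_parallel[OF len V(2) W(2) assms(3)])
  also have "opeq L \<dots> (mmult L U U')" by (rule opeq_mmult) (use V W in auto)
  finally have op: "opeq L (circ_op L ?Z) (mmult L U U')" .
  have valid: "valid_circuit L ?Z"
    unfolding valid_circuit_def
  proof
    fix z assume "z \<in> set ?Z"
    then obtain k l where kl: "z = k @ l" "k \<in> set V" "l \<in> set W"
      by (auto dest: set_zip_leftD set_zip_rightD)
    show "valid_layer L z" unfolding kl
    proof (rule valid_layer_append)
      show "valid_layer L k" "valid_layer L l" using kl V W by (auto simp: valid_circuit_def)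
      fix a b assume "a \<in> set k" "b \<in> set l"
      then have "gate_support a \<subseteq> X" "gate_support b \<subseteq> Y" using kl V W by auto
      then show "gate_support a \<inter> gate_support b = {}" using assms(3) by blast
    qed
  qed
  have supp: "\<forall>l\<in>set ?Z. \<forall>a\<in>set l. gate_support a \<subseteq> X \<union> Y"
  proof (intro ballI)
    fix z a assume "z \<in> set ?Z" and a: "a \<in> set z"
    then obtain k l where kl: "z = k @ l" "k \<in> set V" "l \<in> set W"
      by (auto dest: set_zip_leftD set_zip_rightD)
    with a have "a \<in> set k \<or> a \<in> set l" by simp
    with kl V(2) W(2) show "gate_support a \<subseteq> X \<union> Y" by blast
  qed
  have "gate_count ?Z = gate_count V + gate_count W"
    using len by (induction V W rule: list_induct2) (auto simp: gate_count_def)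
  then show ?thesis
    unfolding impl_def realizes_def using V(3,4) W(3,4) valid supp op by (intro exI[of _ ?Z]) simp
qed

lemma impl_par_list:
  assumes "\<And>j. j \<in> set js \<Longrightarrow> impl L (X j) d g (U j)" "distinct js"
    "\<And>i j. i \<in> set js \<Longrightarrow> j \<in> set js \<Longrightarrow> i \<noteq> j \<Longrightarrow> X i \<inter> X j = {}"
  shows "impl L (\<Union>j\<in>set js. X j) d (length js * g) (oprod L (map U js))"
  using assms
proof (induction js)
  case Nil
  show ?case using impl_mono[OF impl_idm] by simp
next
  case (Cons j js)
  have "impl L ((\<Union>j\<in>set js. X j) \<union> X j) d (length js * g + g) (mmult L (oprod L (map U js)) (U j))"
  proof (rule impl_par)
    show "impl L (\<Union>j\<in>set js. X j) d (length js * g) (oprod L (map U js))"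
      by (rule Cons.IH) (use Cons.prems in auto)
    show "impl L (X j) d g (U j)" using Cons.prems by auto
    show "(\<Union>j\<in>set js. X j) \<inter> X j = {}" using Cons.prems(2) Cons.prems(3)[of _ j] by force
  qed
  then have "impl L ((\<Union>j\<in>set js. X j) \<union> X j) d (length js * g + g) (oprod L (map U (j # js)))"
    by (rule impl_cong) (simp add: opeq_sym[OF oprod_Cons])
  then show ?case by (rule impl_mono) auto
qed

section \<open>Two-qubit operators\<close>

text \<open>The arguments of \<open>M\<close> are the bits of \<open>x\<close>, \<open>y\<close> in
  the row configuration, followed by those in the column configuration.\<close>

definition tq :: "site \<Rightarrow> site \<Rightarrow> (bool \<Rightarrow> bool \<Rightarrow> bool \<Rightarrow> bool \<Rightarrow> complex) \<Rightarrow> op" where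
  "tq x y M T S = (if T - {x, y} = S - {x, y} then M (x \<in> T) (y \<in> T) (x \<in> S) (y \<in> S) else 0)"

lemma tq_mmult:
  assumes "x \<noteq> y" "x \<in> lattice L" "y \<in> lattice L"
  shows "opeq L (mmult L (tq x y M) (tq x y M'))
    (tq x y (\<lambda>a b c d. \<Sum>e\<in>UNIV. \<Sum>f\<in>UNIV. M a b e f * M' e f c d))"
proof (rule opeqI)
  fix T S assume TS: "T \<subseteq> lattice L" "S \<subseteq> lattice L"
  \<comment> \<open>\<open>put\<close> lists the four configurations that agree with
    \<open>T\<close> off the two qubits; the sum over intermediate configurations collapses to
    them.\<close>
  define put where "put = (\<lambda>(e, f). T - {x, y} \<union> (if e then {x} else {}) \<union> (if f then {y} else {}))"
  have put: "put p - {x, y} = T - {x, y}" "x \<in> put p \<longleftrightarrow> fst p" "y \<in> put p \<longleftrightarrow> snd p" for p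
    using assms(1) by (auto simp: put_def split: prod.splits if_splits)
  have inj: "inj put"
  proof (rule injI)
    fix p q assume "put p = put q"
    then show "p = q" using put(2,3)[of p] put(2,3)[of q] by (simp add: prod_eq_iff)
  qed
  have range: "U \<in> range put" if "T - {x, y} = U - {x, y}" for U
  proof -
    have "U = put (x \<in> U, y \<in> U)" using that by (auto simp: put_def)
    then show ?thesis by blast
  qed
  have sub: "range put \<subseteq> Pow (lattice L)"
    using TS assms by (auto simp: put_def split: if_splits)
  have "mmult L (tq x y M) (tq x y M') T S = (\<Sum>U\<in>range put. tq x y M T U * tq x y M' U S)"
    unfolding mmult_def
    by (rule sum.mono_neutral_right) (use sub range in \<open>auto simp: tq_def\<close>)
  also have "\<dots> = (\<Sum>p\<in>UNIV. tq x y M T (put p) * tq x y M' (put p) S)"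
    by (simp add: sum.reindex[OF inj])
  also have "\<dots> = (\<Sum>(e, f)\<in>UNIV \<times> UNIV. tq x y M T (put (e, f)) * tq x y M' (put (e, f)) S)"
    by (simp add: case_prod_beta)
  also have "\<dots> = tq x y (\<lambda>a b c d. \<Sum>e\<in>UNIV. \<Sum>f\<in>UNIV. M a b e f * M' e f c d) T S"
    by (subst sum.cartesian_product[symmetric]) (auto simp: tq_def put)
  finally show "mmult L (tq x y M) (tq x y M') T S
    = tq x y (\<lambda>a b c d. \<Sum>e\<in>UNIV. \<Sum>f\<in>UNIV. M a b e f * M' e f c d) T S" .
qed

section \<open>Two-by-two matrices and controlled gates\<close>

type_synonym mat2 = "bool \<Rightarrow> bool \<Rightarrow> complex"

definition m2 :: "mat2 \<Rightarrow> mat2 \<Rightarrow> mat2" where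
  "m2 A B a b = (\<Sum>j\<in>UNIV. A a j * B j b)"

definition adj2 :: "mat2 \<Rightarrow> mat2" where
  "adj2 A a b = cnj (A b a)"

definition diag2 :: "(bool \<Rightarrow> complex) \<Rightarrow> mat2" where
  "diag2 d a b = (if a = b then d a else 0)"

text \<open>Orthonormality of the columns and of the rows are both required, so that either inverse
  relation can be read off without a dimension argument.\<close>

definition U2 :: "mat2 \<Rightarrow> bool" where
  "U2 V \<longleftrightarrow> unitary2 V \<and> unitary2 (adj2 V)"

definition dg :: "mat2 \<Rightarrow> (bool \<Rightarrow> complex) \<Rightarrow> mat2" where
  "dg V d = m2 V (m2 (diag2 d) (adj2 V))"

text \<open>Unitary matrices presented with a diagonalisation. The eigenvectors are what lets a
  controlled version be built from a diagonal gate in \<open>impl_blk\<close>.\<close>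

definition dgl :: "mat2 \<Rightarrow> bool" where
  "dgl B \<longleftrightarrow> (\<exists>V \<phi>. U2 V \<and> B = dg V (\<lambda>j. cis (\<phi> j)))"

text \<open>A gate on the first qubit selected by the second: \<open>u\<close> if it is 0,
  \<open>v\<close> if it is 1.\<close>

definition mux :: "mat2 \<Rightarrow> mat2 \<Rightarrow> bool \<Rightarrow> bool \<Rightarrow> bool \<Rightarrow> bool \<Rightarrow> complex" where
  "mux u v a b c d = (if b = d then (if b then v else u) a c else 0)"

text \<open>The operators that preserve the joint parity: \<open>Be\<close> and \<open>Bo\<close>
  act in the even and the odd sector, where the bit of \<open>x\<close> serves as
  coordinate.\<close>

definition blk :: "site \<Rightarrow> site \<Rightarrow> mat2 \<Rightarrow> mat2 \<Rightarrow> op" where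
  "blk x y Be Bo = tq x y (\<lambda>a b c d. if (a = b) = (c = d) then (if a = b then Be else Bo) a c else 0)"

lemma adj2_adj2 [simp]: "adj2 (adj2 V) = V"
  by (simp add: adj2_def fun_eq_iff)

lemma U2_adj2 [simp]: "U2 (adj2 V) \<longleftrightarrow> U2 V"
  by (auto simp: U2_def)

lemma m2_assoc: "m2 (m2 A B) C = m2 A (m2 B C)"
  by (intro ext) (simp add: m2_def UNIV_bool algebra_simps)

lemma m2_diag2 [simp]: "m2 (diag2 d) (diag2 e) = diag2 (\<lambda>j. d j * e j)"
  by (intro ext) (auto simp: m2_def diag2_def UNIV_bool)

lemma m2_one [simp]: "m2 (diag2 (\<lambda>_. 1)) A = A" "m2 A (diag2 (\<lambda>_. 1)) = A"
  by (auto simp: fun_eq_iff m2_def diag2_def UNIV_bool)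

lemma m2_adj2_left:
  assumes "U2 V" shows "m2 (adj2 V) V = diag2 (\<lambda>_. 1)"
proof (intro ext)
  fix a b
  have "(\<Sum>c\<in>UNIV. V c b * cnj (V c a)) = (if b = a then 1 else 0)"
    using assms by (simp add: U2_def unitary2_def)
  then show "m2 (adj2 V) V a b = diag2 (\<lambda>_. 1) a b"
    by (simp add: m2_def adj2_def diag2_def mult.commute eq_commute)
qed

lemma m2_adj2_right:
  assumes "U2 V" shows "m2 V (adj2 V) = diag2 (\<lambda>_. 1)"
  using m2_adj2_left[of "adj2 V"] assms by simp

lemma m2_cancel:
  assumes "U2 V" shows "m2 V (m2 (adj2 V) A) = A" "m2 (adj2 V) (m2 V A) = A"
  using assms by (simp_all add: m2_assoc[symmetric] m2_adj2_left m2_adj2_right)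

lemma dg_one: "U2 V \<Longrightarrow> dg V (\<lambda>_. 1) = diag2 (\<lambda>_. 1)"
  by (simp add: dg_def m2_adj2_right)

lemma dg_m2: "U2 V \<Longrightarrow> m2 (dg V d) (dg V e) = dg V (\<lambda>j. d j * e j)"
  unfolding dg_def by (simp add: m2_assoc m2_cancel)
    (simp add: m2_assoc[symmetric])

lemma dist_l1_neq: "dist_l1 x y = 1 \<Longrightarrow> x \<noteq> y"
  by (auto simp: dist_l1_def ndist_def split: prod.splits)

lemma dist_l1_commute: "dist_l1 x y = dist_l1 y x"
  by (auto simp: dist_l1_def ndist_def split: prod.splits)

lemma gate_op_Single_tq:
  assumes "x \<noteq> y"
  shows "gate_op (Single x u) = tq x y (mux u u)"
proof (intro ext)
  fix T S
  have "T - {x} = S - {x} \<longleftrightarrow> T - {x, y} = S - {x, y} \<and> (y \<in> T \<longleftrightarrow> y \<in> S)"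
    using assms by blast
  then show "gate_op (Single x u) T S = tq x y (mux u u) T S"
    by (simp add: tq_def mux_def)
qed

lemma gate_op_CNOT_tq:
  assumes "x \<noteq> y"
  shows "gate_op (CNOT x y) = tq x y (\<lambda>a b c d. if a = c \<and> b = (d \<noteq> c) then 1 else 0)"
    (is "?A = ?B")
proof (intro ext)
  fix T S
  have "(T = (if x \<in> S then S - {y} \<union> ({y} - S) else S)) \<longleftrightarrow>
     T - {x, y} = S - {x, y} \<and> (x \<in> T \<longleftrightarrow> x \<in> S) \<and> (y \<in> T \<longleftrightarrow> (y \<in> S) \<noteq> (x \<in> S))"
    using assms by (cases "x \<in> S"; cases "y \<in> S") auto
  then show "?A T S = ?B T S"
    by (simp add: tq_def)
qed

lemma tq_commute: "tq x y M = tq y x (\<lambda>a b c d. M b a d c)"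
  by (simp add: tq_def fun_eq_iff insert_commute)

lemma tq_mux_mmult:
  assumes "x \<noteq> y" "x \<in> lattice L" "y \<in> lattice L"
  shows "opeq L (mmult L (tq x y (mux u v)) (tq x y (mux u' v'))) (tq x y (mux (m2 u u') (m2 v v')))"
proof -
  have "(\<lambda>a b c d. \<Sum>e\<in>UNIV. \<Sum>f\<in>UNIV. mux u v a b e f * mux u' v' e f c d) = mux (m2 u u') (m2 v v')"
    by (intro ext) (auto simp: mux_def m2_def UNIV_bool)
  then show ?thesis using tq_mmult[OF assms, of "mux u v" "mux u' v'"] by simp
qed

lemma impl_tq_Single:
  assumes "x \<noteq> y" "x \<in> lattice L" "U2 u"
  shows "impl L {x, y} 1 1 (tq x y (mux u u))"
proof -
  have "impl L {x} 1 1 (gate_op (Single x u))"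
    using impl_gate[of L "Single x u"] assms by (simp add: U2_def)
  then show ?thesis unfolding gate_op_Single_tq[OF assms(1)] by (rule impl_mono) auto
qed

lemma U2_diag2: "(\<And>j. d j * cnj (d j) = 1) \<Longrightarrow> U2 (diag2 d)"
  by (auto simp: U2_def unitary2_def adj2_def diag2_def UNIV_bool mult.commute)

lemma impl_tq_seq:
  assumes "x \<noteq> y" "x \<in> lattice L" "y \<in> lattice L"
    "impl L {x, y} d g (tq x y M)" "impl L {x, y} d' g' (tq x y M')"
  shows "impl L {x, y} (d + d') (g + g')
    (tq x y (\<lambda>a b c d. \<Sum>e\<in>UNIV. \<Sum>f\<in>UNIV. M' a b e f * M e f c d))"
  using impl_cong[OF impl_seq[OF assms(4,5)] tq_mmult[OF assms(1-3)]] .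

lemma impl_mux_seq:
  assumes "x \<noteq> y" "x \<in> lattice L" "y \<in> lattice L"
    "impl L {x, y} d g (tq x y (mux u v))" "impl L {x, y} d' g' (tq x y (mux u' v'))"
  shows "impl L {x, y} (d + d') (g + g') (tq x y (mux (m2 u' u) (m2 v' v)))"
  using impl_cong[OF impl_seq[OF assms(4,5)] tq_mux_mmult[OF assms(1-3)]] .

definition cnot2 :: "bool \<Rightarrow> bool \<Rightarrow> bool \<Rightarrow> bool \<Rightarrow> complex" where
  "cnot2 a b c d = (if a = c \<and> b = (d \<noteq> c) then 1 else 0)"

definition cnot2' :: "bool \<Rightarrow> bool \<Rightarrow> bool \<Rightarrow> bool \<Rightarrow> complex" where
  "cnot2' a b c d = (if b = d \<and> a = (c \<noteq> d) then 1 else 0)"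

lemma impl_cnot2:
  assumes "dist_l1 x y = 1" "x \<in> lattice L" "y \<in> lattice L"
  shows "impl L {x, y} 1 1 (tq x y cnot2)" "impl L {x, y} 1 1 (tq x y cnot2')"
proof -
  have ne: "x \<noteq> y" using assms(1) by (rule dist_l1_neq)
  have "gate_op (CNOT x y) = tq x y cnot2"
    using gate_op_CNOT_tq[OF ne] by (simp add: cnot2_def[abs_def])
  then show "impl L {x, y} 1 1 (tq x y cnot2)"
    using impl_gate[of L "CNOT x y"] assms by simp
  have "gate_op (CNOT y x) = tq x y cnot2'"
    using gate_op_CNOT_tq[of y x] ne by (simp add: cnot2'_def[abs_def] tq_commute[of y x])
  then show "impl L {x, y} 1 1 (tq x y cnot2')"
    using impl_gate[of L "CNOT y x"] assms by (simp add: dist_l1_commute[of y x] insert_commute)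
qed

lemma cnj_cis_cancel [simp]: "cis t * cnj (cis t) = 1"
  by (simp add: cis_cnj cis_mult)

text \<open>Up to a global phase, the phase of a diagonal two-qubit gate is a real combination of
  the bits \<open>a\<close>, \<open>b\<close> and \<open>a + b mod 2\<close>.\<close>
lemma impl_diag:
  assumes "dist_l1 x y = 1" "x \<in> lattice L" "y \<in> lattice L"
  shows "impl L {x, y} 5 5 (tq x y (mux (diag2 (\<lambda>a. cis (\<phi> a))) (diag2 (\<lambda>a. cis (\<psi> a)))))"
proof -
  have ne: "x \<noteq> y" using assms(1) by (rule dist_l1_neq)
  \<comment> \<open>The phase at bits \<open>a\<close>, \<open>b\<close> is to be
    \<open>\<phi> False\<close>, plus \<open>B\<close> for \<open>a\<close>, \<open>A\<close> for
    \<open>b\<close> and \<open>C\<close> for their sum mod 2; these values solve the three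
    remaining equations.\<close>
  define C where "C = (\<phi> True + \<psi> False - \<psi> True - \<phi> False) / 2"
  define B where "B = \<phi> True - \<phi> False - C"
  define A where "A = \<psi> False - \<phi> False - C"
  let ?Py = "diag2 (\<lambda>b. cis (\<phi> False + (if b then A else 0)))"
  let ?P = "\<lambda>r. diag2 (\<lambda>b. cis (if b then r else 0))"
  note seq = impl_tq_seq[OF ne assms(2,3)]
  have "impl L {y, x} 1 1 (tq y x (mux ?Py ?Py))"
    by (rule impl_tq_Single) (use ne assms in \<open>auto intro: U2_diag2\<close>)
  then have 1: "impl L {x, y} 1 1 (tq x y (\<lambda>a b c d. mux ?Py ?Py b a d c))"
    by (simp add: insert_commute tq_commute[of y x])
  have 2: "impl L {x, y} 1 1 (tq x y (mux (?P r) (?P r)))" for r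
    by (rule impl_tq_Single) (use ne assms in \<open>auto intro: U2_diag2\<close>)
  note all = seq[OF seq[OF seq[OF seq[OF 1 2[of B]] impl_cnot2(2)[OF assms]] 2[of C]] impl_cnot2(2)[OF assms]]
  have "\<phi> True = \<phi> False + B + C" "\<psi> False = \<phi> False + A + C" "\<psi> True = \<phi> False + A + B"
    by (auto simp: A_def B_def C_def field_simps)
  note angles = this
  have eq: "mux (diag2 (\<lambda>a. cis (\<phi> a))) (diag2 (\<lambda>a. cis (\<psi> a))) = (\<lambda>a b c d.
    \<Sum>e\<in>UNIV. \<Sum>f\<in>UNIV. cnot2' a b e f *
      (\<Sum>e'\<in>UNIV. \<Sum>f'\<in>UNIV. mux (?P C) (?P C) e f e' f' *
        (\<Sum>e\<in>UNIV. \<Sum>f\<in>UNIV. cnot2' e' f' e f *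
          (\<Sum>e'\<in>UNIV. \<Sum>f'\<in>UNIV. mux (?P B) (?P B) e f e' f' *
              mux ?Py ?Py f' e' d c))))" (is "?l = ?r")
  proof (intro ext)
    fix a b c d
    show "?l a b c d = ?r a b c d"
      by (cases a; cases b; cases c; cases d)
        (simp_all add: cnot2'_def mux_def diag2_def UNIV_bool cis_mult algebra_simps angles)
  qed
  have "impl L {x, y} (1 + 1 + 1 + 1 + 1) (1 + 1 + 1 + 1 + 1)
      (tq x y (mux (diag2 (\<lambda>a. cis (\<phi> a))) (diag2 (\<lambda>a. cis (\<psi> a)))))"
    unfolding eq by (rule all)
  then show ?thesis by (simp add: numeral_eq_Suc)
qed

text \<open>A CNOT from \<open>x\<close> to \<open>y\<close> writes the joint parity onto
  \<open>y\<close>, which turns the block operator into \<open>Be\<close> or \<open>Bo\<close> on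
  \<open>x\<close> selected by \<open>y\<close>. Controlling \<open>dg V\<close> only requires
  controlling its diagonal factor, because \<open>V\<close> and its adjoint cancel when that factor
  is the identity. This gives two CNOTs and twice 1 + 5 + 1 gates, 16 in all.\<close>

lemma impl_blk:
  assumes "dist_l1 x y = 1" "x \<in> lattice L" "y \<in> lattice L" "dgl Be" "dgl Bo"
  shows "impl L {x, y} 16 16 (blk x y Be Bo)"
proof -
  have ne: "x \<noteq> y" using assms(1) by (rule dist_l1_neq)
  obtain V \<phi> where V: "U2 V" "Be = dg V (\<lambda>j. cis (\<phi> j))" using assms(4) by (auto simp: dgl_def)
  obtain W \<psi> where W: "U2 W" "Bo = dg W (\<lambda>j. cis (\<psi> j))" using assms(5) by (auto simp: dgl_def)
  note seq = impl_mux_seq[OF ne assms(2,3)]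
  note single = impl_tq_Single[OF ne assms(2)]
  note diag = impl_diag[OF assms(1-3)]
  have e: "impl L {x, y} (1 + 5 + 1) (1 + 5 + 1) (tq x y (mux Be (diag2 (\<lambda>_. 1))))"
    using seq[OF seq[OF single[of "adj2 V"] diag[of \<phi> "\<lambda>_. 0"]] single[of V]] V
    by (simp add: dg_def m2_adj2_right)
  have o: "impl L {x, y} (1 + 5 + 1) (1 + 5 + 1) (tq x y (mux (diag2 (\<lambda>_. 1)) Bo))"
    using seq[OF seq[OF single[of "adj2 W"] diag[of "\<lambda>_. 0" \<psi>]] single[of W]] W
    by (simp add: dg_def m2_adj2_right)
  have m: "impl L {x, y} (7 + 7) (7 + 7) (tq x y (mux Be Bo))"
    using seq[OF e o] by simp
  note all = impl_tq_seq[OF ne assms(2,3) impl_tq_seq[OF ne assms(2,3) impl_cnot2(1)[OF assms(1-3)] m]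
      impl_cnot2(1)[OF assms(1-3)]]
  have "(if (a = b) = (c = d) then (if a = b then Be else Bo) a c else 0) =
    (\<Sum>e\<in>UNIV. \<Sum>f\<in>UNIV. cnot2 a b e f * (\<Sum>e'\<in>UNIV. \<Sum>f'\<in>UNIV. mux Be Bo e f e' f' * cnot2 e' f' c d))"
    for a b c d
    by (cases a; cases b; cases c; cases d) (simp_all add: cnot2_def mux_def UNIV_bool)
  then show ?thesis using all unfolding blk_def by simp
qed

definition dgop :: "(cfg \<Rightarrow> complex) \<Rightarrow> op" where
  "dgop f T S = (if T = S then f S else 0)"

lemma impl_cz:
  assumes "dist_l1 x y = 1" "x \<in> lattice L" "y \<in> lattice L"
  shows "impl L {x, y} 5 5 (dgop (\<lambda>S. if x \<in> S \<and> y \<in> S then -1 else 1))"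
proof -
  have ne: "x \<noteq> y" using assms(1) by (rule dist_l1_neq)
  have "dgop (\<lambda>S. if x \<in> S \<and> y \<in> S then -1 else 1) T S =
    tq x y (mux (diag2 (\<lambda>a. cis 0)) (diag2 (\<lambda>a. cis (if a then pi else 0)))) T S" for T S
  proof -
    have "T = S \<longleftrightarrow> T - {x, y} = S - {x, y} \<and> (x \<in> T \<longleftrightarrow> x \<in> S) \<and> (y \<in> T \<longleftrightarrow> y \<in> S)"
      by blast
    then show ?thesis by (auto simp: dgop_def tq_def mux_def diag2_def)
  qed
  then have "dgop (\<lambda>S. if x \<in> S \<and> y \<in> S then -1 else 1) =
    tq x y (mux (diag2 (\<lambda>a. cis 0)) (diag2 (\<lambda>a. cis (if a then pi else 0))))" by blast
  then show ?thesis using impl_diag[OF assms, of "\<lambda>_. 0" "\<lambda>a. if a then pi else 0"] by simp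
qed

section \<open>CNOT chains\<close>

definition permop :: "(cfg \<Rightarrow> cfg) \<Rightarrow> op" where
  "permop f T S = (if T = f S then 1 else 0)"

lemma mmult_dgop_left: "T \<subseteq> lattice L \<Longrightarrow> mmult L (dgop f) A T S = f T * A T S"
proof -
  assume "T \<subseteq> lattice L"
  moreover have "mmult L (dgop f) A T S = (\<Sum>U\<in>Pow (lattice L). if U = T then f T * A T S else 0)"
    unfolding mmult_def dgop_def by (intro sum.cong) auto
  ultimately show ?thesis by simp
qed

lemma mmult_dgop_right: "S \<subseteq> lattice L \<Longrightarrow> mmult L A (dgop f) T S = A T S * f S"
proof -
  assume "S \<subseteq> lattice L"
  moreover have "mmult L A (dgop f) T S = (\<Sum>U\<in>Pow (lattice L). if U = S then A T S * f S else 0)"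
    unfolding mmult_def dgop_def by (intro sum.cong) auto
  ultimately show ?thesis by simp
qed

lemma mmult_permop_right: "f S \<subseteq> lattice L \<Longrightarrow> mmult L A (permop f) T S = A T (f S)"
proof -
  assume "f S \<subseteq> lattice L"
  moreover have "mmult L A (permop f) T S = (\<Sum>U\<in>Pow (lattice L). if U = f S then A T U else 0)"
    unfolding mmult_def permop_def by (intro sum.cong) auto
  ultimately show ?thesis by simp
qed

lemma dgop_mmult: "opeq L (mmult L (dgop f) (dgop g)) (dgop (\<lambda>S. f S * g S))"
  by (rule opeqI) (simp add: mmult_dgop_left, simp add: dgop_def)

lemma dgop_one: "dgop (\<lambda>_. 1) = idm"
  by (auto simp: dgop_def idm_def fun_eq_iff)

lemma oprod_dgop:
  "distinct js \<Longrightarrow>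
    opeq L (oprod L (map (\<lambda>j. dgop (f j)) js)) (dgop (\<lambda>S. \<Prod>j\<in>set js. f j S))"
proof (induction js)
  case Nil
  show ?case by (simp add: dgop_one)
next
  case (Cons j js)
  have "opeq L (oprod L (dgop (f j) # map (\<lambda>j. dgop (f j)) js))
      (mmult L (oprod L (map (\<lambda>j. dgop (f j)) js)) (dgop (f j)))"
    by (rule oprod_Cons)
  also have "opeq L \<dots> (mmult L (dgop (\<lambda>S. \<Prod>j\<in>set js. f j S)) (dgop (f j)))"
    by (rule opeq_mmult_l) (use Cons in auto)
  also have "opeq L \<dots> (dgop (\<lambda>S. (\<Prod>j\<in>set js. f j S) * f j S))"
    by (rule dgop_mmult)
  finally show ?case using Cons.prems by (simp add: mult.commute)
qed

lemma dgop_permop: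
  assumes "\<And>S. S \<subseteq> lattice L \<Longrightarrow> f S \<subseteq> lattice L"
  shows "opeq L (mmult L (dgop g) (permop f)) (mmult L (permop f) (dgop (\<lambda>S. g (f S))))"
  by (rule opeqI) (simp add: mmult_dgop_left mmult_dgop_right, simp add: permop_def)

lemma permop_mmult:
  assumes "\<And>S. S \<subseteq> lattice L \<Longrightarrow> g S \<subseteq> lattice L"
  shows "opeq L (mmult L (permop f) (permop g)) (permop (\<lambda>S. f (g S)))"
  by (rule opeqI) (simp add: mmult_permop_right assms, simp add: permop_def)

text \<open>The uncomputation is recorded as an operator \<open>C\<close> with a circuit of the same
  cost, because the map is always used in a conjugation: \<open>C\<close> undoes it after a diagonal
  sign has been pulled through.\<close>

definition rev_impl :: "nat \<Rightarrow> site set \<Rightarrow> nat \<Rightarrow> nat \<Rightarrow> (cfg \<Rightarrow> cfg) \<Rightarrow> bool" where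
  "rev_impl L X d g f \<longleftrightarrow> (\<forall>S. S \<subseteq> lattice L \<longrightarrow> f S \<subseteq> lattice L) \<and>
     (\<exists>C. impl L X d g (permop f) \<and> impl L X d g C \<and> opeq L (mmult L C (permop f)) idm)"

lemma rev_implI:
  assumes "\<And>S. S \<subseteq> lattice L \<Longrightarrow> f S \<subseteq> lattice L" "impl L X d g (permop f)" "impl L X d g C"
    "opeq L (mmult L C (permop f)) idm"
  shows "rev_impl L X d g f"
  unfolding rev_impl_def using assms(1) by (intro conjI exI[of _ C] assms(2-4)) simp

lemma mmult_inverse_pair:
  assumes "opeq L (mmult L C A) idm" "opeq L (mmult L D B) idm"
  shows "opeq L (mmult L (mmult L C D) (mmult L B A)) idm"
  using opeq_trans[OF opeq_mmult_r[OF mmult_cancel[OF assms(2)]] assms(1)]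
  by (simp add: mmult_assoc)

lemma rev_implE:
  assumes "rev_impl L X d g f"
  obtains C where "impl L X d g (permop f)" "impl L X d g C" "opeq L (mmult L C (permop f)) idm"
    "\<And>S. S \<subseteq> lattice L \<Longrightarrow> f S \<subseteq> lattice L"
  using assms unfolding rev_impl_def by blast

text \<open>The inverse composes in the opposite order, hence the two hypotheses \<open>left\<close>
  and \<open>right\<close>; sequential and parallel composition are the two instances.\<close>

lemma rev_impl_combine:
  assumes "rev_impl L X d g f" "rev_impl L Y d' g' f'"
    and left: "\<And>U U'. impl L X d g U \<Longrightarrow> impl L Y d' g' U' \<Longrightarrow> impl L Z e h (mmult L U' U)"
    and right: "\<And>U U'. impl L X d g U \<Longrightarrow> impl L Y d' g' U' \<Longrightarrow> impl L Z e h (mmult L U U')"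
  shows "rev_impl L Z e h (\<lambda>S. f' (f S))"
proof -
  obtain C where C: "impl L X d g (permop f)" "impl L X d g C" "opeq L (mmult L C (permop f)) idm"
    "\<And>S. S \<subseteq> lattice L \<Longrightarrow> f S \<subseteq> lattice L"
    using assms(1) by (rule rev_implE) blast
  obtain C' where C': "impl L Y d' g' (permop f')" "impl L Y d' g' C'"
    "opeq L (mmult L C' (permop f')) idm" "\<And>S. S \<subseteq> lattice L \<Longrightarrow> f' S \<subseteq> lattice L"
    using assms(2) by (rule rev_implE) blast
  have pm: "opeq L (mmult L (permop f') (permop f)) (permop (\<lambda>S. f' (f S)))"
    by (rule permop_mmult[OF C(4)])
  have inv: "opeq L (mmult L (mmult L C C') (permop (\<lambda>S. f' (f S)))) idm"
    using opeq_trans[OF opeq_mmult_r[OF opeq_sym[OF pm]] mmult_inverse_pair[OF C(3) C'(3)]] .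
  show ?thesis
    by (rule rev_implI[OF _ impl_cong[OF left[OF C(1) C'(1)] pm] right[OF C(2) C'(2)] inv])
      (rule C'(4)[OF C(4)])
qed

lemma rev_impl_seq:
  assumes "rev_impl L X d g f" "rev_impl L X d' g' f'"
  shows "rev_impl L X (d + d') (g + g') (\<lambda>S. f' (f S))"
proof (rule rev_impl_combine[OF assms])
  fix U U' assume U: "impl L X d g U" "impl L X d' g' U'"
  show "impl L X (d + d') (g + g') (mmult L U' U)" by (rule impl_seq[OF U])
  show "impl L X (d + d') (g + g') (mmult L U U')"
    using impl_seq[OF U(2,1)] by (simp add: add.commute)
qed

lemma rev_impl_par:
  assumes "rev_impl L X d g f" "rev_impl L Y d g' f'" "X \<inter> Y = {}"
  shows "rev_impl L (X \<union> Y) d (g + g') (\<lambda>S. f' (f S))"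
proof (rule rev_impl_combine[OF assms(1,2)])
  fix U U' assume U: "impl L X d g U" "impl L Y d g' U'"
  show "impl L (X \<union> Y) d (g + g') (mmult L U U')" by (rule impl_par[OF U assms(3)])
  show "impl L (X \<union> Y) d (g + g') (mmult L U' U)"
    using impl_par[OF U(2,1)] assms(3) by (simp add: Un_commute Int_commute add.commute)
qed

lemma rev_impl_mono:
  assumes "rev_impl L X d g f" "X \<subseteq> X'" "d \<le> d'" "g \<le> g'"
  shows "rev_impl L X' d' g' f"
proof -
  obtain C where "impl L X d g (permop f)" "impl L X d g C" "opeq L (mmult L C (permop f)) idm"
    "\<And>S. S \<subseteq> lattice L \<Longrightarrow> f S \<subseteq> lattice L"
    using assms(1) by (rule rev_implE) blast
  then show ?thesis using impl_mono[OF _ assms(2-4)] by (intro rev_implI)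
qed

lemma permop_id: "permop (\<lambda>S. S) = idm"
  by (simp add: permop_def idm_def fun_eq_iff)

lemma rev_impl_id: "rev_impl L X 0 0 (\<lambda>S. S)"
proof -
  have "impl L X 0 0 idm" by (rule impl_mono[OF impl_idm]) auto
  then show ?thesis unfolding rev_impl_def permop_id by (auto intro!: exI[of _ idm])
qed

definition pc :: "(nat \<Rightarrow> site) \<Rightarrow> cfg \<Rightarrow> nat \<Rightarrow> nat" where
  "pc w S k = card {i. i < k \<and> w i \<in> S}"

lemma pc_0 [simp]: "pc w S 0 = 0"
  by (simp add: pc_def)

lemma pc_Suc: "pc w S (Suc k) = pc w S k + (if w k \<in> S then 1 else 0)"
proof -
  have "{i. i < Suc k \<and> w i \<in> S} = {i. i < k \<and> w i \<in> S} \<union> (if w k \<in> S then {k} else {})"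
    by (auto simp: less_Suc_eq)
  then show ?thesis by (simp add: pc_def)
qed

text \<open>In-place prefix sums mod 2 along the line \<open>w\<close>.\<close>

definition chain :: "(nat \<Rightarrow> site) \<Rightarrow> nat \<Rightarrow> cfg \<Rightarrow> cfg" where
  "chain w n S = (S - w ` {..<n}) \<union> {w k |k. k < n \<and> odd (pc w S (Suc k))}"

definition cnot_cfg :: "site \<Rightarrow> site \<Rightarrow> cfg \<Rightarrow> cfg" where
  "cnot_cfg c t S = (if c \<in> S then S - {t} \<union> ({t} - S) else S)"

lemma cnot_cfg_iff: "z \<in> cnot_cfg c t S \<longleftrightarrow> (if z = t then (t \<in> S) \<noteq> (c \<in> S) else z \<in> S)"
  by (auto simp: cnot_cfg_def)

lemma rev_impl_cnot:
  assumes "dist_l1 c t = 1" "c \<in> lattice L" "t \<in> lattice L"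
  shows "rev_impl L {c, t} 1 1 (cnot_cfg c t)"
proof -
  have ne: "c \<noteq> t" using assms(1) by (rule dist_l1_neq)
  have op: "gate_op (CNOT c t) = permop (cnot_cfg c t)"
    by (simp add: permop_def cnot_cfg_def fun_eq_iff)
  have "impl L {c, t} 1 1 (permop (cnot_cfg c t))"
    using impl_gate[of L "CNOT c t"] assms by (simp add: op[symmetric])
  moreover have lat: "cnot_cfg c t S \<subseteq> lattice L" if "S \<subseteq> lattice L" for S
    using that assms(2,3) by (auto simp: cnot_cfg_def)
  moreover have "cnot_cfg c t (cnot_cfg c t S) = S" for S
    using ne by (intro set_eqI) (auto simp: cnot_cfg_iff)
  then have "opeq L (mmult L (permop (cnot_cfg c t)) (permop (cnot_cfg c t))) idm"
    using permop_mmult[of L "cnot_cfg c t" "cnot_cfg c t", OF lat] by (simp add: permop_id)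
  ultimately show ?thesis by (intro rev_implI) simp_all
qed

lemma chain_in:
  assumes "inj_on w {..<n}" "k < n"
  shows "w k \<in> chain w n S \<longleftrightarrow> odd (pc w S (Suc k))"
  using assms by (auto simp: chain_def inj_on_def)

lemma chain_out: "z \<notin> w ` {..<n} \<Longrightarrow> z \<in> chain w n S \<longleftrightarrow> z \<in> S"
  by (auto simp: chain_def)

text \<open>When the first sites already hold their prefix parities, one CNOT from the last of them
  to the next site extends the chain. A chain of a single site needs no gate and leaves its layer
  idle.\<close>

lemma rev_impl_chain:
  assumes "inj_on w {..<n}" "\<And>k. k < n \<Longrightarrow> w k \<in> lattice L"
    "\<And>k. Suc k < n \<Longrightarrow> dist_l1 (w k) (w (Suc k)) = 1"
  shows "rev_impl L (w ` {..<n}) n n (chain w n)"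
  using assms
proof (induction n)
  case 0
  have "chain w 0 = (\<lambda>S. S)" by (simp add: chain_def fun_eq_iff)
  then show ?case using rev_impl_id by simp
next
  case (Suc n)
  have inj: "inj_on w {..<n}" by (rule inj_on_subset[OF Suc.prems(1)]) auto
  have IH: "rev_impl L (w ` {..<n}) n n (chain w n)"
    by (rule Suc.IH[OF inj]) (use Suc.prems in auto)
  show ?case
  proof (cases n)
    case 0
    have "chain w (Suc 0) = (\<lambda>S. S)" by (auto simp: chain_def fun_eq_iff pc_Suc)
    moreover have "rev_impl L (w ` {..<Suc 0}) (Suc 0) (Suc 0) (\<lambda>S. S)"
      by (rule rev_impl_mono[OF rev_impl_id[of L "{}"]]) auto
    ultimately show ?thesis unfolding 0 by simp
  next
    case (Suc m)
    have wn: "w n \<notin> w ` {..<n}" using inj_on_image_mem_iff[OF Suc.prems(1), of n "{..<n}"] by auto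
    have "rev_impl L (w ` {..<Suc n}) (n + 1) (n + 1) (\<lambda>S. cnot_cfg (w m) (w n) (chain w n S))"
    proof (rule rev_impl_seq[where f = "chain w n" and f' = "cnot_cfg (w m) (w n)"])
      show "rev_impl L (w ` {..<Suc n}) n n (chain w n)" by (rule rev_impl_mono[OF IH]) auto
      have "rev_impl L {w m, w n} 1 1 (cnot_cfg (w m) (w n))"
        by (rule rev_impl_cnot) (use Suc Suc.prems in auto)
      then show "rev_impl L (w ` {..<Suc n}) 1 1 (cnot_cfg (w m) (w n))"
        by (rule rev_impl_mono) (use Suc in auto)
    qed
    moreover have "cnot_cfg (w m) (w n) (chain w n S) = chain w (Suc n) S" for S
    proof (rule set_eqI)
      fix z
      show "z \<in> cnot_cfg (w m) (w n) (chain w n S) \<longleftrightarrow> z \<in> chain w (Suc n) S"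
      proof (cases "z \<in> w ` {..<Suc n}")
        case True
        then obtain k where k: "z = w k" "k < Suc n" by auto
        show ?thesis
        proof (cases "k = n")
          case True
          have "w m \<in> chain w n S \<longleftrightarrow> odd (pc w S n)"
            using chain_in[OF inj, of m S] Suc by simp
          then show ?thesis
            using chain_in[OF Suc.prems(1), of n S] chain_out[OF wn, of S] k True
            by (auto simp: cnot_cfg_iff pc_Suc)
        next
          case False
          then have "k < n" using k by simp
          then have "w k \<in> w ` {..<n}" by simp
          then have "w k \<noteq> w n" using wn by metis
          then show ?thesis
            using chain_in[OF Suc.prems(1) k(2), of S] chain_in[OF inj, of k S] k False
            by (auto simp: cnot_cfg_iff)
        qed
      next
        case False
        then have "z \<noteq> w n" "z \<notin> w ` {..<n}" by auto
        then show ?thesis using False by (simp add: cnot_cfg_iff chain_out)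
      qed
    qed
    ultimately show ?thesis by simp
  qed
qed

lemma chain_cong: "(\<And>k. k < n \<Longrightarrow> w k \<in> S \<longleftrightarrow> w k \<in> S') \<Longrightarrow> k \<le> n \<Longrightarrow> pc w S k = pc w S' k"
  unfolding pc_def by (rule arg_cong[where f = card]) auto

definition prefix_sums :: "('a \<Rightarrow> nat \<Rightarrow> site) \<Rightarrow> 'a list \<Rightarrow> nat \<Rightarrow> (cfg \<Rightarrow> cfg) \<Rightarrow> bool" where
  "prefix_sums w js n f \<longleftrightarrow>
    (\<forall>S. \<forall>j\<in>set js. \<forall>k<n. w j k \<in> f S \<longleftrightarrow> odd (pc (w j) S (Suc k))) \<and>
    (\<forall>S. \<forall>z. z \<notin> (\<Union>j\<in>set js. w j ` {..<n}) \<longrightarrow> (z \<in> f S \<longleftrightarrow> z \<in> S))"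

text \<open>Chains on disjoint lines share their layers, so the depth stays \<open>n\<close> however
  many lines there are.\<close>

lemma rev_impl_chains:
  assumes "distinct js"
    "\<And>j. j \<in> set js \<Longrightarrow> inj_on (w j) {..<n}" "\<And>j k. j \<in> set js \<Longrightarrow> k < n \<Longrightarrow> w j k \<in> lattice L"
    "\<And>j k. j \<in> set js \<Longrightarrow> Suc k < n \<Longrightarrow> dist_l1 (w j k) (w j (Suc k)) = 1"
    "\<And>i j. i \<in> set js \<Longrightarrow> j \<in> set js \<Longrightarrow> i \<noteq> j \<Longrightarrow> w i ` {..<n} \<inter> w j ` {..<n} = {}"
  shows "\<exists>f. rev_impl L (\<Union>j\<in>set js. w j ` {..<n}) n (length js * n) f \<and> prefix_sums w js n f"
  using assms
proof (induction js)
  case Nil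
  have "rev_impl L {} n 0 (\<lambda>S. S)" by (rule rev_impl_mono[OF rev_impl_id]) auto
  then show ?case by (intro exI[of _ "\<lambda>S. S"]) (simp add: prefix_sums_def)
next
  case (Cons j js)
  let ?X = "\<Union>j\<in>set js. w j ` {..<n}"
  obtain f where f: "rev_impl L ?X n (length js * n) f"
    "\<And>S i k. i \<in> set js \<Longrightarrow> k < n \<Longrightarrow> w i k \<in> f S \<longleftrightarrow> odd (pc (w i) S (Suc k))"
    "\<And>S z. z \<notin> ?X \<Longrightarrow> z \<in> f S \<longleftrightarrow> z \<in> S"
    using Cons.IH Cons.prems by (force simp: less_Suc_eq_le prefix_sums_def)
  have disj: "w i ` {..<n} \<inter> w j ` {..<n} = {}" if "i \<in> set js" for i
    using Cons.prems(1) Cons.prems(5)[of i j] that by auto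
  then have XY: "?X \<inter> w j ` {..<n} = {}" by blast
  have "rev_impl L (?X \<union> w j ` {..<n}) n (length js * n + n) (\<lambda>S. chain (w j) n (f S))"
    by (rule rev_impl_par[OF f(1) rev_impl_chain XY]) (use Cons.prems in auto)
  moreover have "?X \<union> w j ` {..<n} = (\<Union>j\<in>set (j # js). w j ` {..<n})" by auto
  ultimately have 1: "rev_impl L (\<Union>j\<in>set (j # js). w j ` {..<n}) n (length (j # js) * n)
      (\<lambda>S. chain (w j) n (f S))"
    by (simp add: add.commute)
  have 2: "w i k \<in> chain (w j) n (f S) \<longleftrightarrow> odd (pc (w i) S (Suc k))"
    if "i \<in> set (j # js)" "k < n" for S i k
  proof (cases "i = j")
    case True
    have eq: "w j l \<in> f S \<longleftrightarrow> w j l \<in> S" if "l < n" for l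
      by (rule f(3)) (use XY that in auto)
    have "pc (w j) (f S) (Suc k) = pc (w j) S (Suc k)"
      using that(2) by (intro chain_cong[of n, OF eq]) auto
    then show ?thesis using chain_in[of "w j" n k "f S"] Cons.prems(2)[of j] that True by simp
  next
    case False
    then have "i \<in> set js" using that by auto
    moreover have "w i k \<notin> w j ` {..<n}" using disj[OF \<open>i \<in> set js\<close>] that(2) by blast
    ultimately show ?thesis using f(2)[of i k S] that by (simp add: chain_out)
  qed
  have 3: "z \<in> chain (w j) n (f S) \<longleftrightarrow> z \<in> S" if "z \<notin> (\<Union>j\<in>set (j # js). w j ` {..<n})" for S z
  proof -
    have "z \<notin> w j ` {..<n}" "z \<notin> ?X" using that by auto
    then show ?thesis using f(3)[of z S] by (simp add: chain_out)
  qed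
  show ?case unfolding prefix_sums_def
    by (intro exI[of _ "\<lambda>S. chain (w j) n (f S)"] conjI allI ballI impI 1) (rule 2 3; assumption)+
qed

section \<open>Sign functions of relations\<close>

text \<open>For a relation without diagonal pairs this is the diagonal of a product of controlled-Z
  gates, one for each pair of \<open>R\<close>. The sign of a reordering of fermionic modes has this
  form, with \<open>R\<close> the set of inverted pairs.\<close>

definition rsg :: "(site \<times> site) set \<Rightarrow> cfg \<Rightarrow> complex" where
  "rsg R S = (-1) ^ card (R \<inter> S \<times> S)"

lemma rsg_sq [simp]: "rsg R S * rsg R S = 1"
  by (simp add: rsg_def flip: power_mult_distrib)

lemma rsg_empty [simp]: "rsg {} S = 1"
  by (simp add: rsg_def)

lemma rsg_Un: "finite R \<Longrightarrow> finite Q \<Longrightarrow> R \<inter> Q = {} \<Longrightarrow> rsg (R \<union> Q) S = rsg R S * rsg Q S"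
  unfolding rsg_def power_add[symmetric] Int_Un_distrib2
  by (subst card_Un_disjoint) auto

lemma rsg_UN:
  assumes "finite I" "\<And>i. i \<in> I \<Longrightarrow> finite (R i)"
    "\<And>i j. i \<in> I \<Longrightarrow> j \<in> I \<Longrightarrow> i \<noteq> j \<Longrightarrow> R i \<inter> R j = {}"
  shows "rsg (\<Union>i\<in>I. R i) S = (\<Prod>i\<in>I. rsg (R i) S)"
  using assms
proof (induction I)
  case (insert i I)
  have "R i \<inter> (\<Union>i\<in>I. R i) = {}" using insert.hyps insert.prems(2) by blast
  moreover have "rsg (\<Union>i\<in>I. R i) S = (\<Prod>i\<in>I. rsg (R i) S)"
    using insert by blast
  ultimately show ?case using insert.hyps insert.prems(1) by (simp add: rsg_Un)
qed simp

lemma rsg_Times: "rsg (A \<times> B) S = (-1) ^ (card (A \<inter> S) * card (B \<inter> S))"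
  by (simp add: rsg_def Times_Int_Times card_cartesian_product)

lemma minus_one_power_mult: "(-1 :: complex) ^ (m * n) = (if odd m \<and> odd n then -1 else 1)"
  by (simp add: uminus_power_if)

definition ladder_rel :: "(nat \<Rightarrow> site) \<Rightarrow> (nat \<Rightarrow> site) \<Rightarrow> nat \<Rightarrow> (site \<times> site) set" where
  "ladder_rel u w n = {(u k, w i) |k i. i < k \<and> k < n}"

lemma finite_ladder_rel [simp]: "finite (ladder_rel u w n)"
  by (rule finite_subset[of _ "(u ` {..<n}) \<times> (w ` {..<n})"]) (auto simp: ladder_rel_def)

text \<open>The exclusive prefix parity wanted by the strict inequality is the inclusive one
  corrected by the bit of \<open>w k\<close> itself. Each of the two factors is a controlled-Z on
  rung \<open>k\<close>, one with the prefix sums computed and one without.\<close>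

lemma rsg_ladder:
  assumes "inj_on u {..<n}" "inj_on w {..<n}"
  shows "rsg (ladder_rel u w n) S =
    (\<Prod>k<n. (if u k \<in> S \<and> odd (pc w S (Suc k)) then -1 else 1) * (if u k \<in> S \<and> w k \<in> S then -1 else 1))"
  using assms
proof (induction n)
  case 0
  then show ?case by (simp add: ladder_rel_def)
next
  case (Suc n)
  have inj: "inj_on u {..<n}" "inj_on w {..<n}"
    using Suc.prems by (auto elim: inj_on_subset)
  have "ladder_rel u w (Suc n) = ladder_rel u w n \<union> {u n} \<times> (w ` {..<n})"
    by (auto simp: ladder_rel_def less_Suc_eq)
  moreover have "ladder_rel u w n \<inter> {u n} \<times> (w ` {..<n}) = {}"
  proof -
    have "u k \<noteq> u n" if "k < n" for k using Suc.prems(1) that by (force simp: inj_on_def)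
    then show ?thesis by (auto simp: ladder_rel_def)
  qed
  ultimately have "rsg (ladder_rel u w (Suc n)) S =
      rsg (ladder_rel u w n) S * rsg ({u n} \<times> (w ` {..<n})) S"
    by (simp add: rsg_Un)
  moreover have "card (w ` {..<n} \<inter> S) = pc w S n"
  proof -
    have "w ` {..<n} \<inter> S = w ` {i. i < n \<and> w i \<in> S}" by auto
    then show ?thesis
      unfolding pc_def using card_image[OF inj_on_subset[OF inj(2), of "{i. i < n \<and> w i \<in> S}"]] by auto
  qed
  then have "rsg ({u n} \<times> (w ` {..<n})) S = (if u n \<in> S \<and> odd (pc w S n) then -1 else 1)"
    by (cases "u n \<in> S") (simp_all add: rsg_Times minus_one_power_mult)
  moreover have "(if u n \<in> S \<and> odd (pc w S n) then -1 else 1) =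
    (if u n \<in> S \<and> odd (pc w S (Suc n)) then -1 else 1) * (if u n \<in> S \<and> w n \<in> S then -1 else (1::complex))"
    by (simp add: pc_Suc)
  ultimately show ?case using Suc.IH[OF inj] by simp
qed

text \<open>Conjugating controlled-Z gates along the rungs by the CNOT chain on \<open>w\<close> couples \<open>u k\<close> with
  the parity of \<open>w 0, \<dots>, w k\<close>; the rung \<open>k\<close> itself is removed by a second layer of controlled-Z gates.\<close>
lemma impl_ladders:
  assumes dist: "distinct js"
    and lat: "\<And>j k. j \<in> set js \<Longrightarrow> k < n \<Longrightarrow> u j k \<in> lattice L \<and> w j k \<in> lattice L \<and> dist_l1 (u j k) (w j k) = 1"
    and step: "\<And>j k. j \<in> set js \<Longrightarrow> Suc k < n \<Longrightarrow> dist_l1 (w j k) (w j (Suc k)) = 1"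
    and uinj: "\<And>i j k l. i \<in> set js \<Longrightarrow> j \<in> set js \<Longrightarrow> k < n \<Longrightarrow> l < n \<Longrightarrow> u i k = u j l \<Longrightarrow> i = j \<and> k = l"
    and winj: "\<And>i j k l. i \<in> set js \<Longrightarrow> j \<in> set js \<Longrightarrow> k < n \<Longrightarrow> l < n \<Longrightarrow> w i k = w j l \<Longrightarrow> i = j \<and> k = l"
    and uw: "\<And>i j k l. i \<in> set js \<Longrightarrow> j \<in> set js \<Longrightarrow> k < n \<Longrightarrow> l < n \<Longrightarrow> u i k \<noteq> w j l"
  shows "impl L (lattice L) (2 * n + 10) (length js * n * 12) (dgop (rsg (\<Union>j\<in>set js. ladder_rel (u j) (w j) n)))"
proof -
  let ?ks = "List.product js [0..<n]"
  let ?cz = "\<lambda>(j, k) S. if u j k \<in> S \<and> w j k \<in> S then -1 else (1::complex)"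
  let ?D = "\<lambda>S. \<Prod>p\<in>set ?ks. ?cz p S"
  have injs: "inj_on (u j) {..<n}" "inj_on (w j) {..<n}" if "j \<in> set js" for j
    using uinj[of j j] winj[of j j] that by (auto simp: inj_on_def)
  have dks: "distinct ?ks" using dist by (simp add: distinct_product)
  have "impl L (\<Union>p\<in>set ?ks. {u (fst p) (snd p), w (fst p) (snd p)}) 5 (length ?ks * 5)
      (oprod L (map (\<lambda>p. dgop (?cz p)) ?ks))"
  proof (rule impl_par_list[OF _ dks])
    fix p assume p: "p \<in> set ?ks"
    then show "impl L {u (fst p) (snd p), w (fst p) (snd p)} 5 5 (dgop (?cz p))"
      using impl_cz[of "u (fst p) (snd p)" "w (fst p) (snd p)" L] lat[of "fst p" "snd p"]
      by (auto simp: case_prod_beta)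
  next
    fix p q assume pq: "p \<in> set ?ks" "q \<in> set ?ks" "p \<noteq> q"
    then show "{u (fst p) (snd p), w (fst p) (snd p)} \<inter> {u (fst q) (snd q), w (fst q) (snd q)} = {}"
      using uinj[of "fst p" "fst q" "snd p" "snd q"] winj[of "fst p" "fst q" "snd p" "snd q"]
        uw[of "fst p" "fst q" "snd p" "snd q"] uw[of "fst q" "fst p" "snd q" "snd p"]
      by (auto simp: prod_eq_iff)
  qed
  moreover have "(\<Union>p\<in>set ?ks. {u (fst p) (snd p), w (fst p) (snd p)}) \<subseteq> lattice L"
  proof (rule UN_least)
    fix p assume "p \<in> set ?ks"
    then show "{u (fst p) (snd p), w (fst p) (snd p)} \<subseteq> lattice L"
      using lat[of "fst p" "snd p"] by auto
  qed
  ultimately have "impl L (lattice L) 5 (length ?ks * 5) (oprod L (map (\<lambda>p. dgop (?cz p)) ?ks))"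
    by (rule impl_mono) auto
  then have D: "impl L (lattice L) 5 (length js * n * 5) (dgop ?D)"
    using impl_cong[OF _ oprod_dgop[OF dks]] by simp
  obtain f where f: "rev_impl L (\<Union>j\<in>set js. w j ` {..<n}) n (length js * n) f"
    "\<And>S j k. j \<in> set js \<Longrightarrow> k < n \<Longrightarrow> w j k \<in> f S \<longleftrightarrow> odd (pc (w j) S (Suc k))"
    "\<And>S z. z \<notin> (\<Union>j\<in>set js. w j ` {..<n}) \<Longrightarrow> (z \<in> f S \<longleftrightarrow> z \<in> S)"
  proof -
    have "\<exists>f. rev_impl L (\<Union>j\<in>set js. w j ` {..<n}) n (length js * n) f \<and> prefix_sums w js n f"
    proof (rule rev_impl_chains[OF dist])
      show "w i ` {..<n} \<inter> w j ` {..<n} = {}" if "i \<in> set js" "j \<in> set js" "i \<noteq> j" for i j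
        using winj[of i j] that by blast
    qed (use lat step injs in simp_all)
    then show ?thesis using that unfolding prefix_sums_def by blast
  qed
  have "(\<Union>j\<in>set js. w j ` {..<n}) \<subseteq> lattice L" using lat by auto
  then have f': "rev_impl L (lattice L) n (length js * n) f" using rev_impl_mono[OF f(1)] by auto
  obtain C where C: "impl L (lattice L) n (length js * n) (permop f)"
      "impl L (lattice L) n (length js * n) C" "opeq L (mmult L C (permop f)) idm"
      "\<And>S. S \<subseteq> lattice L \<Longrightarrow> f S \<subseteq> lattice L"
    using f' by (rule rev_implE) blast
  have uf: "u j k \<in> f S \<longleftrightarrow> u j k \<in> S" if "j \<in> set js" "k < n" for j k S
    by (rule f(3)) (use uw that in blast)
  have sign: "?D (f S) * ?D S = rsg (\<Union>j\<in>set js. ladder_rel (u j) (w j) n) S" for S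
  proof -
    have "?D (f S) * ?D S = (\<Prod>p\<in>set ?ks. ?cz p (f S) * ?cz p S)"
      by (simp add: prod.distrib)
    also have "\<dots> = (\<Prod>(j, k)\<in>set js \<times> {..<n}.
      (if u j k \<in> S \<and> odd (pc (w j) S (Suc k)) then -1 else 1) * (if u j k \<in> S \<and> w j k \<in> S then -1 else 1))"
      by (rule prod.cong) (auto simp: uf f(2))
    also have "\<dots> = (\<Prod>j\<in>set js. \<Prod>k<n.
      (if u j k \<in> S \<and> odd (pc (w j) S (Suc k)) then -1 else 1) * (if u j k \<in> S \<and> w j k \<in> S then -1 else 1))"
      by (rule prod.cartesian_product[symmetric])
    also have "\<dots> = (\<Prod>j\<in>set js. rsg (ladder_rel (u j) (w j) n) S)"
      by (rule prod.cong) (use rsg_ladder[OF injs] in auto)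
    also have "\<dots> = rsg (\<Union>j\<in>set js. ladder_rel (u j) (w j) n) S"
    proof (rule rsg_UN[symmetric])
      fix i j assume ij: "i \<in> set js" "j \<in> set js" "i \<noteq> j"
      have "fst p \<in> u i ` {..<n}" if "p \<in> ladder_rel (u i) (w i) n" for i p
        using that by (auto simp: ladder_rel_def)
      moreover have "u i ` {..<n} \<inter> u j ` {..<n} = {}"
      proof -
        have "False" if z: "z \<in> u i ` {..<n}" "z \<in> u j ` {..<n}" for z
        proof -
          obtain k l where "z = u i k" "k < n" "z = u j l" "l < n" using z by blast
          then show False using uinj[of i j k l] ij by simp
        qed
        then show ?thesis by blast
      qed
      ultimately show "ladder_rel (u i) (w i) n \<inter> ladder_rel (u j) (w j) n = {}"
        by blast
    qed auto
    finally show ?thesis .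
  qed
  \<comment> \<open>Each rung costs two controlled-Z of five gates and, in the chain and its
    inverse, two CNOTs: twelve in all. One \<open>?D\<close> acts on the original bits, the other
    while the prefix sums are in place.\<close>
  have "impl L (lattice L) (5 + n + (5 + n)) (length js * n * 5 + length js * n + (length js * n * 5 + length js * n))
      (mmult L (mmult L C (dgop ?D)) (mmult L (permop f) (dgop ?D)))"
    by (rule impl_seq[OF impl_seq[OF D C(1)] impl_seq[OF D C(2)]])
  moreover have "opeq L (mmult L (mmult L C (dgop ?D)) (mmult L (permop f) (dgop ?D)))
      (dgop (rsg (\<Union>j\<in>set js. ladder_rel (u j) (w j) n)))"
  proof -
    have "opeq L (mmult L (mmult L C (dgop ?D)) (mmult L (permop f) (dgop ?D)))
        (mmult L C (mmult L (mmult L (dgop ?D) (permop f)) (dgop ?D)))"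
      by (simp only: mmult_assoc opeq_refl)
    also have "opeq L \<dots> (mmult L C (mmult L (mmult L (permop f) (dgop (\<lambda>S. ?D (f S)))) (dgop ?D)))"
      by (intro opeq_mmult_r opeq_mmult_l dgop_permop C(4))
    also have "opeq L \<dots> (mmult L C (mmult L (permop f) (mmult L (dgop (\<lambda>S. ?D (f S))) (dgop ?D))))"
      by (simp only: mmult_assoc opeq_refl)
    also have "opeq L \<dots> (mmult L (dgop (\<lambda>S. ?D (f S))) (dgop ?D))"
      by (rule mmult_cancel[OF C(3)])
    also have "opeq L \<dots> (dgop (\<lambda>S. ?D (f S) * ?D S))" by (rule dgop_mmult)
    finally show ?thesis unfolding sign .
  qed
  ultimately have "impl L (lattice L) (5 + n + (5 + n)) (length js * n * 5 + length js * n + (length js * n * 5 + length js * n))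
      (dgop (rsg (\<Union>j\<in>set js. ladder_rel (u j) (w j) n)))" by (rule impl_cong)
  then show ?thesis by (rule impl_mono) auto
qed

section \<open>Bond layers\<close>

lemma mult_add_less_iff:
  assumes "r < L" "r' < (L::nat)"
  shows "n * L + r < n' * L + r' \<longleftrightarrow> n < n' \<or> n = n' \<and> r < r'"
proof -
  have *: "m * L + s < m' * L + s'" if "m < m'" "s < L" for m m' s s'
  proof -
    have "m * L + s < Suc m * L" using that(2) by simp
    also have "\<dots> \<le> m' * L" by (rule mult_le_mono1) (use that(1) in simp)
    finally show ?thesis by simp
  qed
  show ?thesis
    using *[of n n' r r'] *[of n' n r' r] assms by (cases n n' rule: linorder_cases) auto
qed

lemma mult_add_eq_iff:
  assumes "r < L" "r' < (L::nat)"
  shows "n * L + r = n' * L + r' \<longleftrightarrow> n = n' \<and> r = r'"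
  using mult_add_less_iff[OF assms, of n n'] mult_add_less_iff[OF assms(2,1), of n' n] by auto

lemma ref_idx_less_iff:
  assumes "(a, b, c) \<in> lattice L" "(a', b', c') \<in> lattice L"
  shows "ref_idx L (a, b, c) < ref_idx L (a', b', c') \<longleftrightarrow> a < a' \<or> a = a' \<and> (b < b' \<or> b = b' \<and> c < c')"
proof -
  have "ref_idx L (i, j, k) = (i * L + j) * L + k" for i j k
    by (simp add: ref_idx_def algebra_simps)
  then show ?thesis using assms by (auto simp: lattice_def mult_add_less_iff mult_add_eq_iff)
qed

lemma card_lattice: "card (lattice L) = L ^ 3"
  by (simp add: lattice_def card_cartesian_product power3_eq_cube)

section \<open>Sign conjugation and change of the ordering\<close>

definition sg :: "(cfg \<Rightarrow> complex) \<Rightarrow> op \<Rightarrow> op" where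
  "sg s A T S = s T * s S * A T S"

lemma sg_dgop: "opeq L (sg s A) (mmult L (dgop s) (mmult L A (dgop s)))"
  by (rule opeqI) (simp add: sg_def mmult_dgop_left mmult_dgop_right)

text \<open>\<open>rsg (srel L x y)\<close> is the sign of the reordering that moves \<open>x\<close>, \<open>y\<close> in front of all other modes.\<close>
definition srel :: "nat \<Rightarrow> site \<Rightarrow> site \<Rightarrow> (site \<times> site) set" where
  "srel L x y = {(v, w). v \<in> {x, y} \<and> w \<in> lattice L - {x, y} \<and> ref_idx L w < ref_idx L v}"

lemma srel_commute: "srel L x y = srel L y x"
  by (auto simp: srel_def)

text \<open>The gates that a bond layer accepts. Exponentials of admissible terms and fermionic
  swaps both belong here.\<close>

definition G2 :: "nat \<Rightarrow> site \<Rightarrow> site \<Rightarrow> op set" where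
  "G2 L x y = {A. \<exists>Be Bo. dgl Be \<and> dgl Bo \<and> opeq L A (sg (rsg (srel L x y)) (blk x y Be Bo))}"

lemma sign_prod_card: "finite S \<Longrightarrow> (\<Prod>w\<in>S. if P w then -1 else (1::complex)) = (-1) ^ card {w \<in> S. P w}"
  by (simp add: prod.If_cases Int_def)

text \<open>Making \<open>v\<close> occupied adds one crossing for each occupied \<open>w\<close>
  related to it; a pair present in both directions counts twice and cancels.\<close>

lemma rsg_insert:
  assumes "finite S" "v \<notin> S" "(v, v) \<notin> R"
  shows "rsg R (insert v S) = rsg R S * (\<Prod>w\<in>S. if ((v, w) \<in> R) \<noteq> ((w, v) \<in> R) then -1 else 1)"
proof -
  let ?A = "{v} \<times> {w \<in> S. (v, w) \<in> R}" and ?B = "{w \<in> S. (w, v) \<in> R} \<times> {v}"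
  have "R \<inter> insert v S \<times> insert v S = (R \<inter> S \<times> S) \<union> (?A \<union> ?B)"
    using assms(3) by auto
  moreover have "(R \<inter> S \<times> S) \<inter> (?A \<union> ?B) = {}" "?A \<inter> ?B = {}"
    using assms(2) by auto
  ultimately have "card (R \<inter> insert v S \<times> insert v S) = card (R \<inter> S \<times> S) + (card ?A + card ?B)"
    using assms(1) by (simp add: card_Un_disjoint)
  then have "rsg R (insert v S) = rsg R S * ((-1) ^ card {w \<in> S. (v, w) \<in> R} * (-1) ^ card {w \<in> S. (w, v) \<in> R})"
    by (simp add: rsg_def power_add card_cartesian_product)
  also have "(-1) ^ card {w \<in> S. (v, w) \<in> R} * (-1) ^ card {w \<in> S. (w, v) \<in> R}
     = (\<Prod>w\<in>S. (if (v, w) \<in> R then -1 else (1::complex)) * (if (w, v) \<in> R then -1 else 1))"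
    using assms(1) by (simp add: prod.distrib sign_prod_card)
  also have "\<dots> = (\<Prod>w\<in>S. if ((v, w) \<in> R) \<noteq> ((w, v) \<in> R) then -1 else 1)"
    by (rule prod.cong) auto
  finally show ?thesis .
qed

text \<open>Whether the quadratic forms of \<open>R\<close> and \<open>Q\<close>, read mod 2 on
  unordered pairs, disagree on the coupling of \<open>v\<close> and \<open>w\<close>.\<close>

definition rel_xor :: "(site \<times> site) set \<Rightarrow> (site \<times> site) set \<Rightarrow> site \<Rightarrow> site \<Rightarrow> bool" where
  "rel_xor R Q v w \<longleftrightarrow> (((v, w) \<in> R) \<noteq> ((w, v) \<in> R)) \<noteq> (((v, w) \<in> Q) \<noteq> ((w, v) \<in> Q))"

lemma rsg_pair_insert:
  assumes "finite S" "v \<notin> S" "(v, v) \<notin> R" "(v, v) \<notin> Q"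
  shows "rsg R (insert v S) * rsg Q (insert v S)
    = rsg R S * rsg Q S * (\<Prod>w\<in>S. if rel_xor R Q v w then -1 else 1)"
proof -
  have "(\<Prod>w\<in>S. if ((v, w) \<in> R) \<noteq> ((w, v) \<in> R) then -1 else 1) *
      (\<Prod>w\<in>S. if ((v, w) \<in> Q) \<noteq> ((w, v) \<in> Q) then -1 else 1)
    = (\<Prod>w\<in>S. if rel_xor R Q v w then -1 else (1::complex))"
    unfolding prod.distrib[symmetric] by (rule prod.cong) (auto simp: rel_xor_def)
  then show ?thesis using assms by (simp add: rsg_insert)
qed

lemma rsg_pair_sq: "rsg R S * rsg Q S * (rsg R S * rsg Q S) = 1"
  using rsg_sq[of R S] rsg_sq[of Q S] by (metis mult.assoc mult.commute mult_1_right)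

lemma rsg_nonzero [simp]: "rsg R S \<noteq> 0"
  by (simp add: rsg_def)

text \<open>\<open>F\<close> is the sign of the sum of the two quadratic forms mod 2. By
  \<open>compat\<close> it couples \<open>x\<close> and \<open>y\<close> to the modes in
  \<open>S\<close> by the same factor \<open>c\<close>, and \<open>c\<close> squares to one; what
  remains for two particles is the direct coupling of \<open>x\<close> with
  \<open>y\<close>.\<close>

lemma rsg_pair_flip:
  assumes irr: "(x, x) \<notin> R" "(x, x) \<notin> Q" "(y, y) \<notin> R" "(y, y) \<notin> Q"
    and compat: "\<And>z. z \<in> lattice L - {x, y} \<Longrightarrow> rel_xor R Q x z = rel_xor R Q y z"
    and "x \<noteq> y" and S: "S \<subseteq> lattice L - {x, y}"
  defines "F \<equiv> \<lambda>S. rsg R S * rsg Q S"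
  shows "F (insert x S) * F (insert y S) = 1"
    "F (insert x (insert y S)) * F S = (if rel_xor R Q x y then -1 else 1)"
proof -
  have fin: "finite S" by (rule finite_subset[OF S]) simp
  have xy: "x \<notin> S" "y \<notin> S" using S by auto
  have FF: "F T * F T = 1" for T unfolding F_def by (rule rsg_pair_sq)
  define c where "c = (\<Prod>w\<in>S. if rel_xor R Q y w then -1 else (1::complex))"
  have c: "(\<Prod>w\<in>S. if rel_xor R Q x w then -1 else (1::complex)) = c"
    unfolding c_def by (rule prod.cong) (use compat S in auto)
  have cc: "c * c = 1"
    unfolding c_def prod.distrib[symmetric] by (rule prod.neutral) auto
  have x: "F (insert x S) = F S * c"
    unfolding F_def using rsg_pair_insert[OF fin xy(1) irr(1,2)] c by simp
  have y: "F (insert y S) = F S * c"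
    unfolding F_def using rsg_pair_insert[OF fin xy(2) irr(3,4)] c_def by simp
  have "F (insert x (insert y S)) = F (insert y S) * ((if rel_xor R Q x y then -1 else 1) * c)"
    unfolding F_def using rsg_pair_insert[of "insert y S" x R Q] fin xy irr \<open>x \<noteq> y\<close> c by simp
  then have 2: "F (insert x (insert y S)) = F S * (c * c) * (if rel_xor R Q x y then -1 else 1)"
    by (simp add: y)
  have "F (insert x S) * F (insert y S) = (F S * F S) * (c * c)" by (simp add: x y)
  then show "F (insert x S) * F (insert y S) = 1" by (simp add: FF cc)
  have "F (insert x (insert y S)) * F S = (F S * F S) * (if rel_xor R Q x y then -1 else 1)"
    using 2 cc by simp
  then show "F (insert x (insert y S)) * F S = (if rel_xor R Q x y then -1 else 1)" by (simp add: FF)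
qed

definition flip_offdiag :: "bool \<Rightarrow> mat2 \<Rightarrow> mat2" where
  "flip_offdiag p B a b = (if p \<and> a \<noteq> b then - B a b else B a b)"

lemma dgl_flip_offdiag:
  assumes "dgl B" shows "dgl (flip_offdiag p B)"
proof (cases p)
  case True
  obtain V \<phi> where V: "U2 V" "B = dg V (\<lambda>j. cis (\<phi> j))" using assms by (auto simp: dgl_def)
  \<comment> \<open>Conjugation with diag(1, -1) negates the off-diagonal entries; here it is
    absorbed into the eigenvectors.\<close>
  define W where "W = (\<lambda>a j. (if a then -1 else 1) * V a j)"
  have "U2 W" using V(1)
    unfolding U2_def unitary2_def adj2_def by (simp add: UNIV_bool W_def all_bool_eq neg_eq_iff_add_eq_0 eq_neg_iff_add_eq_0)
  moreover have "flip_offdiag p B = dg W (\<lambda>j. cis (\<phi> j))"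
    unfolding V(2) by (intro ext) (auto simp: True flip_offdiag_def dg_def m2_def adj2_def diag2_def W_def UNIV_bool algebra_simps)
  ultimately show ?thesis by (auto simp: dgl_def)
next
  case False
  then have "flip_offdiag p B = B" by (simp add: flip_offdiag_def fun_eq_iff)
  then show ?thesis using assms by simp
qed

text \<open>The compatibility hypothesis says that the reorderings behind \<open>R\<close> and \<open>Q\<close> differ by one that
  treats \<open>x\<close> and \<open>y\<close> alike; since a block operator changes the occupations of \<open>x\<close> and \<open>y\<close> both or
  not at all, exchanging the two signs costs only a sign that depends on \<open>x\<close>, \<open>y\<close> alone.\<close>
lemma sg_blk_change:
  assumes irr: "(x, x) \<notin> R" "(x, x) \<notin> Q" "(y, y) \<notin> R" "(y, y) \<notin> Q"
    and compat: "\<And>z. z \<in> lattice L - {x, y} \<Longrightarrow> rel_xor R Q x z = rel_xor R Q y z"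
    and "x \<noteq> y"
  shows "opeq L (sg (rsg R) (blk x y Be Bo)) (sg (rsg Q) (blk x y (flip_offdiag (rel_xor R Q x y) Be) Bo))"
proof (rule opeqI)
  fix T S assume TS: "T \<subseteq> lattice L" "S \<subseteq> lattice L"
  let ?p = "rel_xor R Q x y"
  define F where "F = (\<lambda>S. rsg R S * rsg Q S)"
  have FF: "F T * F T = 1" for T unfolding F_def by (rule rsg_pair_sq)
  define S0 where "S0 = S - {x, y}"
  have S0: "S0 \<subseteq> lattice L - {x, y}" using TS by (auto simp: S0_def)
  have flip: "F (insert x S0) * F (insert y S0) = 1"
    "F (insert x (insert y S0)) * F S0 = (if ?p then -1 else 1)"
    unfolding F_def by (rule rsg_pair_flip[OF irr compat \<open>x \<noteq> y\<close> S0]; assumption)+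
  have main: "F T * F S * blk x y Be Bo T S = blk x y (flip_offdiag ?p Be) Bo T S"
  proof (cases "T - {x, y} = S - {x, y}")
    case True
    have cases: "U = (if x \<in> U then if y \<in> U then insert x (insert y S0) else insert x S0
       else if y \<in> U then insert y S0 else S0)" if "U - {x, y} = S0" for U
      using that by auto
    have T: "T = (if x \<in> T then if y \<in> T then insert x (insert y S0) else insert x S0
       else if y \<in> T then insert y S0 else S0)" by (rule cases) (simp add: S0_def True)
    have S: "S = (if x \<in> S then if y \<in> S then insert x (insert y S0) else insert x S0
       else if y \<in> S then insert y S0 else S0)" by (rule cases) (simp add: S0_def)
    have flip': "F (insert y S0) * F (insert x S0) = 1"
       "F S0 * F (insert x (insert y S0)) = (if ?p then -1 else 1)"
      using flip by (simp_all add: mult.commute)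
    consider "T = S" | "x \<in> T" "y \<notin> T" "x \<notin> S" "y \<in> S" | "x \<notin> T" "y \<in> T" "x \<in> S" "y \<notin> S"
      | "x \<in> T" "y \<in> T" "x \<notin> S" "y \<notin> S" | "x \<notin> T" "y \<notin> T" "x \<in> S" "y \<in> S"
      | "((x \<in> T) = (y \<in> T)) \<noteq> ((x \<in> S) = (y \<in> S))"
      using True by blast
    then show ?thesis
    proof cases
      case 1
      then show ?thesis by (simp add: FF blk_def tq_def flip_offdiag_def)
    next
      case 2
      then have "T = insert x S0" "S = insert y S0" using T S by auto
      then have "F T * F S = 1" using flip by simp
      then show ?thesis using 2 by (simp add: blk_def tq_def)
    next
      case 3
      then have "T = insert y S0" "S = insert x S0" using T S by auto
      then have "F T * F S = 1" using flip' by simp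
      then show ?thesis using 3 by (simp add: blk_def tq_def)
    next
      case 4
      then have "T = insert x (insert y S0)" "S = S0" using T S by auto
      then have "F T * F S = (if ?p then -1 else 1)" using flip by simp
      then show ?thesis using 4 by (simp add: blk_def tq_def flip_offdiag_def)
    next
      case 5
      then have "T = S0" "S = insert x (insert y S0)" using T S by auto
      then have "F T * F S = (if ?p then -1 else 1)" using flip' by simp
      then show ?thesis using 5 by (simp add: blk_def tq_def flip_offdiag_def)
    next
      case 6
      then show ?thesis by (simp add: blk_def tq_def)
    qed
  qed (simp add: blk_def tq_def)
  have "rsg R T * rsg R S * B = rsg Q T * rsg Q S * (F T * F S * B)" for B
  proof -
    have "rsg Q T * rsg Q S * (F T * F S * B) =
      (rsg Q T * rsg Q T) * (rsg Q S * rsg Q S) * (rsg R T * rsg R S * B)"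
      unfolding F_def by (simp only: ac_simps)
    then show ?thesis by (simp only: rsg_sq mult_1_left)
  qed
  then show "sg (rsg R) (blk x y Be Bo) T S = sg (rsg Q) (blk x y (flip_offdiag ?p Be) Bo) T S"
    unfolding sg_def main[symmetric] .
qed

text \<open>After \<open>sg_blk_change\<close> every gate is the same sign conjugate of a two-qubit
  block. By \<open>oprod_conj\<close> the sign is then applied once on each side, and the blocks, on
  disjoint bonds, run in 16 common layers.\<close>

lemma bond_layer:
  assumes D: "impl L (lattice L) d g (dgop (rsg Q))" and irr: "\<And>z. (z, z) \<notin> Q"
    and bs: "distinct bs"
    and lat: "\<And>x y. (x, y) \<in> set bs \<Longrightarrow> x \<in> lattice L \<and> y \<in> lattice L \<and> dist_l1 x y = 1"
    and compat: "\<And>x y z. (x, y) \<in> set bs \<Longrightarrow> z \<in> lattice L - {x, y} \<Longrightarrow>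
      rel_xor (srel L x y) Q x z = rel_xor (srel L x y) Q y z"
    and disj: "\<And>x y x' y'. (x, y) \<in> set bs \<Longrightarrow> (x', y') \<in> set bs \<Longrightarrow> (x, y) \<noteq> (x', y') \<Longrightarrow>
      {x, y} \<inter> {x', y'} = {}"
    and U: "\<And>x y. (x, y) \<in> set bs \<Longrightarrow> U (x, y) \<in> G2 L x y"
  shows "impl L (lattice L) (2 * d + 16) (2 * g + 16 * L ^ 3) (oprod L (map U bs))"
proof -
  let ?D = "dgop (rsg Q)" and ?X = "\<lambda>p. {fst p, snd p}"
  have "\<forall>p\<in>set bs. \<exists>A. impl L (?X p) 16 16 A \<and> opeq L (U p) (mmult L ?D (mmult L A ?D))"
  proof
    fix p assume "p \<in> set bs"
    moreover obtain x y where p: "p = (x, y)" by (cases p)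
    ultimately have xy: "(x, y) \<in> set bs" by simp
    have ne: "x \<noteq> y" using lat[OF xy] dist_l1_neq by blast
    obtain Be Bo where B: "dgl Be" "dgl Bo" "opeq L (U p) (sg (rsg (srel L x y)) (blk x y Be Bo))"
      using U[OF xy] unfolding p G2_def by blast
    define A where "A = blk x y (flip_offdiag (rel_xor (srel L x y) Q x y) Be) Bo"
    note B(3)
    also have "opeq L (sg (rsg (srel L x y)) (blk x y Be Bo)) (sg (rsg Q) A)"
      unfolding A_def
      by (rule sg_blk_change) (use irr ne compat[OF xy] in \<open>auto simp: srel_def\<close>)
    also have "opeq L (sg (rsg Q) A) (mmult L ?D (mmult L A ?D))" by (rule sg_dgop)
    finally have "opeq L (U p) (mmult L ?D (mmult L A ?D))" .
    moreover have "impl L (?X p) 16 16 A"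
      unfolding A_def p using impl_blk[of x y L] lat[OF xy] B dgl_flip_offdiag by simp
    ultimately show "\<exists>A. impl L (?X p) 16 16 A \<and> opeq L (U p) (mmult L ?D (mmult L A ?D))" by blast
  qed
  from bchoice[OF this] obtain A where A: "\<And>p. p \<in> set bs \<Longrightarrow> impl L (?X p) 16 16 (A p)"
    "\<And>p. p \<in> set bs \<Longrightarrow> opeq L (U p) (mmult L ?D (mmult L (A p) ?D))" by blast
  have DD: "opeq L (mmult L ?D ?D) idm"
    using dgop_mmult[of L "rsg Q" "rsg Q"] by (simp add: dgop_one)
  have "opeq L (oprod L (map U bs)) (oprod L (map (\<lambda>p. mmult L ?D (mmult L (A p) ?D)) bs))"
    by (rule oprod_cong[OF A(2)])
  also have "opeq L \<dots> (mmult L ?D (mmult L (oprod L (map A bs)) ?D))"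
    by (rule oprod_conj[OF DD DD])
  finally have eq: "opeq L (oprod L (map U bs)) (mmult L ?D (mmult L (oprod L (map A bs)) ?D))" .
  have "impl L (\<Union>p\<in>set bs. ?X p) 16 (length bs * 16) (oprod L (map A bs))"
  proof (rule impl_par_list[OF A(1) bs])
    fix p q assume "p \<in> set bs" "q \<in> set bs" "p \<noteq> q"
    then show "?X p \<inter> ?X q = {}" using disj[of "fst p" "snd p" "fst q" "snd q"] by (auto simp: prod_eq_iff)
  qed
  moreover have "(\<Union>p\<in>set bs. ?X p) \<subseteq> lattice L"
  proof (rule UN_least)
    fix p assume "p \<in> set bs" then show "?X p \<subseteq> lattice L" using lat[of "fst p" "snd p"] by simp
  qed
  \<comment> \<open>Disjoint bonds have different first ends, so there are no more bonds than
    sites.\<close>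
  moreover have "length bs \<le> L ^ 3"
  proof -
    have "inj_on fst (set bs)"
    proof (rule inj_onI)
      fix p q assume pq: "p \<in> set bs" "q \<in> set bs" "fst p = fst q"
      then show "p = q"
        using disj[of "fst p" "snd p" "fst q" "snd q"] by (auto simp: prod_eq_iff)
    qed
    moreover have "fst ` set bs \<subseteq> lattice L"
    proof
      fix x assume "x \<in> fst ` set bs" then show "x \<in> lattice L" using lat[of x] by fastforce
    qed
    ultimately have "card (set bs) \<le> card (lattice L)" by (rule card_inj_on_le) simp
    then show ?thesis using distinct_card[OF bs] card_lattice by simp
  qed
  ultimately have "impl L (lattice L) 16 (L ^ 3 * 16) (oprod L (map A bs))"
    by (auto elim!: impl_mono)
  then have "impl L (lattice L) (d + 16 + d) (g + L ^ 3 * 16 + g) (mmult L ?D (mmult L (oprod L (map A bs)) ?D))"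
    by (intro impl_seq D)
  then have "impl L (lattice L) (d + 16 + d) (g + L ^ 3 * 16 + g) (oprod L (map U bs))"
    by (rule impl_cong) (rule opeq_sym[OF eq])
  then show ?thesis by (rule impl_mono) auto
qed

definition bond_class :: "nat \<Rightarrow> nat \<Rightarrow> (site \<times> site) set \<Rightarrow> bool" where
  "bond_class L K B \<longleftrightarrow> (\<forall>bs U. distinct bs \<and> set bs \<subseteq> B \<and> (\<forall>p\<in>set bs. U p \<in> G2 L (fst p) (snd p)) \<longrightarrow>
     impl L (lattice L) (K * L) (K * L ^ 3) (oprod L (map U bs)))"

lemma bond_classI:
  assumes "impl L (lattice L) d g (dgop (rsg Q))" "\<And>z. (z, z) \<notin> Q"
    "\<And>x y. (x, y) \<in> B \<Longrightarrow> x \<in> lattice L \<and> y \<in> lattice L \<and> dist_l1 x y = 1"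
    "\<And>x y z. (x, y) \<in> B \<Longrightarrow> z \<in> lattice L - {x, y} \<Longrightarrow>
      rel_xor (srel L x y) Q x z = rel_xor (srel L x y) Q y z"
    "\<And>x y x' y'. (x, y) \<in> B \<Longrightarrow> (x', y') \<in> B \<Longrightarrow> (x, y) \<noteq> (x', y') \<Longrightarrow> {x, y} \<inter> {x', y'} = {}"
    "2 * d + 16 \<le> K * L" "2 * g + 16 * L ^ 3 \<le> K * L ^ 3"
  shows "bond_class L K B"
  unfolding bond_class_def
proof (intro allI impI)
  fix bs and U :: "site \<times> site \<Rightarrow> op"
  assume "distinct bs \<and> set bs \<subseteq> B \<and> (\<forall>p\<in>set bs. U p \<in> G2 L (fst p) (snd p))"
  then have bs: "distinct bs" "\<And>p. p \<in> set bs \<Longrightarrow> p \<in> B" "\<And>p. p \<in> set bs \<Longrightarrow> U p \<in> G2 L (fst p) (snd p)"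
    by blast+
  have "impl L (lattice L) (2 * d + 16) (2 * g + 16 * L ^ 3) (oprod L (map U bs))"
  proof (rule bond_layer[OF assms(1,2) bs(1)])
    fix x y assume xy: "(x, y) \<in> set bs"
    show "x \<in> lattice L \<and> y \<in> lattice L \<and> dist_l1 x y = 1" by (rule assms(3)[OF bs(2)[OF xy]])
    show "U (x, y) \<in> G2 L x y" using bs(3)[OF xy] by simp
    fix z assume "z \<in> lattice L - {x, y}"
    then show "rel_xor (srel L x y) Q x z = rel_xor (srel L x y) Q y z"
      by (rule assms(4)[OF bs(2)[OF xy]])
  next
    fix x y x' y' assume "(x, y) \<in> set bs" "(x', y') \<in> set bs" "(x, y) \<noteq> (x', y')"
    then show "{x, y} \<inter> {x', y'} = {}" by (intro assms(5) bs(2))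
  qed
  then show "impl L (lattice L) (K * L) (K * L ^ 3) (oprod L (map U bs))"
    by (rule impl_mono) (use assms(6,7) in auto)
qed

section \<open>Signs and circuits for the three bond directions\<close>

definition bonds1 :: "nat \<Rightarrow> nat \<Rightarrow> (site \<times> site) set" where
  "bonds1 r L = {((a, b, c), (a', b', c')). a' = Suc a \<and> b' = b \<and> c' = c \<and> a' < L \<and> b < L \<and> c < L \<and> a mod 2 = r}"

definition bonds2 :: "nat \<Rightarrow> nat \<Rightarrow> (site \<times> site) set" where
  "bonds2 r L = {((a, b, c), (a', b', c')). a' = a \<and> b' = Suc b \<and> c' = c \<and> a < L \<and> b' < L \<and> c < L \<and> b mod 2 = r}"

definition bonds3 :: "nat \<Rightarrow> nat \<Rightarrow> (site \<times> site) set" where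
  "bonds3 r L = {((a, b, c), (a', b', c')). a' = a \<and> b' = b \<and> c' = Suc c \<and> a < L \<and> b < L \<and> c' < L \<and> c mod 2 = r}"

lemma mod_2_Suc_neq: "a mod 2 \<noteq> Suc a mod (2::nat)"
  by presburger

lemmas parity_neq = mod_2_Suc_neq mod_2_Suc_neq[symmetric]

text \<open>The ends of a bond in the fastest direction are already consecutive in the reference
  ordering, so the empty relation will do and only the 16 block layers are paid for.\<close>

lemma bond_class3:
  assumes "L \<ge> 1" shows "bond_class L 16 (bonds3 r L)"
proof (rule bond_classI[where Q = "{}" and d = 0 and g = 0])
  have "dgop (rsg {}) = idm"
    by (simp add: dgop_def idm_def fun_eq_iff)
  moreover have "impl L (lattice L) 0 0 idm" by (rule impl_mono[OF impl_idm]) auto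
  ultimately show "impl L (lattice L) 0 0 (dgop (rsg {}))" by simp
next
  fix x y x' y' :: site assume "(x, y) \<in> bonds3 r L" "(x', y') \<in> bonds3 r L" "(x, y) \<noteq> (x', y')"
  then show "{x, y} \<inter> {x', y'} = {}" by (auto simp: bonds3_def parity_neq)
next
  fix x y z assume xy: "(x, y) \<in> bonds3 r L" and z: "z \<in> lattice L - {x, y}"
  obtain a b c i j k where x: "x = (a, b, c)" and zz: "z = (i, j, k)" by (metis prod_cases3)
  have y: "y = (a, b, Suc c)" and lat: "(a, b, c) \<in> lattice L" "(a, b, Suc c) \<in> lattice L" "(i, j, k) \<in> lattice L"
    using xy z by (auto simp: bonds3_def x zz lattice_def)
  show "rel_xor (srel L x y) {} x z = rel_xor (srel L x y) {} y z"
    using z lat unfolding x y zz by (auto simp: rel_xor_def srel_def ref_idx_less_iff)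
qed (use assms in \<open>auto simp: bonds3_def lattice_def dist_l1_def ndist_def\<close>)

text \<open>The inversions that arise when the rows \<open>b\<close> and \<open>Suc b\<close> of a
  plane, for \<open>b\<close> of parity \<open>r\<close>, are merged into one row alternating
  between them: site \<open>c\<close> of the first row is overtaken by the sites before
  \<open>c\<close> of the second.\<close>

definition ladder2 :: "nat \<Rightarrow> nat \<Rightarrow> (site \<times> site) set" where
  "ladder2 r L = {((a, b, c), (a', b', c')). a' = a \<and> b' = Suc b \<and> c' < c \<and> a < L \<and> b' < L \<and> c < L \<and> b mod 2 = r}"

lemma impl_ladder2:
  "impl L (lattice L) (2 * L + 10) (12 * L ^ 3) (dgop (rsg (ladder2 r L)))"
proof -
  let ?js = "filter (\<lambda>(a, b). Suc b < L \<and> b mod 2 = r) (List.product [0..<L] [0..<L])"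
  let ?u = "\<lambda>(a, b) k. (a, b, k)" and ?w = "\<lambda>(a, b) k. (a, Suc b, k)"
  have eq: "(\<Union>j\<in>set ?js. ladder_rel (?u j) (?w j) L) = ladder2 r L"
    by (fastforce simp: ladder2_def ladder_rel_def)
  have "impl L (lattice L) (2 * L + 10) (length ?js * L * 12)
      (dgop (rsg (\<Union>j\<in>set ?js. ladder_rel (?u j) (?w j) L)))"
    by (rule impl_ladders)
      (auto simp: distinct_product lattice_def dist_l1_def ndist_def parity_neq)
  moreover have "length ?js \<le> L * L"
    using length_filter_le[of _ "List.product [0..<L] [0..<L]"] by (simp del: length_filter_le)
  then have "length ?js * L * 12 \<le> 12 * L ^ 3" by (simp add: power3_eq_cube)
  ultimately show ?thesis unfolding eq by (auto elim: impl_mono)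
qed

text \<open>Both ends see a third site alike in the merged order because they are consecutive there.
  The constant 40 covers two sign circuits and the blocks: \<open>2 * (2 * L + 10) + 16\<close>
  layers and \<open>(2 * 12 + 16) * L ^ 3\<close> gates.\<close>

lemma bond_class2:
  assumes "L \<ge> 1" shows "bond_class L 40 (bonds2 r L)"
proof (rule bond_classI[OF impl_ladder2])
  fix x y x' y' :: site assume "(x, y) \<in> bonds2 r L" "(x', y') \<in> bonds2 r L" "(x, y) \<noteq> (x', y')"
  then show "{x, y} \<inter> {x', y'} = {}" by (auto simp: bonds2_def parity_neq)
next
  fix x y z assume xy: "(x, y) \<in> bonds2 r L" and z: "z \<in> lattice L - {x, y}"
  obtain a b c i j k where x: "x = (a, b, c)" and zz: "z = (i, j, k)" by (metis prod_cases3)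
  have y: "y = (a, Suc b, c)" and r: "b mod 2 = r"
    and lat: "(a, b, c) \<in> lattice L" "(a, Suc b, c) \<in> lattice L" "(i, j, k) \<in> lattice L"
    using xy z by (auto simp: bonds2_def x zz lattice_def)
  \<comment> \<open>Within the class a row is merged with one neighbour only: the upper row of the
    bond is not merged with the next one, nor the lower row with the one before it.\<close>
  have par: "Suc b mod 2 \<noteq> r" "b = Suc j \<Longrightarrow> j mod 2 \<noteq> r" using r mod_2_Suc_neq by metis+
  have bounds: "a < L" "Suc b < L" "c < L" "i < L" "j < L" "k < L" using lat by (auto simp: lattice_def)
  have ne: "\<not> (i = a \<and> j = b \<and> k = c)" "\<not> (i = a \<and> j = Suc b \<and> k = c)"
    using z by (auto simp: x y zz)
  consider "i \<noteq> a" | "i = a" "j = b" | "i = a" "j = Suc b" | "i = a" "j < b" | "i = a" "j > Suc b" by linarith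
  then show "rel_xor (srel L x y) (ladder2 r L) x z = rel_xor (srel L x y) (ladder2 r L) y z"
    using z lat par r bounds ne unfolding x y zz rel_xor_def srel_def ladder2_def
    by cases (auto simp: ref_idx_less_iff)
qed (use assms in \<open>auto simp: bonds2_def ladder2_def lattice_def dist_l1_def ndist_def\<close>)

lemma rsg_prod: "finite R \<Longrightarrow> rsg R S = (\<Prod>p\<in>R. if fst p \<in> S \<and> snd p \<in> S then -1 else 1)"
proof -
  assume "finite R"
  moreover have "{p \<in> R. fst p \<in> S \<and> snd p \<in> S} = R \<inter> S \<times> S" by auto
  ultimately show ?thesis by (simp add: rsg_def prod.If_cases Int_def)
qed

text \<open>Merging the planes \<open>a\<close> and \<open>Suc a\<close> site by site inverts a site
  of the first plane with every lexicographically earlier site of the second. The inverted pairs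
  split into those within corresponding rows, which form ladders, and those between different rows,
  which involve whole rows (\<open>ladder1_plane\<close>).\<close>

definition ladder1_row :: "nat \<Rightarrow> nat \<Rightarrow> (site \<times> site) set" where
  "ladder1_row r L = {((a, b, c), (a', b', c')). a' = Suc a \<and> b' = b \<and> c' < c \<and> a' < L \<and> b < L \<and> c < L \<and> a mod 2 = r}"

definition ladder1_plane :: "nat \<Rightarrow> nat \<Rightarrow> (site \<times> site) set" where
  "ladder1_plane r L = {((a, b, c), (a', b', c')). a' = Suc a \<and> b' < b \<and> a' < L \<and> b < L \<and> c < L \<and> c' < L \<and> a mod 2 = r}"

lemma impl_ladder1_row:
  "impl L (lattice L) (2 * L + 10) (12 * L ^ 3) (dgop (rsg (ladder1_row r L)))"
proof -
  let ?js = "filter (\<lambda>(a, b). Suc a < L \<and> a mod 2 = r) (List.product [0..<L] [0..<L])"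
  let ?u = "\<lambda>(a, b) k. (a, b, k)" and ?w = "\<lambda>(a, b) k. (Suc a, b, k)"
  have eq: "(\<Union>j\<in>set ?js. ladder_rel (?u j) (?w j) L) = ladder1_row r L"
    by (fastforce simp: ladder1_row_def ladder_rel_def)
  have "impl L (lattice L) (2 * L + 10) (length ?js * L * 12)
      (dgop (rsg (\<Union>j\<in>set ?js. ladder_rel (?u j) (?w j) L)))"
    by (rule impl_ladders)
      (auto simp: distinct_product lattice_def dist_l1_def ndist_def parity_neq)
  moreover have "length ?js \<le> L * L"
    using length_filter_le[of _ "List.product [0..<L] [0..<L]"] by (simp del: length_filter_le)
  then have "length ?js * L * 12 \<le> 12 * L ^ 3" by (simp add: power3_eq_cube)
  ultimately show ?thesis unfolding eq by (auto elim: impl_mono)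
qed

text \<open>After prefix sums along all rows, the last site of each row carries the parity of the row,
  so a ladder in the last column couples whole rows.\<close>
lemma impl_ladder1_plane:
  assumes "L \<ge> 1"
  shows "impl L (lattice L) (4 * L + 10) (14 * L ^ 3) (dgop (rsg (ladder1_plane r L)))"
proof -
  let ?js = "filter (\<lambda>a. Suc a < L \<and> a mod 2 = r) [0..<L]"
  let ?u = "\<lambda>a k. (a, k, L - 1)" and ?w = "\<lambda>a k. (Suc a, k, L - 1)"
  let ?Q = "\<Union>a\<in>set ?js. ladder_rel (?u a) (?w a) L"
  have D: "impl L (lattice L) (2 * L + 10) (length ?js * L * 12) (dgop (rsg ?Q))"
    by (rule impl_ladders) (use assms in \<open>auto simp: lattice_def dist_l1_def ndist_def parity_neq\<close>)
  have Q: "?Q = {((a, b, c), (a', b', c')). a' = Suc a \<and> b' < b \<and> c = L - 1 \<and> c' = L - 1 \<and> a' < L \<and> b < L \<and> a mod 2 = r}"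
    by (fastforce simp: ladder_rel_def)
  have finQ: "finite ?Q" by simp
  let ?rows = "List.product [0..<L] [0..<L]" and ?line = "\<lambda>(a, b) k. (a, b, k)"
  have "\<exists>f. rev_impl L (\<Union>j\<in>set ?rows. ?line j ` {..<L}) L (length ?rows * L) f \<and>
      prefix_sums ?line ?rows L f"
    by (rule rev_impl_chains)
      (auto simp: distinct_product inj_on_def lattice_def dist_l1_def ndist_def)
  then obtain f where f: "rev_impl L (\<Union>j\<in>set ?rows. ?line j ` {..<L}) L (length ?rows * L) f"
    and odd: "\<And>S j k. j \<in> set ?rows \<Longrightarrow> k < L \<Longrightarrow> ?line j k \<in> f S \<longleftrightarrow> odd (pc (?line j) S (Suc k))"
    unfolding prefix_sums_def by blast
  have "rev_impl L (lattice L) L (length ?rows * L) f"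
    by (rule rev_impl_mono[OF f]) (auto simp: lattice_def)
  then obtain C where C: "impl L (lattice L) L (length ?rows * L) (permop f)"
      "impl L (lattice L) L (length ?rows * L) C" "opeq L (mmult L C (permop f)) idm"
      "\<And>S. S \<subseteq> lattice L \<Longrightarrow> f S \<subseteq> lattice L"
    unfolding rev_impl_def by blast
  define row :: "site \<Rightarrow> site set" where "row = (\<lambda>(a, b, c::nat). (\<lambda>k. (a, b, k)) ` {..<L})"
  have card_row: "card (row (a, b, c) \<inter> S) = pc (\<lambda>k. (a, b, k)) S L" for a b c :: nat and S
  proof -
    have "row (a, b, c) \<inter> S = (\<lambda>k. (a, b, k)) ` {k. k < L \<and> (a, b, k) \<in> S}"
      by (auto simp: row_def)
    then show ?thesis by (simp add: pc_def card_image inj_on_def)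
  qed
  have last: "(a, b, L - 1) \<in> f S \<longleftrightarrow> odd (card (row (a, b, c) \<inter> S))" if "a < L" "b < L" for a b S c
    using odd[of "(a, b)" "L - 1" S] that assms by (simp add: card_row)
  \<comment> \<open>A pair of last sites in \<open>?Q\<close> is doubly occupied after the prefix
    sums exactly if both rows have odd parity, and this is the sign of the product of the two
    rows.\<close>
  have sign: "rsg ?Q (f S) = rsg (ladder1_plane r L) S" for S
  proof -
    have "rsg ?Q (f S) = (\<Prod>p\<in>?Q. if fst p \<in> f S \<and> snd p \<in> f S then -1 else 1)"
      by (rule rsg_prod[OF finQ])
    also have "\<dots> = (\<Prod>p\<in>?Q. rsg (row (fst p) \<times> row (snd p)) S)"
    proof (rule prod.cong[OF refl])
      fix p assume "p \<in> ?Q"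
      then obtain a b b' where p: "p = ((a, b, L - 1), (Suc a, b', L - 1))" "Suc a < L" "b < L" "b' < b"
        unfolding Q by auto
      then show "(if fst p \<in> f S \<and> snd p \<in> f S then -1 else 1) = rsg (row (fst p) \<times> row (snd p)) S"
        using last[of a b S "L - 1"] last[of "Suc a" b' S "L - 1"]
        unfolding rsg_Times minus_one_power_mult by simp
    qed
    also have "\<dots> = rsg (\<Union>p\<in>?Q. row (fst p) \<times> row (snd p)) S"
    proof (rule rsg_UN[symmetric, OF finQ])
      show "finite (row (fst p) \<times> row (snd p))" for p
        by (simp add: row_def split: prod.splits)
      fix p q assume pq: "p \<in> ?Q" "q \<in> ?Q" "p \<noteq> q"
      obtain a b b' where p: "p = ((a, b, L - 1), (Suc a, b', L - 1))"
        using pq(1) unfolding Q by auto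
      obtain i j j' where q: "q = ((i, j, L - 1), (Suc i, j', L - 1))"
        using pq(2) unfolding Q by auto
      show "row (fst p) \<times> row (snd p) \<inter> row (fst q) \<times> row (snd q) = {}"
        using pq(3) unfolding p q row_def by auto
    qed
    also have "(\<Union>p\<in>?Q. row (fst p) \<times> row (snd p)) = ladder1_plane r L"
    proof -
      have 1: "p \<in> ladder1_plane r L" if "q \<in> ?Q" "p \<in> row (fst q) \<times> row (snd q)" for p q
        using that unfolding Q row_def ladder1_plane_def by auto
      have 2: "\<exists>q\<in>?Q. p \<in> row (fst q) \<times> row (snd q)" if plane: "p \<in> ladder1_plane r L" for p
      proof -
        obtain a b c b' c' where p: "p = ((a, b, c), (Suc a, b', c'))" "b' < b" "Suc a < L" "b < L"
          "c < L" "c' < L" "a mod 2 = r"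
          using plane unfolding ladder1_plane_def by auto
        have "((a, b, L - 1), (Suc a, b', L - 1)) \<in> ?Q" unfolding Q using p by simp
        moreover have "p \<in> row (a, b, L - 1) \<times> row (Suc a, b', L - 1)"
          using p(5,6) by (simp add: p(1) row_def)
        ultimately show ?thesis by (intro bexI[of _ "((a, b, L - 1), (Suc a, b', L - 1))"]) simp_all
      qed
      show ?thesis
      proof (intro equalityI subsetI)
        fix p assume "p \<in> (\<Union>p\<in>?Q. row (fst p) \<times> row (snd p))"
        then show "p \<in> ladder1_plane r L" by (rule UN_E) (rule 1)
      next
        fix p assume "p \<in> ladder1_plane r L"
        from 2[OF this] show "p \<in> (\<Union>p\<in>?Q. row (fst p) \<times> row (snd p))"
          by (elim bexE) (rule UN_I)
      qed
    qed
    finally show ?thesis .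
  qed
  \<comment> \<open>The ladders act between computing and undoing the row parities. Two passes over
    all rows cost \<open>2 * L ^ 3\<close> gates, the ladders at most
    \<open>12 * L ^ 3\<close>.\<close>
  have "impl L (lattice L) (L + (2 * L + 10) + L) (length ?rows * L + length ?js * L * 12 + length ?rows * L)
      (mmult L C (mmult L (dgop (rsg ?Q)) (permop f)))"
    by (intro impl_seq C D)
  moreover have "opeq L (mmult L C (mmult L (dgop (rsg ?Q)) (permop f))) (dgop (rsg (ladder1_plane r L)))"
  proof -
    have "opeq L (mmult L C (mmult L (dgop (rsg ?Q)) (permop f)))
      (mmult L C (mmult L (permop f) (dgop (\<lambda>S. rsg ?Q (f S)))))"
      by (intro opeq_mmult_r dgop_permop C)
    also have "opeq L \<dots> (dgop (\<lambda>S. rsg ?Q (f S)))" by (rule mmult_cancel[OF C(3)])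
    finally show ?thesis unfolding sign .
  qed
  ultimately have 1: "impl L (lattice L) (L + (2 * L + 10) + L)
      (length ?rows * L + length ?js * L * 12 + length ?rows * L) (dgop (rsg (ladder1_plane r L)))"
    by (rule impl_cong)
  have "length ?js * L \<le> L * L * L"
  proof -
    have "length ?js \<le> L" using length_filter_le[of _ "[0..<L]"] by (simp del: length_filter_le)
    also have "L \<le> L * L" by simp
    finally show ?thesis by (rule mult_le_mono1)
  qed
  then have "length ?rows * L + length ?js * L * 12 + length ?rows * L \<le> 14 * L ^ 3"
    by (simp add: power3_eq_cube)
  then show ?thesis by (rule impl_mono[OF 1 order_refl, rotated]) simp
qed

text \<open>The two parts of the inversion set are disjoint, so their signs multiply and their
  circuits are concatenated. The constant 70 bounds \<open>2 * (6 * L + 20) + 16\<close> layers and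
  \<open>(2 * 26 + 16) * L ^ 3\<close> gates.\<close>

lemma bond_class1:
  assumes "L \<ge> 1" shows "bond_class L 70 (bonds1 r L)"
proof -
  let ?Q = "ladder1_row r L \<union> ladder1_plane r L"
  have fin: "finite (ladder1_row r L)" "finite (ladder1_plane r L)"
    by (rule finite_subset[of _ "lattice L \<times> lattice L"];
        force simp: ladder1_row_def ladder1_plane_def lattice_def)+
  have disj: "ladder1_row r L \<inter> ladder1_plane r L = {}"
    by (auto simp: ladder1_row_def ladder1_plane_def)
  have "impl L (lattice L) (2 * L + 10 + (4 * L + 10)) (12 * L ^ 3 + 14 * L ^ 3)
      (mmult L (dgop (rsg (ladder1_plane r L))) (dgop (rsg (ladder1_row r L))))"
    by (rule impl_seq[OF impl_ladder1_row impl_ladder1_plane[OF assms]])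
  moreover have "dgop (rsg ?Q) = dgop (\<lambda>S. rsg (ladder1_plane r L) S * rsg (ladder1_row r L) S)"
    using rsg_Un[OF fin disj] by (simp add: mult.commute fun_eq_iff dgop_def)
  ultimately have D: "impl L (lattice L) (2 * L + 10 + (4 * L + 10)) (12 * L ^ 3 + 14 * L ^ 3) (dgop (rsg ?Q))"
    using impl_cong[OF _ dgop_mmult] by simp
  show ?thesis
  proof (rule bond_classI[OF D])
    fix x y x' y' :: site assume "(x, y) \<in> bonds1 r L" "(x', y') \<in> bonds1 r L" "(x, y) \<noteq> (x', y')"
    then show "{x, y} \<inter> {x', y'} = {}" by (auto simp: bonds1_def parity_neq)
  next
    fix x y z assume xy: "(x, y) \<in> bonds1 r L" and z: "z \<in> lattice L - {x, y}"
    obtain a b c i j k where x: "x = (a, b, c)" and zz: "z = (i, j, k)" by (metis prod_cases3)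
    have y: "y = (Suc a, b, c)" and r: "a mod 2 = r"
      and lat: "(a, b, c) \<in> lattice L" "(Suc a, b, c) \<in> lattice L" "(i, j, k) \<in> lattice L"
      using xy z by (auto simp: bonds1_def x zz lattice_def)
    have par: "Suc a mod 2 \<noteq> r" "a = Suc i \<Longrightarrow> i mod 2 \<noteq> r" using r mod_2_Suc_neq by metis+
    have bounds: "a < L" "Suc a < L" "b < L" "c < L" "i < L" "j < L" "k < L" using lat by (auto simp: lattice_def)
    have ne: "\<not> (i = a \<and> j = b \<and> k = c)" "\<not> (i = Suc a \<and> j = b \<and> k = c)"
      using z by (auto simp: x y zz)
    consider "i = a" | "i = Suc a" | "i < a" | "i > Suc a" by linarith
    then show "rel_xor (srel L x y) ?Q x z = rel_xor (srel L x y) ?Q y z"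
      using z lat par r bounds ne unfolding x y zz rel_xor_def srel_def ladder1_row_def ladder1_plane_def
      by cases (auto simp: ref_idx_less_iff)
  qed (use assms in \<open>auto simp: bonds1_def ladder1_row_def ladder1_plane_def lattice_def dist_l1_def ndist_def\<close>)
qed

section \<open>Exponentials of admissible terms\<close>

lemma sg_mmult: "(\<And>U. s U * s U = 1) \<Longrightarrow> mmult L (sg s A) (sg s B) = sg s (mmult L A B)"
proof (intro ext)
  fix T S assume s: "\<And>U. s U * s U = 1"
  have "sg s A T U * sg s B U S = s T * s S * (A T U * B U S)" for U
  proof -
    have "sg s A T U * sg s B U S = (s U * s U) * (s T * s S * (A T U * B U S))"
      unfolding sg_def by (simp only: ac_simps)
    then show ?thesis by (simp add: s)
  qed
  then have "mmult L (sg s A) (sg s B) T S = (\<Sum>U\<in>Pow (lattice L). s T * s S * (A T U * B U S))"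
    unfolding mmult_def by (rule sum.cong[OF refl])
  also have "\<dots> = sg s (mmult L A B) T S"
    by (simp only: sg_def mmult_def sum_distrib_left)
  finally show "mmult L (sg s A) (sg s B) T S = sg s (mmult L A B) T S" .
qed

lemma madd_sg: "madd (sg s A) (sg s B) = sg s (madd A B)"
  by (simp add: madd_def sg_def fun_eq_iff distrib_left)

lemma smult_sg: "smult c (sg s A) = sg s (smult c A)"
  by (simp add: smult_def sg_def fun_eq_iff)

lemma opeq_sg: "opeq L A B \<Longrightarrow> opeq L (sg s A) (sg s B)"
  by (simp add: opeq_def sg_def)

lemma cnj_rsg [simp]: "cnj (rsg R S) = rsg R S"
  by (simp add: rsg_def)

lemma adj_sg_rsg: "adj (sg (rsg R) A) = sg (rsg R) (adj A)"
  by (simp add: adj_def sg_def fun_eq_iff)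

lemma adj_tq: "adj (tq x y h) = tq x y (\<lambda>a b c d. cnj (h c d a b))"
  by (simp add: adj_def tq_def fun_eq_iff)

lemma madd_tq: "madd (tq x y g) (tq x y h) = tq x y (\<lambda>a b c d. g a b c d + h a b c d)"
  by (simp add: madd_def tq_def fun_eq_iff)

lemma smult_tq: "smult k (tq x y h) = tq x y (\<lambda>a b c d. k * h a b c d)"
  by (simp add: smult_def tq_def fun_eq_iff)

lemma ref_idx_eq_iff:
  assumes "x \<in> lattice L" "y \<in> lattice L"
  shows "ref_idx L x = ref_idx L y \<longleftrightarrow> x = y"
proof
  assume "ref_idx L x = ref_idx L y"
  then show "x = y"
    using ref_idx_less_iff[of "fst x" "fst (snd x)" "snd (snd x)" L "fst y" "fst (snd y)" "snd (snd y)"]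
      ref_idx_less_iff[of "fst y" "fst (snd y)" "snd (snd y)" L "fst x" "fst (snd x)" "snd (snd x)"] assms
    by (simp add: prod_eq_iff) linarith
qed simp

text \<open>The Jordan-Wigner sign of \<open>ann L v\<close> relative to the ordering that puts \<open>x\<close>, \<open>y\<close> first:
  mode \<open>v\<close> sees the modes \<open>w\<close> with \<open>front_sees L x y v w\<close>.\<close>
definition front_sees :: "nat \<Rightarrow> site \<Rightarrow> site \<Rightarrow> site \<Rightarrow> site \<Rightarrow> bool" where
  "front_sees L x y v w \<longleftrightarrow>
    (if v \<in> {x, y} then w \<in> {x, y} \<and> ref_idx L w < ref_idx L v
     else w \<in> {x, y} \<or> ref_idx L w < ref_idx L v)"

definition ann_front :: "nat \<Rightarrow> site \<Rightarrow> site \<Rightarrow> site \<Rightarrow> op" where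
  "ann_front L x y v T S =
    (if v \<in> S \<and> T = S - {v} then \<Prod>w\<in>T. if front_sees L x y v w then -1 else 1 else 0)"

text \<open>\<open>w\<close> precedes \<open>v\<close> in the reference ordering exactly if either
  it does so in the front ordering or the pair is inverted, but not both. The inverted pairs
  contribute the ratio of the signs of \<open>S\<close> and \<open>T\<close>, by
  \<open>rsg_insert\<close>.\<close>

lemma ann_sg:
  assumes "x \<in> lattice L" "y \<in> lattice L" "v \<in> lattice L"
  shows "opeq L (ann L v) (sg (rsg (srel L x y)) (ann_front L x y v))"
proof (rule opeqI)
  fix T S assume TS: "T \<subseteq> lattice L" "S \<subseteq> lattice L"
  let ?R = "srel L x y"
  show "ann L v T S = sg (rsg ?R) (ann_front L x y v) T S"
  proof (cases "v \<in> S \<and> T = S - {v}")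
    case True
    then have S: "S = insert v T" "v \<notin> T" by auto
    have fin: "finite T" "finite S" using TS finite_lattice finite_subset by blast+
    have vR: "(v, v) \<notin> ?R" by (auto simp: srel_def)
    have "ann L v T S = (\<Prod>w\<in>S. if ref_idx L w < ref_idx L v then -1 else 1)"
      using True fin by (simp add: ann_def sign_prod_card)
    also have "\<dots> = (\<Prod>w\<in>T. if ref_idx L w < ref_idx L v then -1 else 1)"
      using S fin by simp
    also have "\<dots> = (\<Prod>w\<in>T. if ((v, w) \<in> ?R) \<noteq> ((w, v) \<in> ?R) then -1 else 1)
        * (\<Prod>w\<in>T. if front_sees L x y v w then -1 else 1)"
      unfolding prod.distrib[symmetric]
    proof (rule prod.cong[OF refl])
      fix w assume w: "w \<in> T"
      then have wl: "w \<in> lattice L" "w \<noteq> v" using TS S by auto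
      then have "ref_idx L w \<noteq> ref_idx L v" using ref_idx_eq_iff assms by blast
      then show "(if ref_idx L w < ref_idx L v then -1 else 1) =
        (if ((v, w) \<in> ?R) \<noteq> ((w, v) \<in> ?R) then -1 else 1) *
        (if front_sees L x y v w then -1 else (1::complex))"
        using wl assms by (auto simp: srel_def front_sees_def)
    qed
    also have "\<dots> = sg (rsg ?R) (ann_front L x y v) T S"
      using True rsg_insert[OF fin(1) S(2) vR] unfolding S(1)[symmetric]
      by (simp add: sg_def ann_front_def flip: mult.assoc)
    finally show ?thesis .
  next
    case False
    then show ?thesis unfolding ann_def sg_def ann_front_def by (simp only: if_False mult_zero_right)
  qed
qed

lemma sign_prod_single:
  "finite T \<Longrightarrow> (\<Prod>w\<in>T. if w = y \<and> p then -1 else (1::complex)) = (if y \<in> T \<and> p then -1 else 1)"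
  by (cases p) (simp_all add: prod.delta)

text \<open>With \<open>x\<close> and \<open>y\<close> in front, the string of \<open>x\<close>
  contains at most the mode \<open>y\<close>.\<close>

lemma ann_front_tq:
  assumes "x \<noteq> y"
  shows "\<exists>h. opeq L (ann_front L x y x) (tq x y h)"
proof -
  have "opeq L (ann_front L x y x)
    (tq x y (\<lambda>a b c d. if c \<and> \<not> a \<and> b = d then (if b \<and> ref_idx L y < ref_idx L x then -1 else 1) else 0))"
  proof (rule opeqI)
    fix T S assume "T \<subseteq> lattice L"
    then have fin: "finite T" by (rule finite_subset) simp
    have "front_sees L x y x w \<longleftrightarrow> w = y \<and> ref_idx L y < ref_idx L x" for w
      by (auto simp: front_sees_def)
    moreover have "x \<in> S \<and> T = S - {x} \<longleftrightarrow> T - {x, y} = S - {x, y} \<and> x \<in> S \<and> x \<notin> T \<and> (y \<in> T \<longleftrightarrow> y \<in> S)"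
      using assms by blast
    ultimately show "ann_front L x y x T S = tq x y (\<lambda>a b c d.
      if c \<and> \<not> a \<and> b = d then (if b \<and> ref_idx L y < ref_idx L x then -1 else 1) else 0) T S"
      using fin by (simp add: ann_front_def tq_def sign_prod_single)
  qed
  then show ?thesis by blast
qed

lemma ann_front_commute: "ann_front L x y v = ann_front L y x v"
proof -
  have "front_sees L x y v w = front_sees L y x v w" for w
    by (auto simp: front_sees_def)
  then show ?thesis by (simp add: ann_front_def fun_eq_iff)
qed

lemma sg_idm: "sg (rsg R) idm = idm"
  by (simp add: sg_def idm_def fun_eq_iff)

lemma idm_tq: "idm = tq x y (\<lambda>a b c d. if a = c \<and> b = d then 1 else 0)"
proof (intro ext)
  fix T S
  have "T = S \<longleftrightarrow> T - {x, y} = S - {x, y} \<and> (x \<in> T \<longleftrightarrow> x \<in> S) \<and> (y \<in> T \<longleftrightarrow> y \<in> S)" by blast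
  then show "idm T S = tq x y (\<lambda>a b c d. if a = c \<and> b = d then 1 else 0) T S"
    by (simp add: idm_def tq_def)
qed

text \<open>All four generators become two-qubit operators under one common sign conjugation. The
  sign squares to one, so the conjugation respects products, and the form survives the closure
  operations.\<close>

lemma alg2_tq:
  assumes xy: "x \<noteq> y" "x \<in> lattice L" "y \<in> lattice L" and "A \<in> alg2 L x y"
  shows "\<exists>h. opeq L A (sg (rsg (srel L x y)) (tq x y h))"
  using assms(4)
proof induction
  let ?s = "rsg (srel L x y)"
  have ann: "\<exists>h. opeq L (ann L v) (sg ?s (tq x y h))" if v: "v \<in> {x, y}" for v
  proof -
    obtain h where h: "opeq L (ann_front L x y v) (tq x y h)"
      using v ann_front_tq[OF xy(1), of L] ann_front_tq[OF xy(1)[symmetric], of L]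
      unfolding ann_front_commute[of L y x] tq_commute[of y x] by blast
    have "opeq L (ann L v) (sg ?s (ann_front L x y v))" by (rule ann_sg) (use v xy in auto)
    also have "opeq L \<dots> (sg ?s (tq x y h))" by (rule opeq_sg[OF h])
    finally show ?thesis by blast
  qed
  have cre: "\<exists>h. opeq L (cre L v) (sg ?s (tq x y h))" if v: "v \<in> {x, y}" for v
  proof -
    obtain h where "opeq L (ann L v) (sg ?s (tq x y h))" using ann[OF v] by blast
    from opeq_adj[OF this] show ?thesis unfolding cre_def adj_sg_rsg adj_tq by blast
  qed
  {
    case a_id
    have "idm = sg ?s (tq x y (\<lambda>a b c d. if a = c \<and> b = d then 1 else 0))"
      using sg_idm idm_tq by metis
    then show ?case by (metis opeq_refl)
  next
    case a_cx show ?case by (rule ann) simp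
  next
    case a_cy show ?case by (rule ann) simp
  next
    case a_cdx show ?case by (rule cre) simp
  next
    case a_cdy show ?case by (rule cre) simp
  next
    case (a_add A B)
    then obtain g h where "opeq L A (sg ?s (tq x y g))" "opeq L B (sg ?s (tq x y h))" by blast
    from opeq_madd[OF this] show ?case unfolding madd_sg madd_tq by blast
  next
    case (a_smult A c)
    then obtain g where "opeq L A (sg ?s (tq x y g))" by blast
    from opeq_smult[OF this, of c] show ?case unfolding smult_sg smult_tq by blast
  next
    case (a_mult A B)
    then obtain g h where "opeq L A (sg ?s (tq x y g))" "opeq L B (sg ?s (tq x y h))" by blast
    from opeq_mmult[OF this]
    have 1: "opeq L (mmult L A B) (sg ?s (mmult L (tq x y g) (tq x y h)))" by (simp add: sg_mmult)
    show ?case using opeq_trans[OF 1 opeq_sg[OF tq_mmult[OF xy]]] by blast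
  }
qed

lemma num_dgop:
  assumes "x \<in> lattice L"
  shows "opeq L (num L x) (dgop (\<lambda>S. if x \<in> S then 1 else 0))"
proof (rule opeqI)
  fix T S assume TS: "T \<subseteq> lattice L" "S \<subseteq> lattice L"
  let ?e = "\<lambda>S. (-1) ^ card {y \<in> S. ref_idx L y < ref_idx L x} :: complex"
  have "num L x T S = (\<Sum>U\<in>Pow (lattice L). if U = T - {x} then
    (if x \<in> T then ?e T else 0) * (if x \<in> S \<and> U = S - {x} then ?e S else 0) else 0)"
    unfolding num_def mmult_def cre_def adj_def ann_def by (rule sum.cong) auto
  also have "\<dots> = (if x \<in> T then ?e T else 0) * (if x \<in> S \<and> T - {x} = S - {x} then ?e S else 0)"
    using TS by (simp add: subset_insertI2 subset_iff)
  also have "\<dots> = dgop (\<lambda>S. if x \<in> S then 1 else 0) T S"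
  proof -
    have "x \<in> T \<Longrightarrow> x \<in> S \<Longrightarrow> T - {x} = S - {x} \<longleftrightarrow> T = S" by blast
    then show ?thesis by (auto simp: dgop_def power_mult_distrib[symmetric] simp del: power_mult_distrib)
  qed
  finally show "num L x T S = dgop (\<lambda>S. if x \<in> S then 1 else 0) T S" .
qed

lemma parity2_dgop:
  assumes "x \<in> lattice L" "y \<in> lattice L"
  shows "opeq L (parity2 L x y) (dgop (\<lambda>S. if (x \<in> S) = (y \<in> S) then 1 else -1))"
proof -
  have 1: "opeq L (madd idm (smult (-2) (num L v))) (dgop (\<lambda>S. if v \<in> S then -1 else 1))"
    if "v \<in> lattice L" for v
  proof -
    have "opeq L (madd idm (smult (-2) (num L v))) (madd idm (smult (-2) (dgop (\<lambda>S. if v \<in> S then 1 else 0))))"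
      by (intro opeq_madd opeq_smult num_dgop that opeq_refl)
    also have "madd idm (smult (-2) (dgop (\<lambda>S. if v \<in> S then 1 else 0))) = dgop (\<lambda>S. if v \<in> S then -1 else 1)"
      by (auto simp: madd_def smult_def dgop_def idm_def fun_eq_iff)
    finally show ?thesis .
  qed
  have "opeq L (parity2 L x y) (dgop (\<lambda>S. (if x \<in> S then -1 else 1) * (if y \<in> S then -1 else 1)))"
    unfolding parity2_def by (rule opeq_trans[OF opeq_mmult[OF 1 1] dgop_mmult]) fact+
  also have "(\<lambda>S. (if x \<in> S then -1 else 1) * (if y \<in> S then -1 else 1)) =
    (\<lambda>S. if (x \<in> S) = (y \<in> S) then 1 else (-1::complex))" by auto
  finally show ?thesis .
qed

text \<open>Commuting with the parity kills the entries between the two sectors. That the blocks are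
  Hermitian is read off at configurations without further particles, where their entries appear up
  to a nonzero sign.\<close>

lemma admissible_blk:
  assumes xy: "x \<noteq> y" "x \<in> lattice L" "y \<in> lattice L" and adm: "admissible_term L x y H"
  shows "\<exists>Be Bo. (\<forall>a c. cnj (Be c a) = Be a c) \<and> (\<forall>a c. cnj (Bo c a) = Bo a c) \<and>
    opeq L H (sg (rsg (srel L x y)) (blk x y Be Bo))"
proof -
  let ?s = "rsg (srel L x y)"
  obtain h where h: "opeq L H (sg ?s (tq x y h))"
    using alg2_tq[OF xy] adm unfolding admissible_term_def by blast
  let ?p = "\<lambda>S. if (x \<in> S) = (y \<in> S) then 1 else (-1::complex)"
  define Be where "Be = (\<lambda>a c. h a a c c)"
  define Bo where "Bo = (\<lambda>a c. h a (\<not> a) c (\<not> c))"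
  have HP: "opeq L (mmult L H (dgop ?p)) (mmult L (dgop ?p) H)"
  proof -
    note par = parity2_dgop[OF xy(2,3)]
    have "opeq L (mmult L H (dgop ?p)) (mmult L H (parity2 L x y))"
      by (rule opeq_mmult_r[OF opeq_sym[OF par]])
    also have "opeq L \<dots> (mmult L (parity2 L x y) H)" using adm unfolding admissible_term_def by blast
    also have "opeq L \<dots> (mmult L (dgop ?p) H)" by (rule opeq_mmult_l[OF par])
    finally show ?thesis .
  qed
  have zero: "H T S = 0" if "T \<subseteq> lattice L" "S \<subseteq> lattice L" "((x \<in> T) = (y \<in> T)) \<noteq> ((x \<in> S) = (y \<in> S))" for T S
  proof -
    have "H T S * ?p S = ?p T * H T S"
      using opeqD[OF HP that(1,2)] that by (simp add: mmult_dgop_left mmult_dgop_right)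
    then show ?thesis using that(3) by (simp split: if_splits)
  qed
  have Hblk: "H T S = sg ?s (blk x y Be Bo) T S" if TS: "T \<subseteq> lattice L" "S \<subseteq> lattice L" for T S
  proof (cases "((x \<in> T) = (y \<in> T)) = ((x \<in> S) = (y \<in> S))")
    case True
    have "tq x y h T S = blk x y Be Bo T S"
      using True by (cases "x \<in> T"; cases "y \<in> T"; cases "x \<in> S"; cases "y \<in> S")
         (simp_all add: tq_def blk_def Be_def Bo_def)
    then show ?thesis using opeqD[OF h TS] by (simp add: sg_def)
  next
    case False
    then show ?thesis using zero[OF TS] by (simp add: sg_def blk_def tq_def)
  qed
  have herm: "cnj (H S T) = H T S" if "T \<subseteq> lattice L" "S \<subseteq> lattice L" for T S
    using adm that opeqD[of L "adj H" H T S] by (simp add: admissible_term_def adj_def)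
  have "cnj (Be c a) = Be a c" for a c
  proof -
    let ?T = "\<lambda>a. if a then {x, y} else {}"
    have "cnj (H (?T c) (?T a)) = H (?T a) (?T c)" using xy by (intro herm) auto
    then have "?s (?T a) * ?s (?T c) * cnj (Be c a) = ?s (?T a) * ?s (?T c) * Be a c"
      using xy by (cases a; cases c) (auto simp: Hblk sg_def blk_def tq_def)
    then show ?thesis by simp
  qed
  moreover have "cnj (Bo c a) = Bo a c" for a c
  proof -
    let ?T = "\<lambda>a. if a then {x} else {y}"
    have "cnj (H (?T c) (?T a)) = H (?T a) (?T c)" using xy by (intro herm) auto
    then have "?s (?T a) * ?s (?T c) * cnj (Bo c a) = ?s (?T a) * ?s (?T c) * Bo a c"
      using xy by (cases a; cases c) (auto simp: Hblk sg_def blk_def tq_def insert_commute)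
    then show ?thesis by simp
  qed
  moreover have "opeq L H (sg ?s (blk x y Be Bo))" using Hblk by (rule opeqI)
  ultimately show ?thesis by blast
qed

text \<open>Up to the mean \<open>m\<close> of the diagonal the matrix has diagonal
  \<open>d\<close>, \<open>-d\<close> and off-diagonal entry \<open>z\<close>. With the pair of
  \<open>d\<close> and \<open>cmod z\<close> in polar form of angle \<open>t\<close>, the
  eigenvectors are a rotation by \<open>t / 2\<close> twisted by the phase of \<open>z\<close>, and
  the eigenvalues are \<open>m + r\<close> and \<open>m - r\<close>.\<close>

lemma hermitian2_spectral:
  assumes "\<And>a c. cnj (B c a) = B a c"
  shows "\<exists>V l. U2 V \<and> B = dg V (\<lambda>j. complex_of_real (l j))"
proof -
  define m where "m = (Re (B True True) + Re (B False False)) / 2"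
  define d where "d = (Re (B True True) - Re (B False False)) / 2"
  define z where "z = B True False"
  obtain r t where rt: "d = r * cos t" "cmod z = r * sin t" using polar_Ex by blast
  define e where "e = cis (Arg z)"
  have z: "z = complex_of_real (cmod z) * e"
    unfolding e_def using rcis_cmod_Arg[of z] by (simp add: rcis_def)
  have ee: "e * cnj e = 1" unfolding e_def by simp
  define \<eta> where "\<eta> = t / 2"
  define C where "C = complex_of_real (cos \<eta>)"
  define S where "S = complex_of_real (sin \<eta>)"
  have CS: "C * C + S * S = 1"
  proof -
    have "cos \<eta> * cos \<eta> + sin \<eta> * sin \<eta> = 1"
      using sin_cos_squared_add[of \<eta>] by (simp add: power2_eq_square add.commute)
    then have "complex_of_real (cos \<eta> * cos \<eta> + sin \<eta> * sin \<eta>) = 1" by (simp only: of_real_1)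
    then show ?thesis by (simp only: C_def S_def of_real_add of_real_mult)
  qed
  have CS2: "complex_of_real (cos t) = C * C - S * S" "complex_of_real (sin t) = 2 * C * S"
  proof -
    have "cos t = cos \<eta> * cos \<eta> - sin \<eta> * sin \<eta>" "sin t = 2 * cos \<eta> * sin \<eta>"
      using cos_double[of \<eta>] sin_double[of \<eta>] by (simp_all add: \<eta>_def power2_eq_square)
    then show "complex_of_real (cos t) = C * C - S * S" "complex_of_real (sin t) = 2 * C * S"
      by (simp_all add: C_def S_def)
  qed
  have cnjCS: "cnj C = C" "cnj S = S" by (simp_all add: C_def S_def)
  define V where "V = (\<lambda>a j. if a then (if j then e * C else - S * e) else (if j then S else C))"
  have "U2 V"
  proof -
    have s: "e * C * (cnj e * C) + S * S = 1" "S * e * (S * cnj e) + C * C = 1"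
      "e * C * (C * cnj e) + S * e * (S * cnj e) = 1"
    proof -
      have "e * C * (cnj e * C) + S * S = (e * cnj e) * (C * C) + S * S" by (simp only: ac_simps)
      then show "e * C * (cnj e * C) + S * S = 1" using ee CS by simp
      have "S * e * (S * cnj e) + C * C = (e * cnj e) * (S * S) + C * C" by (simp only: ac_simps)
      then show "S * e * (S * cnj e) + C * C = 1" using ee CS by (simp add: add.commute)
      have "e * C * (C * cnj e) + S * e * (S * cnj e) = (e * cnj e) * (C * C + S * S)"
        by (simp add: algebra_simps)
      then show "e * C * (C * cnj e) + S * e * (S * cnj e) = 1" using ee CS by simp
    qed
    have t: "e * C * (S * cnj e) = C * S" "S * e * (C * cnj e) = C * S" 
      using ee by (metis mult.assoc mult.commute mult.right_neutral)+
    show ?thesis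
      unfolding U2_def unitary2_def adj2_def V_def
      using s t CS by (simp add: UNIV_bool all_bool_eq cnjCS algebra_simps)
  qed
  moreover let ?D = "dg V (\<lambda>j. complex_of_real (if j then m + r else m - r))"
  have "B = ?D"
  proof -
    have Btt: "B True True = complex_of_real (m + d)" "B False False = complex_of_real (m - d)"
      using assms[of True True] assms[of False False]
      by (simp_all add: m_def d_def complex_eq_iff field_simps)
    have Bft: "B False True = cnj z" using assms[of True False] by (simp add: z_def)
    have md: "complex_of_real m = complex_of_real m * (C * C + S * S)" using CS by simp
    have dd: "complex_of_real d = complex_of_real r * (C * C - S * S)" by (simp add: rt CS2)
    have zz: "z = complex_of_real r * (2 * C * S) * e" using z by (simp add: rt CS2)
    have 1: "B True True = ?D True True"
    proof -
      have "?D True True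
        = (e * cnj e) * (complex_of_real m * (C * C + S * S) + complex_of_real r * (C * C - S * S))"
        by (simp add: dg_def m2_def adj2_def diag2_def UNIV_bool V_def cnjCS algebra_simps)
      then show ?thesis using md dd by (simp add: Btt ee)
    qed
    have 2: "B False False = ?D False False"
    proof -
      have "?D False False
        = complex_of_real m * (C * C + S * S) - complex_of_real r * (C * C - S * S)"
        by (simp add: dg_def m2_def adj2_def diag2_def UNIV_bool V_def cnjCS algebra_simps)
      then show ?thesis using md dd by (simp add: Btt)
    qed
    have 3: "?D True False = z"
      unfolding zz by (simp add: dg_def m2_def adj2_def diag2_def UNIV_bool V_def cnjCS algebra_simps)
    have 4: "?D False True = cnj z"
      unfolding zz by (simp add: dg_def m2_def adj2_def diag2_def UNIV_bool V_def cnjCS algebra_simps)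
    show ?thesis
    proof (intro ext)
      fix a c show "B a c = ?D a c"
        by (cases a; cases c) (simp_all only: 1 2 3 4 Bft z_def[symmetric])
    qed
  qed
  ultimately show ?thesis by (intro exI[of _ V] exI[of _ "\<lambda>j. if j then m + r else m - r"] conjI)
qed

lemma blk_mmult:
  assumes "x \<noteq> y" "x \<in> lattice L" "y \<in> lattice L"
  shows "opeq L (mmult L (blk x y Be Bo) (blk x y Be' Bo')) (blk x y (m2 Be Be') (m2 Bo Bo'))"
proof -
  let ?M = "\<lambda>Be Bo a b c d. if (a = b) = (c = d) then (if a = b then Be else Bo) a c else 0"
  have eq: "(\<lambda>a b c d. \<Sum>e\<in>UNIV. \<Sum>f\<in>UNIV. ?M Be Bo a b e f * ?M Be' Bo' e f c d) =
      ?M (m2 Be Be') (m2 Bo Bo')"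
  proof (intro ext)
    fix a b c d
    show "(\<Sum>e\<in>UNIV. \<Sum>f\<in>UNIV. ?M Be Bo a b e f * ?M Be' Bo' e f c d) = ?M (m2 Be Be') (m2 Bo Bo') a b c d"
      by (cases a; cases b; cases c; cases d) (simp_all add: m2_def UNIV_bool)
  qed
  show ?thesis using tq_mmult[OF assms, of "?M Be Bo" "?M Be' Bo'"] unfolding eq blk_def .
qed

lemma blk_one: "blk x y (diag2 (\<lambda>_. 1)) (diag2 (\<lambda>_. 1)) = idm"
  unfolding blk_def idm_tq[of x y]
proof (intro arg_cong[where f = "tq x y"] ext)
  fix a b c d
  show "(if (a = b) = (c = d) then (if a = b then diag2 (\<lambda>_. 1) else diag2 (\<lambda>_. 1)) a c else 0)
    = (if a = c \<and> b = d then 1 else (0::complex))"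
    by (cases a; cases b; cases c; cases d) (simp_all add: diag2_def)
qed

lemma mpow_sg_blk:
  assumes xy: "x \<noteq> y" "x \<in> lattice L" "y \<in> lattice L" and "U2 V" "U2 W"
    and A: "opeq L A (sg (rsg R) (blk x y (dg V d) (dg W e)))"
  shows "opeq L (mpow L A k) (sg (rsg R) (blk x y (dg V (\<lambda>j. d j ^ k)) (dg W (\<lambda>j. e j ^ k))))"
proof (induction k)
  case 0
  show ?case using assms(4,5) by (simp add: mpow_def dg_one blk_one sg_idm)
next
  case (Suc k)
  have "opeq L (mpow L A (Suc k)) (mmult L A (mpow L A k))" by (simp add: mpow_def)
  also have "opeq L \<dots> (sg (rsg R) (mmult L (blk x y (dg V d) (dg W e))
      (blk x y (dg V (\<lambda>j. d j ^ k)) (dg W (\<lambda>j. e j ^ k)))))"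
    using opeq_mmult[OF A Suc] by (simp add: sg_mmult)
  also have "opeq L \<dots> (sg (rsg R) (blk x y (dg V (\<lambda>j. d j ^ Suc k)) (dg W (\<lambda>j. e j ^ Suc k))))"
    by (rule opeq_trans[OF opeq_sg[OF blk_mmult[OF xy]]]) (simp add: dg_m2 assms(4,5))
  finally show ?case .
qed

lemma dg_exp_sums: "(\<lambda>k. dg V (\<lambda>j. d j ^ k) a c / of_nat (fact k)) sums dg V (\<lambda>j. exp (d j)) a c"
proof -
  have "(\<lambda>k. w ^ k / of_nat (fact k)) sums exp w" for w :: complex
    using exp_converges[of w] by (simp add: scaleR_conv_of_real field_simps)
  then have "(\<lambda>k. V a True * cnj (V c True) * (d True ^ k / of_nat (fact k))
      + V a False * cnj (V c False) * (d False ^ k / of_nat (fact k))) sums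
    (V a True * cnj (V c True) * exp (d True) + V a False * cnj (V c False) * exp (d False))"
    by (intro sums_add sums_mult)
  then show ?thesis
    by (simp add: dg_def m2_def diag2_def adj2_def UNIV_bool algebra_simps add_divide_distrib)
qed

text \<open>\<open>mexp\<close> is an entrywise series whose value is meaningful only with
  convergence, so the result is stated with \<open>sums\<close>. The powers act on the eigenvalues
  alone.\<close>

lemma mexp_sg_blk_sums:
  assumes "x \<noteq> y" "x \<in> lattice L" "y \<in> lattice L" "U2 V" "U2 W"
    and "opeq L A (sg (rsg R) (blk x y (dg V d) (dg W e)))"
    and TS: "T \<subseteq> lattice L" "S \<subseteq> lattice L"
  shows "(\<lambda>k. mpow L A k T S / of_nat (fact k)) sums
    sg (rsg R) (blk x y (dg V (\<lambda>j. exp (d j))) (dg W (\<lambda>j. exp (e j)))) T S"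
proof -
  let ?F = "\<lambda>f g. blk x y (dg V f) (dg W g) T S"
  have "(\<lambda>k. ?F (\<lambda>j. d j ^ k) (\<lambda>j. e j ^ k) / of_nat (fact k)) sums ?F (\<lambda>j. exp (d j)) (\<lambda>j. exp (e j))"
    using dg_exp_sums[of V d] dg_exp_sums[of W e]
    by (cases "x \<in> T"; cases "y \<in> T"; cases "x \<in> S"; cases "y \<in> S") (simp_all add: blk_def tq_def)
  then have "(\<lambda>k. rsg R T * rsg R S * (?F (\<lambda>j. d j ^ k) (\<lambda>j. e j ^ k) / of_nat (fact k)))
      sums (rsg R T * rsg R S * ?F (\<lambda>j. exp (d j)) (\<lambda>j. exp (e j)))"
    by (rule sums_mult)
  moreover have "mpow L A k T S / of_nat (fact k) = rsg R T * rsg R S * (?F (\<lambda>j. d j ^ k) (\<lambda>j. e j ^ k) / of_nat (fact k))" for k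
    using opeqD[OF mpow_sg_blk[OF assms(1-6)] TS] by (simp add: sg_def)
  ultimately show ?thesis by (simp add: sg_def)
qed

lemma dgl_dg: "U2 V \<Longrightarrow> dgl (dg V (\<lambda>j. cis (\<phi> j)))"
  by (auto simp: dgl_def)

text \<open>The blocks of the exponential have eigenvalues on the unit circle because
  \<open>t\<close> and the eigenvalues of the blocks of \<open>H\<close> are real. Convergence is
  exported as well, for use in \<open>intw_mexp\<close>.\<close>

lemma mexp_admissible:
  fixes t :: real
  assumes xy: "x \<noteq> y" "x \<in> lattice L" "y \<in> lattice L" and adm: "admissible_term L x y H"
  defines "A \<equiv> smult (- \<i> * complex_of_real t) H"
  shows mexp_admissible_G2: "mexp L A \<in> G2 L x y"
    and mexp_admissible_sums: "\<And>T S. T \<subseteq> lattice L \<Longrightarrow> S \<subseteq> lattice L \<Longrightarrow>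
      (\<lambda>k. mpow L A k T S / of_nat (fact k)) sums mexp L A T S"
proof -
  let ?z = "- \<i> * complex_of_real t" and ?s = "rsg (srel L x y)"
  obtain Be Bo where B: "\<And>a c. cnj (Be c a) = Be a c" "\<And>a c. cnj (Bo c a) = Bo a c"
    "opeq L H (sg ?s (blk x y Be Bo))" using admissible_blk[OF assms(1-4)] by blast
  obtain V l where V: "U2 V" "Be = dg V (\<lambda>j. complex_of_real (l j))"
    using hermitian2_spectral[of Be] B(1) by blast
  obtain W n where W: "U2 W" "Bo = dg W (\<lambda>j. complex_of_real (n j))"
    using hermitian2_spectral[of Bo] B(2) by blast
  have dgz: "?z * dg V f a c = dg V (\<lambda>j. ?z * f j) a c" for V f a c
    by (simp add: dg_def m2_def diag2_def adj2_def UNIV_bool algebra_simps)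
  have "smult ?z (blk x y Be Bo) =
      blk x y (dg V (\<lambda>j. ?z * complex_of_real (l j))) (dg W (\<lambda>j. ?z * complex_of_real (n j)))"
    unfolding blk_def smult_tq V(2) W(2) dgz[symmetric]
    by (intro arg_cong[where f = "tq x y"] ext) simp
  then have "opeq L A
    (sg ?s (blk x y (dg V (\<lambda>j. ?z * complex_of_real (l j))) (dg W (\<lambda>j. ?z * complex_of_real (n j)))))"
    using opeq_smult[OF B(3), of ?z] by (simp add: smult_sg A_def)
  note sums = mexp_sg_blk_sums[OF xy V(1) W(1) this]
  have "exp (?z * complex_of_real r) = cis (- t * r)" for r
    by (simp add: cis_conv_exp mult.assoc)
  then have sums: "(\<lambda>k. mpow L A k T S / of_nat (fact k)) sums
      sg ?s (blk x y (dg V (\<lambda>j. cis (- t * l j))) (dg W (\<lambda>j. cis (- t * n j)))) T S"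
    if "T \<subseteq> lattice L" "S \<subseteq> lattice L" for T S
    using sums[OF that] by simp
  have "opeq L (mexp L A) (sg ?s (blk x y (dg V (\<lambda>j. cis (- t * l j))) (dg W (\<lambda>j. cis (- t * n j)))))"
    by (rule opeqI) (use sums in \<open>simp add: mexp_def sums_iff\<close>)
  moreover have "dgl (dg V (\<lambda>j. cis (- t * l j)))" "dgl (dg W (\<lambda>j. cis (- t * n j)))"
    by (rule dgl_dg[OF V(1)], rule dgl_dg[OF W(1)])
  ultimately show "mexp L A \<in> G2 L x y" unfolding G2_def by (intro CollectI exI conjI)
  show "(\<lambda>k. mpow L A k T S / of_nat (fact k)) sums mexp L A T S"
    if "T \<subseteq> lattice L" "S \<subseteq> lattice L" for T S
    using sums[OF that] by (simp add: mexp_def sums_iff)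
qed

text \<open>Exchanging the roles of the ends fixes the even block and negates both indices of the
  odd one, where the two bits are opposite.\<close>

lemma G2_commute: "G2 L x y = G2 L y x"
proof -
  have "G2 L y x \<subseteq> G2 L x y" for x y
  proof
    fix A assume "A \<in> G2 L y x"
    then obtain Be Bo where B: "dgl Be" "dgl Bo" "opeq L A (sg (rsg (srel L x y)) (blk y x Be Bo))"
      unfolding G2_def srel_commute[of L y x] by blast
    obtain V \<phi> where V: "U2 V" "Bo = dg V (\<lambda>j. cis (\<phi> j))" using B(2) by (auto simp: dgl_def)
    let ?Bo = "\<lambda>a c. Bo (\<not> a) (\<not> c)" and ?V = "\<lambda>a j. V (\<not> a) j"
    have "?Bo = dg ?V (\<lambda>j. cis (\<phi> j))"
      unfolding V(2) by (intro ext) (simp add: dg_def m2_def adj2_def diag2_def UNIV_bool)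
    moreover have "U2 ?V" using V(1)
      unfolding U2_def unitary2_def adj2_def by (simp add: UNIV_bool all_bool_eq add.commute)
    ultimately have "dgl ?Bo" using dgl_dg[of ?V \<phi>] by simp
    moreover have "blk y x Be Bo = blk x y Be ?Bo"
      unfolding blk_def tq_commute[of y x] by (intro arg_cong[where f = "tq x y"] ext) auto
    ultimately show "A \<in> G2 L x y" unfolding G2_def using B(1,3) by auto
  qed
  then show ?thesis by blast
qed

section \<open>Fermionic permutations\<close>

definition swp :: "site \<Rightarrow> site \<Rightarrow> site \<Rightarrow> site" where
  "swp x y z = (if z = x then y else if z = y then x else z)"

lemma swp_swp [simp]: "swp x y (swp x y z) = z"
  by (simp add: swp_def)

lemma inj_swp: "inj (swp x y)"
  by (metis injI swp_swp)

definition fswap_even :: mat2 where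
  "fswap_even = diag2 (\<lambda>a. if a then -1 else 1)"

definition fswap_odd :: mat2 where
  "fswap_odd a b = (if a \<noteq> b then 1 else 0)"

text \<open>With \<open>x\<close>, \<open>y\<close> in front this exchanges their occupations, with
  the sign -1 that two fermions acquire when both modes are occupied.\<close>

definition fswap :: "nat \<Rightarrow> site \<times> site \<Rightarrow> op" where
  "fswap L = (\<lambda>(x, y). sg (rsg (srel L x y)) (blk x y fswap_even fswap_odd))"

lemma dgl_fswap_even: "dgl fswap_even"
proof -
  have eq: "fswap_even = dg (diag2 (\<lambda>_. 1)) (\<lambda>j. cis (if j then pi else 0))"
    by (intro ext) (simp add: fswap_even_def dg_def m2_def adj2_def diag2_def UNIV_bool)
  have "U2 (diag2 (\<lambda>_. 1))" by (rule U2_diag2) simp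
  then show ?thesis unfolding eq by (rule dgl_dg)
qed

text \<open>The exchange of the two odd states is diagonalised by the Hadamard matrix, with
  eigenvalues 1 and -1.\<close>

lemma dgl_fswap_odd: "dgl fswap_odd"
proof -
  define h where "h = complex_of_real (1 / sqrt 2)"
  have h: "h * h = 1 / 2" "cnj h = h"
    by (simp_all add: h_def flip: of_real_mult)
  define V where "V = (\<lambda>a b. if a \<and> b then - h else h)"
  have V: "U2 V"
    unfolding U2_def unitary2_def adj2_def V_def by (simp add: UNIV_bool all_bool_eq h)
  have eq: "fswap_odd = dg V (\<lambda>j. cis (if j then pi else 0))"
    by (intro ext) (auto simp: fswap_odd_def dg_def m2_def adj2_def diag2_def UNIV_bool V_def h)
  show ?thesis unfolding eq by (rule dgl_dg[OF V])
qed

lemma fswap_G2: "fswap L (x, y) \<in> G2 L x y"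
  unfolding G2_def fswap_def using dgl_fswap_even dgl_fswap_odd by auto

lemma adj_fswap: "adj (fswap L b) = fswap L b"
proof -
  obtain x y where b: "b = (x, y)" by (cases b)
  have "adj (blk x y fswap_even fswap_odd) = blk x y fswap_even fswap_odd"
    unfolding blk_def adj_tq
    by (intro arg_cong[where f = "tq x y"] ext) (auto simp: fswap_even_def fswap_odd_def diag2_def)
  then show ?thesis by (simp add: b fswap_def adj_sg_rsg)
qed

lemma fswap_mmult_fswap:
  assumes "x \<noteq> y" "x \<in> lattice L" "y \<in> lattice L"
  shows "opeq L (mmult L (fswap L (x, y)) (fswap L (x, y))) idm"
proof -
  have "m2 fswap_even fswap_even = diag2 (\<lambda>_. 1)" "m2 fswap_odd fswap_odd = diag2 (\<lambda>_. 1)"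
    by (auto simp: fun_eq_iff m2_def fswap_even_def fswap_odd_def diag2_def UNIV_bool)
  then have "opeq L (mmult L (fswap L (x, y)) (fswap L (x, y)))
      (sg (rsg (srel L x y)) (blk x y (diag2 (\<lambda>_. 1)) (diag2 (\<lambda>_. 1))))"
    using opeq_sg[OF blk_mmult[OF assms, of fswap_even fswap_odd fswap_even fswap_odd]]
    by (simp add: fswap_def sg_mmult)
  then show ?thesis by (simp add: blk_one sg_idm)
qed

definition swp_cfg :: "site \<Rightarrow> site \<Rightarrow> cfg \<Rightarrow> cfg" where
  "swp_cfg x y S = {z. swp x y z \<in> S}"

lemma swp_cfg_image: "swp_cfg x y S = swp x y ` S"
  unfolding swp_cfg_def by (rule set_eqI) (metis (no_types) image_iff mem_Collect_eq swp_swp)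

lemma swp_cfg_swp_cfg [simp]: "swp_cfg x y (swp_cfg x y S) = S"
  by (simp add: swp_cfg_def)

lemma swp_in_lattice: "x \<in> lattice L \<Longrightarrow> y \<in> lattice L \<Longrightarrow> z \<in> lattice L \<Longrightarrow> swp x y z \<in> lattice L"
  by (simp add: swp_def)

lemma swp_cfg_subset:
  "x \<in> lattice L \<Longrightarrow> y \<in> lattice L \<Longrightarrow> S \<subseteq> lattice L \<Longrightarrow> swp_cfg x y S \<subseteq> lattice L"
  unfolding swp_cfg_image using swp_in_lattice by blast

lemma fswap_blk_entry:
  assumes "x \<noteq> y"
  shows "blk x y fswap_even fswap_odd T S = (if T = swp_cfg x y S then if x \<in> S \<and> y \<in> S then -1 else 1 else 0)"
proof -
  have 1: "z \<in> swp_cfg x y S \<longleftrightarrow> (if z = x then y \<in> S else if z = y then x \<in> S else z \<in> S)" for z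
    by (simp add: swp_cfg_def swp_def)
  have "T = swp_cfg x y S \<longleftrightarrow> T - {x, y} = S - {x, y} \<and> (x \<in> T \<longleftrightarrow> y \<in> S) \<and> (y \<in> T \<longleftrightarrow> x \<in> S)"
  proof (intro iffI)
    assume "T = swp_cfg x y S"
    then show "T - {x, y} = S - {x, y} \<and> (x \<in> T \<longleftrightarrow> y \<in> S) \<and> (y \<in> T \<longleftrightarrow> x \<in> S)"
      using 1 assms by auto
  next
    assume r: "T - {x, y} = S - {x, y} \<and> (x \<in> T \<longleftrightarrow> y \<in> S) \<and> (y \<in> T \<longleftrightarrow> x \<in> S)"
    show "T = swp_cfg x y S"
    proof (rule set_eqI)
      fix z
      have "z \<notin> {x, y} \<Longrightarrow> z \<in> T \<longleftrightarrow> z \<in> S" using r by blast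
      then show "z \<in> T \<longleftrightarrow> z \<in> swp_cfg x y S" unfolding 1 using r assms by simp
    qed
  qed
  then show ?thesis
    by (cases "x \<in> T"; cases "y \<in> T"; cases "x \<in> S"; cases "y \<in> S")
      (simp_all add: blk_def tq_def fswap_even_def fswap_odd_def diag2_def)
qed

text \<open>This is checked in the ordering with \<open>x\<close>, \<open>y\<close> in front. A mode
  off the bond has both ends in its string, so exchanging them changes nothing. For an end, the
  string reverses its view of the partner, and the sign of the doubly occupied state makes up for
  it.\<close>

lemma fswap_ann:
  assumes xy: "x \<noteq> y" "x \<in> lattice L" "y \<in> lattice L" and z: "z \<in> lattice L"
  shows "opeq L (mmult L (fswap L (x, y)) (ann L z)) (mmult L (ann L (swp x y z)) (fswap L (x, y)))"
proof -
  let ?s = "rsg (srel L x y)" and ?F = "blk x y fswap_even fswap_odd" and ?A = "ann_front L x y"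
  let ?\<phi> = "\<lambda>S. if x \<in> S \<and> y \<in> S then -1 else (1::complex)"
  note swl = swp_in_lattice[OF xy(2,3) z] and swc = swp_cfg_subset[OF xy(2,3)]
  have "opeq L (mmult L ?F (?A z)) (mmult L (?A (swp x y z)) ?F)"
  proof (rule opeqI)
    fix T S assume TS: "T \<subseteq> lattice L" "S \<subseteq> lattice L"
    let ?T = "swp_cfg x y T" and ?S = "swp_cfg x y S"
    have fin: "finite T" by (rule finite_subset[OF TS(1)]) simp
    have "mmult L ?F (?A z) T S = (\<Sum>U\<in>Pow (lattice L). if U = ?T then ?\<phi> U * ?A z U S else 0)"
      unfolding mmult_def fswap_blk_entry[OF xy(1)]
      by (rule sum.cong) (auto simp del: swp_cfg_swp_cfg, simp_all)
    also have "\<dots> = ?\<phi> ?T * ?A z ?T S" using swc[OF TS(1)] by simp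
    finally have l: "mmult L ?F (?A z) T S = ?\<phi> ?T * ?A z ?T S" .
    have "mmult L (?A (swp x y z)) ?F T S = (\<Sum>U\<in>Pow (lattice L). if U = ?S then ?A (swp x y z) T U * ?\<phi> S else 0)"
      unfolding mmult_def fswap_blk_entry[OF xy(1)] by (rule sum.cong) auto
    also have "\<dots> = ?A (swp x y z) T ?S * ?\<phi> S" using swc[OF TS(2)] by simp
    finally have r: "mmult L (?A (swp x y z)) ?F T S = ?A (swp x y z) T ?S * ?\<phi> S" .
    have in_sw: "u \<in> swp_cfg x y W \<longleftrightarrow> swp x y u \<in> W" for u W by (simp add: swp_cfg_def)
    have cond: "z \<in> S \<and> ?T = S - {z} \<longleftrightarrow> swp x y z \<in> ?S \<and> T = ?S - {swp x y z}"
    proof -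
      have "?T = S - {z} \<longleftrightarrow> T = swp_cfg x y (S - {z})" by (metis swp_cfg_swp_cfg)
      also have "swp_cfg x y (S - {z}) = ?S - {swp x y z}"
        by (rule set_eqI) (simp add: in_sw, metis swp_swp)
      finally show ?thesis by (simp add: in_sw)
    qed
    have "?\<phi> ?T * ?A z ?T S = ?A (swp x y z) T ?S * ?\<phi> S"
    proof (cases "z \<in> S \<and> ?T = S - {z}")
      case True
      then have T: "swp x y z \<in> ?S" "T = ?S - {swp x y z}" using cond by auto
      have "(\<Prod>w\<in>?T. if front_sees L x y z w then -1 else (1::complex))
        = (\<Prod>w\<in>T. if front_sees L x y z (swp x y w) then -1 else 1)"
        unfolding swp_cfg_image by (rule prod.reindex_cong[OF inj_on_subset[OF inj_swp] refl]) auto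
      also have "?\<phi> ?T * \<dots> = (\<Prod>w\<in>T. if front_sees L x y (swp x y z) w then -1 else 1) * ?\<phi> S"
      proof (cases "z \<in> {x, y}")
        case False
        have "front_sees L x y z (swp x y w) \<longleftrightarrow> front_sees L x y (swp x y z) w" for w
          using False by (auto simp: front_sees_def swp_def)
        moreover have "?\<phi> ?T = ?\<phi> S" using True False by auto
        ultimately show ?thesis by simp
      next
        case z: True
        \<comment> \<open>\<open>z'\<close> is the partner of \<open>z\<close>. Exactly one of the
          two precedes the other, so the strings on both sides differ by -1 precisely if the partner
          is occupied in \<open>S\<close>.\<close>
        define z' where "z' = swp x y z"
        have zz: "{x, y} = {z, z'}" "z \<noteq> z'" using z xy(1) by (auto simp: z'_def swp_def)
        have sw: "swp x y w = (if w = z then z' else if w = z' then z else w)" for w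
          using z by (auto simp: z'_def swp_def)
        have 1: "front_sees L x y z (swp x y w) \<longleftrightarrow> w = z \<and> ref_idx L z' < ref_idx L z" for w
          unfolding front_sees_def zz(1) sw using zz(2) by auto
        have 2: "front_sees L x y (swp x y z) w \<longleftrightarrow> w = z \<and> ref_idx L z < ref_idx L z'" for w
          unfolding front_sees_def zz(1) z'_def[symmetric] using zz(2) by auto
        have "z \<notin> ?T" using True by auto
        then have \<phi>T: "?\<phi> ?T = 1" using z by auto
        have "z \<in> T \<longleftrightarrow> z' \<in> S" unfolding T(2) using zz(2) by (simp add: in_sw sw)
        then have \<phi>S: "?\<phi> S = (if z \<in> T then -1 else 1)" using True zz(1) by (metis insert_iff singletonD)
        have "ref_idx L z \<noteq> ref_idx L z'"
          using zz xy(2,3) swl assms(4) ref_idx_eq_iff[of z L z'] by (simp add: z'_def)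
        then show ?thesis unfolding 1 2 sign_prod_single[OF fin] \<phi>T \<phi>S by auto
      qed
      finally show ?thesis using True T by (simp add: ann_front_def)
    next
      case False
      then have "?A z ?T S = 0" "?A (swp x y z) T ?S = 0"
        using cond by (auto simp: ann_front_def)
      then show ?thesis by simp
    qed
    then show "mmult L ?F (?A z) T S = mmult L (?A (swp x y z)) ?F T S" using l r by simp
  qed
  note main = opeq_sg[OF this, of ?s]
  have "opeq L (mmult L (fswap L (x, y)) (ann L z)) (mmult L (fswap L (x, y)) (sg ?s (?A z)))"
    by (rule opeq_mmult_r[OF ann_sg[OF xy(2,3) z]])
  also have "opeq L \<dots> (sg ?s (mmult L ?F (?A z)))" by (simp add: fswap_def sg_mmult)
  also have "opeq L \<dots> (sg ?s (mmult L (?A (swp x y z)) ?F))" by (rule main)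
  also have "opeq L \<dots> (mmult L (sg ?s (?A (swp x y z))) (fswap L (x, y)))" by (simp add: fswap_def sg_mmult)
  also have "opeq L \<dots> (mmult L (ann L (swp x y z)) (fswap L (x, y)))"
    by (rule opeq_mmult_l[OF opeq_sym[OF ann_sg[OF xy(2,3) swl]]])
  finally show ?thesis .
qed

section \<open>Mode permutations and intertwining operators\<close>

definition fperm :: "nat \<Rightarrow> (site \<Rightarrow> site) \<Rightarrow> op \<Rightarrow> bool" where
  "fperm L \<pi> F \<longleftrightarrow> unitary_op L F \<and>
    (\<forall>z\<in>lattice L. \<pi> z \<in> lattice L \<and> opeq L (mmult L F (ann L z)) (mmult L (ann L (\<pi> z)) F))"

lemma unitary_idm: "unitary_op L idm"
  by (simp add: unitary_op_def)

lemma unitary_mmult: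
  assumes "unitary_op L F" "unitary_op L G"
  shows "unitary_op L (mmult L G F)"
  using assms mmult_inverse_pair[of L "adj F" F "adj G" G] mmult_inverse_pair[of L G "adj G" F "adj F"]
  by (simp add: unitary_op_def adj_mmult)

lemma unitary_cong:
  assumes "unitary_op L F" "opeq L F G" shows "unitary_op L G"
proof -
  note GF = opeq_sym[OF assms(2)]
  have "opeq L (mmult L G (adj G)) (mmult L F (adj F))" "opeq L (mmult L (adj G) G) (mmult L (adj F) F)"
    by (intro opeq_mmult opeq_adj GF)+
  then show ?thesis using assms(1) unfolding unitary_op_def by (meson opeq_trans)
qed

text \<open>For unitary \<open>F\<close> this says that \<open>B\<close> is the conjugate of
  \<open>A\<close> by \<open>F\<close>. The product form passes directly through sums, products and
  convergent series.\<close>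

definition intw :: "nat \<Rightarrow> op \<Rightarrow> op \<Rightarrow> op \<Rightarrow> bool" where
  "intw L F A B \<longleftrightarrow> opeq L (mmult L F A) (mmult L B F)"

lemma intw_mmult: "intw L F A B \<Longrightarrow> intw L F A' B' \<Longrightarrow> intw L F (mmult L A A') (mmult L B B')"
  unfolding intw_def
proof -
  assume 1: "opeq L (mmult L F A) (mmult L B F)" and 2: "opeq L (mmult L F A') (mmult L B' F)"
  have "opeq L (mmult L F (mmult L A A')) (mmult L B (mmult L F A'))"
    using opeq_mmult_l[OF 1, of A'] by (simp add: mmult_assoc)
  also have "opeq L \<dots> (mmult L (mmult L B B') F)"
    using opeq_mmult_r[OF 2, of B] by (simp add: mmult_assoc)
  finally show "opeq L (mmult L F (mmult L A A')) (mmult L (mmult L B B') F)" .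
qed

lemma intw_madd: "intw L F A B \<Longrightarrow> intw L F A' B' \<Longrightarrow> intw L F (madd A A') (madd B B')"
  unfolding intw_def mmult_madd_left mmult_madd_right by (rule opeq_madd)

lemma intw_smult: "intw L F A B \<Longrightarrow> intw L F (smult c A) (smult c B)"
  unfolding intw_def mmult_smult_left mmult_smult_right by (rule opeq_smult)

lemma intw_idm: "intw L F idm idm"
  unfolding intw_def by (rule opeq_trans[OF mmult_idm_right opeq_sym[OF mmult_idm_left]])

lemma intw_conj:
  assumes "unitary_op L F" "intw L F A B"
  shows "opeq L B (mmult L F (mmult L A (adj F)))"
proof -
  have "opeq L (mmult L (mmult L F A) (adj F)) (mmult L (mmult L B F) (adj F))"
    by (rule opeq_mmult_l) (use assms(2) in \<open>simp add: intw_def\<close>)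
  moreover have "opeq L (mmult L (mmult L B F) (adj F)) (mmult L B idm)"
    unfolding mmult_assoc by (rule opeq_mmult_r) (use assms(1) in \<open>simp add: unitary_op_def\<close>)
  ultimately have "opeq L (mmult L (mmult L F A) (adj F)) B"
    using mmult_idm_right opeq_trans by blast
  then show ?thesis by (simp add: mmult_assoc opeq_sym)
qed

lemma conj_intw:
  assumes "unitary_op L F" "opeq L B (mmult L F (mmult L A (adj F)))"
  shows "intw L F A B"
proof -
  have "opeq L (mmult L B F) (mmult L (mmult L F (mmult L A (adj F))) F)"
    by (rule opeq_mmult_l[OF assms(2)])
  also have "opeq L \<dots> (mmult L F (mmult L A idm))"
    unfolding mmult_assoc by (intro opeq_mmult_r) (use assms(1) in \<open>simp add: unitary_op_def\<close>)
  also have "opeq L \<dots> (mmult L F A)" by (intro opeq_mmult_r mmult_idm_right)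
  finally show ?thesis unfolding intw_def by (rule opeq_sym)
qed

lemma intw_adj:
  assumes "unitary_op L F" "intw L F A B" shows "intw L F (adj A) (adj B)"
proof (rule conj_intw[OF assms(1)])
  show "opeq L (adj B) (mmult L F (mmult L (adj A) (adj F)))"
    using opeq_adj[OF intw_conj[OF assms]] by (simp add: adj_mmult mmult_assoc)
qed

lemma intw_unique:
  assumes "unitary_op L F" "intw L F A B" "intw L F A' B'" "opeq L A A'"
  shows "opeq L B B'"
proof -
  note intw_conj[OF assms(1,2)]
  also have "opeq L (mmult L F (mmult L A (adj F))) (mmult L F (mmult L A' (adj F)))"
    by (intro opeq_mmult_r opeq_mmult_l assms(4))
  also have "opeq L \<dots> B'" by (rule opeq_sym[OF intw_conj[OF assms(1,3)]])
  finally show ?thesis .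
qed

lemma fperm_intw:
  assumes "fperm L \<pi> F" "z \<in> lattice L"
  shows "intw L F (ann L z) (ann L (\<pi> z))" "intw L F (cre L z) (cre L (\<pi> z))"
    "intw L F (num L z) (num L (\<pi> z))"
proof -
  have u: "unitary_op L F" using assms(1) by (simp add: fperm_def)
  show a: "intw L F (ann L z) (ann L (\<pi> z))" using assms by (simp add: fperm_def intw_def)
  show c: "intw L F (cre L z) (cre L (\<pi> z))" unfolding cre_def by (rule intw_adj[OF u a])
  show "intw L F (num L z) (num L (\<pi> z))" unfolding num_def by (rule intw_mmult[OF c a])
qed

lemma fperm_alg2:
  assumes F: "fperm L \<pi> F" and xy: "x \<in> lattice L" "y \<in> lattice L" and A: "A \<in> alg2 L x y"
  shows "\<exists>B. B \<in> alg2 L (\<pi> x) (\<pi> y) \<and> intw L F A B"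
  using A
proof induction
  case a_id then show ?case using intw_idm alg2.a_id by blast
next
  case a_cx then show ?case using fperm_intw(1)[OF F xy(1)] alg2.a_cx by blast
next
  case a_cy then show ?case using fperm_intw(1)[OF F xy(2)] alg2.a_cy by blast
next
  case a_cdx then show ?case using fperm_intw(2)[OF F xy(1)] alg2.a_cdx by blast
next
  case a_cdy then show ?case using fperm_intw(2)[OF F xy(2)] alg2.a_cdy by blast
next
  case (a_add A B) then show ?case using intw_madd alg2.a_add by meson
next
  case (a_smult A c) then show ?case using intw_smult alg2.a_smult by meson
next
  case (a_mult A B) then show ?case using intw_mmult alg2.a_mult by meson
qed

text \<open>Conjugation carries generators to generators and hence the local algebra to the local
  algebra. Hermiticity and the parity relation are equations between conjugated operators, so
  \<open>intw_unique\<close> transports them.\<close>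

lemma fperm_admissible:
  assumes F: "fperm L \<pi> F" and xy: "x \<in> lattice L" "y \<in> lattice L" and H: "admissible_term L x y H"
  shows "\<exists>H'. admissible_term L (\<pi> x) (\<pi> y) H' \<and> intw L F H H'"
proof -
  have u: "unitary_op L F" using F by (simp add: fperm_def)
  obtain H' where H': "H' \<in> alg2 L (\<pi> x) (\<pi> y)" "intw L F H H'"
    using fperm_alg2[OF F xy] H unfolding admissible_term_def by blast
  have "opeq L (adj H') H'"
    by (rule intw_unique[OF u intw_adj[OF u H'(2)] H'(2)]) (use H in \<open>simp add: admissible_term_def\<close>)
  moreover have P: "intw L F (parity2 L x y) (parity2 L (\<pi> x) (\<pi> y))"
    unfolding parity2_def
    by (intro intw_mmult intw_madd intw_idm intw_smult fperm_intw(3)[OF F] xy)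
  have "opeq L (mmult L H' (parity2 L (\<pi> x) (\<pi> y))) (mmult L (parity2 L (\<pi> x) (\<pi> y)) H')"
    by (rule intw_unique[OF u intw_mmult[OF H'(2) P] intw_mmult[OF P H'(2)]])
      (use H in \<open>simp add: admissible_term_def\<close>)
  ultimately show ?thesis using H' unfolding admissible_term_def by blast
qed

lemma intw_mpow: "intw L F A B \<Longrightarrow> intw L F (mpow L A k) (mpow L B k)"
  by (induction k) (simp_all add: mpow_def intw_idm intw_mmult)

text \<open>The finite sum in a matrix product passes through the two convergent series, whose terms
  agree by \<open>intw_mpow\<close>.\<close>

lemma intw_mexp:
  assumes AB: "intw L F A B"
    and A: "\<And>T S. T \<subseteq> lattice L \<Longrightarrow> S \<subseteq> lattice L \<Longrightarrow> (\<lambda>k. mpow L A k T S / of_nat (fact k)) sums mexp L A T S"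
    and B: "\<And>T S. T \<subseteq> lattice L \<Longrightarrow> S \<subseteq> lattice L \<Longrightarrow> (\<lambda>k. mpow L B k T S / of_nat (fact k)) sums mexp L B T S"
  shows "intw L F (mexp L A) (mexp L B)"
  unfolding intw_def
proof (rule opeqI)
  fix T S assume TS: "T \<subseteq> lattice L" "S \<subseteq> lattice L"
  have "(\<lambda>k. \<Sum>U\<in>Pow (lattice L). F T U * (mpow L A k U S / of_nat (fact k))) sums mmult L F (mexp L A) T S"
    unfolding mmult_def by (intro sums_sum sums_mult A) (use TS in auto)
  moreover have "(\<lambda>k. \<Sum>U\<in>Pow (lattice L). mpow L B k T U / of_nat (fact k) * F U S) sums mmult L (mexp L B) F T S"
    unfolding mmult_def by (intro sums_sum sums_mult2 B) (use TS in auto)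
  moreover have "(\<Sum>U\<in>Pow (lattice L). F T U * (mpow L A k U S / of_nat (fact k)))
      = (\<Sum>U\<in>Pow (lattice L). mpow L B k T U / of_nat (fact k) * F U S)" for k
    using opeqD[OF intw_mpow[OF AB, of k, unfolded intw_def] TS]
    by (simp add: mmult_def flip: sum_divide_distrib)
  ultimately show "mmult L F (mexp L A) T S = mmult L (mexp L B) F T S"
    using sums_unique2 by simp
qed

text \<open>Indexed by the unordered pair and closed under \<open>opeq\<close>, so that conjugates
  by mode permutations are again of this kind (\<open>fperm_Agates\<close>).\<close>

definition Agates :: "nat \<Rightarrow> site set \<Rightarrow> op set" where
  "Agates L p = {U. \<exists>x y H t. p = {x, y} \<and> x \<noteq> y \<and> x \<in> lattice L \<and> y \<in> lattice L \<and>
     admissible_term L x y H \<and> opeq L U (mexp L (smult (- \<i> * complex_of_real t) H))}"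

lemma AgatesI:
  assumes "x \<noteq> y" "x \<in> lattice L" "y \<in> lattice L" "admissible_term L x y H"
    "opeq L U (mexp L (smult (- \<i> * complex_of_real t) H))"
  shows "U \<in> Agates L {x, y}"
  unfolding Agates_def by (intro CollectI exI conjI) (rule refl assms)+

lemma Agates_G2:
  assumes "U \<in> Agates L {x, y}" shows "U \<in> G2 L x y"
proof -
  obtain x' y' H t where *: "{x, y} = {x', y'}" "x' \<noteq> y'" "x' \<in> lattice L" "y' \<in> lattice L"
    "admissible_term L x' y' H" "opeq L U (mexp L (smult (- \<i> * complex_of_real t) H))"
    using assms unfolding Agates_def by blast
  have "mexp L (smult (- \<i> * complex_of_real t) H) \<in> G2 L x' y'" by (rule mexp_admissible_G2[OF *(2-5)])
  then have "U \<in> G2 L x' y'" unfolding G2_def using opeq_trans[OF *(6)] by blast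
  moreover have "x = x' \<and> y = y' \<or> x = y' \<and> y = x'" using *(1) by (simp only: doubleton_eq_iff)
  ultimately show ?thesis using G2_commute[of L x y] by auto
qed

lemma fperm_Agates:
  assumes F: "fperm L \<pi> F" and inj: "inj_on \<pi> (lattice L)" and U: "U \<in> Agates L p"
  shows "mmult L F (mmult L U (adj F)) \<in> Agates L (\<pi> ` p)"
proof -
  obtain x y H t where *: "p = {x, y}" "x \<noteq> y" "x \<in> lattice L" "y \<in> lattice L"
    "admissible_term L x y H" "opeq L U (mexp L (smult (- \<i> * complex_of_real t) H))"
    using U unfolding Agates_def by blast
  let ?z = "- \<i> * complex_of_real t"
  have u: "unitary_op L F" using F by (simp add: fperm_def)
  have \<pi>: "\<pi> x \<in> lattice L" "\<pi> y \<in> lattice L" "\<pi> x \<noteq> \<pi> y"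
    using F * inj by (auto simp: fperm_def inj_on_def)
  obtain H' where H': "admissible_term L (\<pi> x) (\<pi> y) H'" "intw L F H H'"
    using fperm_admissible[OF F *(3-5)] by blast
  have "intw L F (mexp L (smult ?z H)) (mexp L (smult ?z H'))"
    by (intro intw_mexp intw_smult H' mexp_admissible_sums[OF *(2-5)]
        mexp_admissible_sums[OF \<pi>(3,1,2) H'(1)])
  from intw_conj[OF u this]
  have "opeq L (mexp L (smult ?z H')) (mmult L F (mmult L (mexp L (smult ?z H)) (adj F)))" .
  also have "opeq L \<dots> (mmult L F (mmult L U (adj F)))"
    by (intro opeq_mmult_r opeq_mmult_l opeq_sym[OF *(6)])
  finally have "opeq L (mmult L F (mmult L U (adj F))) (mexp L (smult ?z H'))" by (rule opeq_sym)
  from AgatesI[OF \<pi>(3,1,2) H'(1) this] show ?thesis by (simp add: *(1))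
qed

section \<open>Cost of families of exponentials\<close>

definition cheap :: "nat \<Rightarrow> nat \<Rightarrow> op \<Rightarrow> bool" where
  "cheap L K U \<longleftrightarrow> impl L (lattice L) (K * L) (K * L ^ 3) U"

lemma cheap_mono: "cheap L K U \<Longrightarrow> K \<le> K' \<Longrightarrow> cheap L K' U"
  unfolding cheap_def by (erule impl_mono) auto

lemma cheap_seq: "cheap L K U \<Longrightarrow> cheap L K' U' \<Longrightarrow> cheap L (K + K') (mmult L U' U)"
  unfolding cheap_def add_mult_distrib by (rule impl_seq)

lemma cheap_cong: "cheap L K U \<Longrightarrow> opeq L U U' \<Longrightarrow> cheap L K U'"
  unfolding cheap_def by (rule impl_cong)

text \<open>The pairs may come in any order and any of them may be absent, a property that routing
  preserves.\<close>

definition good :: "nat \<Rightarrow> nat \<Rightarrow> site set set \<Rightarrow> bool" where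
  "good L K Fam \<longleftrightarrow> (\<forall>ps U. distinct ps \<longrightarrow> set ps \<subseteq> Fam \<longrightarrow> (\<forall>p\<in>set ps. U p \<in> Agates L p) \<longrightarrow>
     cheap L K (oprod L (map U ps)))"

lemma good_bonds:
  assumes B: "bond_class L K B" and Fam: "\<And>p. p \<in> Fam \<Longrightarrow> \<exists>x y. (x, y) \<in> B \<and> p = {x, y}"
  shows "good L K Fam"
  unfolding good_def
proof (intro allI impI)
  fix ps :: "site set list" and U assume ps: "distinct ps" "set ps \<subseteq> Fam" "\<forall>p\<in>set ps. U p \<in> Agates L p"
  \<comment> \<open>Pairs are unordered but bonds are oriented, so an orientation is chosen for each
    pair.\<close>
  have "\<forall>p\<in>Fam. \<exists>b. b \<in> B \<and> p = {fst b, snd b}" using Fam by fastforce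
  from bchoice[OF this] obtain f where f: "\<And>p. p \<in> Fam \<Longrightarrow> f p \<in> B" "\<And>p. p \<in> Fam \<Longrightarrow> p = {fst (f p), snd (f p)}"
    by blast
  let ?U = "\<lambda>b. U {fst b, snd b}"
  have "impl L (lattice L) (K * L) (K * L ^ 3) (oprod L (map ?U (map f ps)))"
  proof (rule B[unfolded bond_class_def, rule_format], intro conjI ballI)
    have "inj_on f (set ps)" by (rule inj_onI) (metis f(2) ps(2) subsetD)
    then show "distinct (map f ps)" using ps(1) by (simp add: distinct_map)
    show "set (map f ps) \<subseteq> B" using f(1) ps(2) by auto
    fix b assume "b \<in> set (map f ps)"
    then obtain p where p: "p \<in> set ps" "b = f p" by auto
    then have "U {fst b, snd b} \<in> Agates L {fst b, snd b}" using f(2)[of p] ps by auto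
    then show "U {fst b, snd b} \<in> G2 L (fst b) (snd b)" by (rule Agates_G2)
  qed
  moreover have eq: "map ?U (map f ps) = map U ps" using f(2) ps(2) by auto
  ultimately show "cheap L K (oprod L (map U ps))" unfolding eq cheap_def by blast
qed

text \<open>A product of conjugates telescopes, so routing a whole family there and back costs one
  \<open>F\<close> and one adjoint in total, not one per pair.\<close>

lemma good_route:
  assumes F: "fperm L \<pi> F" and inj: "inj_on \<pi> (lattice L)"
    and cheap: "cheap L K' F" "cheap L K' (adj F)" and good: "good L K Fam'"
    and Fam: "\<And>p. p \<in> Fam \<Longrightarrow> p \<subseteq> lattice L \<and> \<pi> ` p \<in> Fam'"
  shows "good L (K + 2 * K') Fam"
  unfolding good_def
proof (intro allI impI)
  fix ps :: "site set list" and U assume ps: "distinct ps" "set ps \<subseteq> Fam" "\<forall>p\<in>set ps. U p \<in> Agates L p"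
  have FF: "opeq L (mmult L F (adj F)) idm" "opeq L (mmult L (adj F) F) idm"
    using F by (auto simp: fperm_def unitary_op_def)
  let ?C = "\<lambda>p. mmult L F (mmult L (U p) (adj F))"
  have sub: "set ps \<subseteq> Pow (lattice L)" using ps(2) Fam by blast
  have inj': "inj_on ((`) \<pi>) (set ps)" by (rule inj_on_subset[OF inj_on_image_Pow[OF inj] sub])
  \<comment> \<open>The conjugated gates must be indexed by the moved pairs, so the original pair is
    recovered by inverting \<open>\<pi>\<close> on sets.\<close>
  define U' where "U' = (\<lambda>q. ?C (inv_into (set ps) ((`) \<pi>) q))"
  have U': "U' (\<pi> ` p) = ?C p" if "p \<in> set ps" for p
    using that inj' by (simp add: U'_def)
  have eq: "map U' (map ((`) \<pi>) ps) = map ?C ps" using U' by simp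
  have "cheap L K (oprod L (map U' (map ((`) \<pi>) ps)))"
  proof (rule good[unfolded good_def, rule_format])
    show "distinct (map ((`) \<pi>) ps)" using ps(1) inj' by (simp add: distinct_map)
    show "set (map ((`) \<pi>) ps) \<subseteq> Fam'" using ps(2) Fam by auto
    fix q assume "q \<in> set (map ((`) \<pi>) ps)"
    then obtain p where p: "p \<in> set ps" "q = \<pi> ` p" by auto
    show "U' q \<in> Agates L q" unfolding p(2) U'[OF p(1)]
      by (rule fperm_Agates[OF F inj]) (use ps(3) p(1) in blast)
  qed
  then have C: "cheap L K (mmult L F (mmult L (oprod L (map U ps)) (adj F)))"
    unfolding eq by (rule cheap_cong) (rule oprod_conj[OF FF])
  let ?P = "oprod L (map U ps)"
  have "cheap L (K' + K + K') (mmult L (adj F) (mmult L (mmult L F (mmult L ?P (adj F))) F))"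
    by (intro cheap_seq cheap C)
  moreover have "opeq L (mmult L (adj F) (mmult L (mmult L F (mmult L ?P (adj F))) F)) ?P"
  proof -
    have "opeq L (mmult L (adj F) (mmult L (mmult L F (mmult L ?P (adj F))) F))
      (mmult L ?P (mmult L (adj F) F))"
      unfolding mmult_assoc by (rule mmult_cancel[OF FF(2)])
    also have "opeq L \<dots> (mmult L ?P idm)" by (rule opeq_mmult_r[OF FF(2)])
    also have "opeq L \<dots> ?P" by simp
    finally show ?thesis .
  qed
  ultimately have "cheap L (K' + K + K') ?P" by (rule cheap_cong)
  then show "cheap L (K + 2 * K') ?P" by (rule cheap_mono) simp
qed

section \<open>Layers of swaps as mode permutations\<close>

definition layer_perm :: "(site \<times> site) list \<Rightarrow> site \<Rightarrow> site" where
  "layer_perm bs = fold (\<lambda>(x, y). swp x y) bs"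

lemma inj_layer_perm: "inj (layer_perm bs)"
proof (induction bs)
  case (Cons b bs)
  have "layer_perm (b # bs) = layer_perm bs \<circ> swp (fst b) (snd b)"
    by (simp add: layer_perm_def fun_eq_iff case_prod_beta)
  then show ?case using Cons inj_compose[OF _ inj_swp] by metis
qed (simp add: layer_perm_def id_def)

lemma layer_perm_fixed:
  "(\<And>x y. (x, y) \<in> set bs \<Longrightarrow> z \<noteq> x \<and> z \<noteq> y) \<Longrightarrow> layer_perm bs z = z"
proof (induction bs)
  case (Cons b bs)
  have "swp (fst b) (snd b) z = z" using Cons.prems[of "fst b" "snd b"] by (simp add: swp_def)
  moreover have "layer_perm bs z = z"
  proof (rule Cons.IH)
    fix x y assume "(x, y) \<in> set bs" then show "z \<noteq> x \<and> z \<noteq> y" using Cons.prems[of x y] by simp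
  qed
  ultimately show ?case by (simp add: layer_perm_def case_prod_beta)
qed (simp add: layer_perm_def)

text \<open>With disjoint bonds no other transposition of the layer touches the two sites.\<close>

lemma layer_perm_swap:
  assumes "distinct bs" "(x, y) \<in> set bs"
    "\<And>b c. b \<in> set bs \<Longrightarrow> c \<in> set bs \<Longrightarrow> b \<noteq> c \<Longrightarrow> {fst b, snd b} \<inter> {fst c, snd c} = {}"
  shows "layer_perm bs x = y \<and> layer_perm bs y = x"
  using assms
proof (induction bs)
  case (Cons b bs)
  have layer: "layer_perm (b # bs) z = layer_perm bs (swp (fst b) (snd b) z)" for z
    by (simp add: layer_perm_def case_prod_beta)
  show ?case
  proof (cases "b = (x, y)")
    case True
    have ne: "z \<noteq> fst c \<and> z \<noteq> snd c" if "c \<in> set bs" "z \<in> {x, y}" for c z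
    proof -
      have "b \<noteq> c" using Cons.prems(1) that(1) by auto
      then have "{x, y} \<inter> {fst c, snd c} = {}" using Cons.prems(3)[of b c] that(1) True by simp
      then show ?thesis using that(2) by blast
    qed
    have "layer_perm bs z = z" if "z \<in> {x, y}" for z
      by (rule layer_perm_fixed) (use ne[of _ z] that in force)
    then show ?thesis unfolding layer using True by (auto simp: swp_def)
  next
    case False
    then have xy: "(x, y) \<in> set bs" using Cons.prems(2) by auto
    then have "{fst b, snd b} \<inter> {x, y} = {}" using Cons.prems(3)[of b "(x, y)"] False by simp
    then have "swp (fst b) (snd b) x = x" "swp (fst b) (snd b) y = y" by (auto simp: swp_def)
    moreover have "layer_perm bs x = y \<and> layer_perm bs y = x"
      by (rule Cons.IH) (use Cons.prems xy in auto)
    ultimately show ?thesis unfolding layer by simp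
  qed
qed simp

lemma fperm_fswap:
  assumes "x \<noteq> y" "x \<in> lattice L" "y \<in> lattice L"
  shows "fperm L (swp x y) (fswap L (x, y))"
  using fswap_mmult_fswap[OF assms] fswap_ann[OF assms] swp_in_lattice[OF assms(2,3)]
  by (simp add: fperm_def unitary_op_def adj_fswap)

lemma fperm_comp:
  assumes "fperm L \<pi> F" "fperm L \<rho> G"
  shows "fperm L (\<lambda>z. \<rho> (\<pi> z)) (mmult L G F)"
  unfolding fperm_def
proof (intro conjI ballI)
  show "unitary_op L (mmult L G F)" using assms unitary_mmult by (simp add: fperm_def)
  fix z assume z: "z \<in> lattice L"
  then have \<pi>z: "\<pi> z \<in> lattice L" using assms(1) by (simp add: fperm_def)
  then show "\<rho> (\<pi> z) \<in> lattice L" using assms(2) by (simp add: fperm_def)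
  have "opeq L (mmult L (mmult L G F) (ann L z)) (mmult L G (mmult L (ann L (\<pi> z)) F))"
    unfolding mmult_assoc by (rule opeq_mmult_r) (use assms(1) z in \<open>simp add: fperm_def\<close>)
  also have "opeq L \<dots> (mmult L (mmult L (ann L (\<rho> (\<pi> z))) G) F)"
    unfolding mmult_assoc[symmetric] by (rule opeq_mmult_l) (use assms(2) \<pi>z in \<open>simp add: fperm_def\<close>)
  also have "opeq L \<dots> (mmult L (ann L (\<rho> (\<pi> z))) (mmult L G F))" by (simp add: mmult_assoc)
  finally show "opeq L (mmult L (mmult L G F) (ann L z)) (mmult L (ann L (\<rho> (\<pi> z))) (mmult L G F))" .
qed

lemma fperm_cong:
  assumes "fperm L \<pi> F" "opeq L F G" shows "fperm L \<pi> G"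
  unfolding fperm_def
proof (intro conjI ballI)
  show "unitary_op L G" using assms unitary_cong by (auto simp: fperm_def)
  fix z assume z: "z \<in> lattice L"
  then show "\<pi> z \<in> lattice L" using assms(1) by (simp add: fperm_def)
  have "opeq L (mmult L G (ann L z)) (mmult L F (ann L z))" by (rule opeq_mmult_l[OF opeq_sym[OF assms(2)]])
  also have "opeq L \<dots> (mmult L (ann L (\<pi> z)) F)" using assms(1) z by (simp add: fperm_def)
  also have "opeq L \<dots> (mmult L (ann L (\<pi> z)) G)" by (rule opeq_mmult_r[OF assms(2)])
  finally show "opeq L (mmult L G (ann L z)) (mmult L (ann L (\<pi> z)) G)" .
qed

lemma fperm_layer:
  assumes "\<And>x y. (x, y) \<in> set bs \<Longrightarrow> x \<noteq> y \<and> x \<in> lattice L \<and> y \<in> lattice L"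
  shows "fperm L (layer_perm bs) (oprod L (map (fswap L) bs))"
  using assms
proof (induction bs)
  case Nil
  have "opeq L (mmult L idm A) (mmult L A idm)" for A
    by (rule opeq_trans[OF mmult_idm_left opeq_sym[OF mmult_idm_right]])
  then show ?case by (simp add: fperm_def unitary_idm layer_perm_def)
next
  case (Cons b bs)
  obtain x y where b: "b = (x, y)" by (cases b)
  have "fperm L (\<lambda>z. layer_perm bs (swp x y z)) (mmult L (oprod L (map (fswap L) bs)) (fswap L b))"
    unfolding b
  proof (rule fperm_comp[OF fperm_fswap Cons.IH])
    show "x \<noteq> y" "x \<in> lattice L" "y \<in> lattice L" using Cons.prems[of x y] b by simp_all
    fix u v assume "(u, v) \<in> set bs"
    then show "u \<noteq> v \<and> u \<in> lattice L \<and> v \<in> lattice L" using Cons.prems[of u v] by simp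
  qed
  moreover have "layer_perm (b # bs) = (\<lambda>z. layer_perm bs (swp x y z))"
    by (simp add: layer_perm_def fun_eq_iff b)
  ultimately show ?case
    using fperm_cong[OF _ opeq_sym[OF oprod_Cons]] by simp
qed

text \<open>Each swap is self-adjoint, so the adjoint of a layer is the layer in reverse
  order.\<close>

lemma cheap_layer:
  assumes "bond_class L K B" "distinct bs" "set bs \<subseteq> B"
  shows "cheap L K (oprod L (map (fswap L) bs))" "cheap L K (adj (oprod L (map (fswap L) bs)))"
proof -
  have 1: "cheap L K (oprod L (map (fswap L) bs))" if "distinct bs" "set bs \<subseteq> B" for bs
    unfolding cheap_def
    by (rule assms(1)[unfolded bond_class_def, rule_format]) (use that fswap_G2 in \<open>auto\<close>)
  show "cheap L K (oprod L (map (fswap L) bs))" using 1 assms by blast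
  have "opeq L (adj (oprod L (map (fswap L) bs))) (oprod L (map (fswap L) (rev bs)))"
    using adj_oprod[of L "map (fswap L) bs"] by (simp add: rev_map adj_fswap o_def)
  then show "cheap L K (adj (oprod L (map (fswap L) bs)))"
    using cheap_cong[OF 1[of "rev bs"] opeq_sym] assms by simp
qed

section \<open>Routing distant pairs\<close>

definition tr :: "nat \<Rightarrow> site \<Rightarrow> site \<Rightarrow> site" where
  "tr M t p = (case t of (i, j, k) \<Rightarrow> case p of (a, b, c) \<Rightarrow> (M * i + a, M * j + b, M * k + c))"

text \<open>One orbit of pairs under translations by multiples of \<open>M\<close>, cut down to the
  lattice. All its pairs have the same offset.\<close>

definition fam :: "nat \<Rightarrow> nat \<Rightarrow> site \<Rightarrow> site \<Rightarrow> site set set" where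
  "fam M L p q = {{tr M t p, tr M t q} |t. tr M t p \<in> lattice L \<and> tr M t q \<in> lattice L}"

text \<open>The difference of \<open>a\<close> and \<open>a'\<close> is a multiple of
  \<open>M\<close> and smaller than \<open>M\<close>, hence zero.\<close>

lemma period_collide:
  assumes "M * i + a = M * i' + a'" "ndist a a' < (M::nat)"
  shows "i = i' \<and> a = a'"
proof -
  have *: False if "M * i + a = M * i' + a'" "i < i'" "a < a' + M" for i i' a a' :: nat
  proof -
    have "M * Suc i \<le> M * i'" by (rule mult_le_mono2) (use that(2) in simp)
    then show False using that(1,3) by simp
  qed
  have lt: "a < a' + M" "a' < a + M" using assms(2) by (auto simp: ndist_def split: if_splits)
  have "\<not> i < i'" using *[OF assms(1) _ lt(1)] by blast
  moreover have "\<not> i' < i" using *[OF assms(1)[symmetric] _ lt(2)] by blast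
  ultimately have "i = i'" by simp
  then show ?thesis using assms(1) by simp
qed

lemma tr_collide:
  assumes "tr M t p = tr M t' q" "dist_inf p q < M"
  shows "t = t' \<and> p = q"
proof -
  obtain i j k where t: "t = (i, j, k)" by (cases t)
  obtain i' j' k' where t': "t' = (i', j', k')" by (cases t')
  obtain a b c where p: "p = (a, b, c)" by (cases p)
  obtain a' b' c' where q: "q = (a', b', c')" by (cases q)
  have "ndist a a' < M" "ndist b b' < M" "ndist c c' < M" using assms(2) by (auto simp: dist_inf_def p q)
  then show ?thesis
    using period_collide[of M i a i' a'] period_collide[of M j b j' b'] period_collide[of M k c k' c'] assms(1)
    by (simp add: tr_def t t' p q)
qed

lemma bond_class_mono: "bond_class L K B \<Longrightarrow> K \<le> K' \<Longrightarrow> bond_class L K' B"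
  unfolding bond_class_def using cheap_mono[unfolded cheap_def] by blast

text \<open>An even period leaves the parity of every coordinate unchanged, so all translates of a
  unit step lie in one bond class. The constant 70 is the largest of the three directions.\<close>

lemma unit_bonds_directed:
  assumes "even M" "up = (Suc a, b, c) \<or> up = (a, Suc b, c) \<or> up = (a, b, Suc c)"
  shows "\<exists>B. (\<forall>L\<ge>1. bond_class L 70 (B L)) \<and> (\<forall>L t. tr M t (a, b, c) \<in> lattice L \<longrightarrow> tr M t up \<in> lattice L \<longrightarrow>
    (tr M t (a, b, c), tr M t up) \<in> B L)"
proof -
  have m: "(M * i + r) mod 2 = r mod 2" for i r
    using assms(1) by (metis dvd_imp_mod_0 mod_add_left_eq mod_mult_left_eq mult_zero_left plus_nat.add_0)
  consider "up = (Suc a, b, c)" | "up = (a, Suc b, c)" | "up = (a, b, Suc c)" using assms(2) by blast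
  then show ?thesis
  proof cases
    case 1
    show ?thesis
      by (rule exI[of _ "bonds1 (a mod 2)"], intro conjI allI impI bond_class1)
        (auto simp: 1 tr_def bonds1_def lattice_def m)
  next
    case 2
    show ?thesis
      by (rule exI[of _ "bonds2 (b mod 2)"], intro conjI allI impI bond_class_mono[OF bond_class2])
        (auto simp: 2 tr_def bonds2_def lattice_def m)
  next
    case 3
    show ?thesis
      by (rule exI[of _ "bonds3 (c mod 2)"], intro conjI allI impI bond_class_mono[OF bond_class3])
        (auto simp: 3 tr_def bonds3_def lattice_def m)
  qed
qed

text \<open>The classes contain bonds in increasing direction only, hence the renaming of the two
  ends as \<open>lo\<close> and \<open>up\<close>.\<close>

lemma unit_bonds:
  assumes "even M" "dist_l1 q q' = 1"
  shows "\<exists>lo up B. {lo, up} = {q, q'} \<and> (\<forall>L\<ge>1. bond_class L 70 (B L)) \<and>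
    (\<forall>L t. tr M t lo \<in> lattice L \<longrightarrow> tr M t up \<in> lattice L \<longrightarrow> (tr M t lo, tr M t up) \<in> B L)"
proof -
  obtain a b c where q: "q = (a, b, c)" by (cases q)
  obtain a' b' c' where q': "q' = (a', b', c')" by (cases q')
  have "(q' = (Suc a, b, c) \<or> q' = (a, Suc b, c) \<or> q' = (a, b, Suc c)) \<or>
    (q = (Suc a', b', c') \<or> q = (a', Suc b', c') \<or> q = (a', b', Suc c'))"
    using assms(2) unfolding q q' by (simp add: dist_l1_def ndist_def split: if_splits) linarith+
  then show ?thesis
  proof
    assume "q' = (Suc a, b, c) \<or> q' = (a, Suc b, c) \<or> q' = (a, b, Suc c)"
    from unit_bonds_directed[OF assms(1) this] obtain B where "\<forall>L\<ge>1. bond_class L 70 (B L)"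
      "\<forall>L t. tr M t q \<in> lattice L \<longrightarrow> tr M t q' \<in> lattice L \<longrightarrow> (tr M t q, tr M t q') \<in> B L"
      unfolding q[symmetric] by (elim exE conjE)
    then show ?thesis by (intro exI[of _ q] exI[of _ q'] exI[of _ B] conjI refl)
  next
    assume "q = (Suc a', b', c') \<or> q = (a', Suc b', c') \<or> q = (a', b', Suc c')"
    from unit_bonds_directed[OF assms(1) this] obtain B where "\<forall>L\<ge>1. bond_class L 70 (B L)"
      "\<forall>L t. tr M t q' \<in> lattice L \<longrightarrow> tr M t q \<in> lattice L \<longrightarrow> (tr M t q', tr M t q) \<in> B L"
      unfolding q'[symmetric] by (elim exE conjE)
    then show ?thesis by (intro exI[of _ q'] exI[of _ q] exI[of _ B] conjI insert_commute)
  qed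
qed

text \<open>The last alternative keeps the new coordinate at or below the larger of the old ones,
  hence inside the lattice after translation.\<close>

lemma closer_coordinate:
  assumes "a \<noteq> a'"
  shows "\<exists>b. ndist a' b = 1 \<and> Suc (ndist a b) = ndist a a' \<and> (b \<le> a \<or> b \<le> a')"
  using assms by (intro exI[of _ "if a < a' then a' - 1 else Suc a'"]) (auto simp: ndist_def)

lemma ndist_self [simp]: "ndist a a = 0"
  by (simp add: ndist_def)

lemma closer_site:
  assumes "p \<noteq> q"
  shows "\<exists>q'. dist_l1 q q' = 1 \<and> Suc (dist_l1 p q') = dist_l1 p q \<and> dist_inf p q' \<le> dist_inf p q \<and>
    (\<forall>M L t. tr M t p \<in> lattice L \<longrightarrow> tr M t q \<in> lattice L \<longrightarrow> tr M t q' \<in> lattice L)"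
proof -
  obtain a b c where p: "p = (a, b, c)" by (cases p)
  obtain a' b' c' where q: "q = (a', b', c')" by (cases q)
  note defs = dist_l1_def dist_inf_def tr_def lattice_def
  consider "a \<noteq> a'" | "b \<noteq> b'" | "c \<noteq> c'" using assms unfolding p q by blast
  then show ?thesis
  proof cases
    case 1
    obtain r where "ndist a' r = 1" "Suc (ndist a r) = ndist a a'" "r \<le> a \<or> r \<le> a'"
      using closer_coordinate[OF 1] by blast
    then show ?thesis unfolding p q by (intro exI[of _ "(r, b', c')"]) (auto simp: defs)
  next
    case 2
    obtain r where "ndist b' r = 1" "Suc (ndist b r) = ndist b b'" "r \<le> b \<or> r \<le> b'"
      using closer_coordinate[OF 2] by blast
    then show ?thesis unfolding p q by (intro exI[of _ "(a', r, c')"]) (auto simp: defs)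
  next
    case 3
    obtain r where "ndist c' r = 1" "Suc (ndist c r) = ndist c c'" "r \<le> c \<or> r \<le> c'"
      using closer_coordinate[OF 3] by blast
    then show ?thesis unfolding p q by (intro exI[of _ "(a', b', r)"]) (auto simp: defs)
  qed
qed

lemma dist_inf_unit: "dist_l1 q q' = 1 \<Longrightarrow> dist_inf q q' \<le> 1"
  by (auto simp: dist_l1_def dist_inf_def split: prod.splits)

lemma ndist_commute: "ndist a b = ndist b a"
  by (simp add: ndist_def)

lemma dist_inf_commute: "dist_inf x y = dist_inf y x"
  by (cases x; cases y) (simp add: dist_inf_def ndist_commute)

lemma dist_inf_self [simp]: "dist_inf x x = 0"
  by (cases x) (simp add: dist_inf_def)

text \<open>All bonds joining \<open>tr M t q\<close> to \<open>tr M t q'\<close> are swapped in one layer.  This leaves every \<open>tr M t p\<close>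
  fixed because \<open>p\<close> is congruent to neither \<open>q\<close> nor \<open>q'\<close> modulo \<open>M\<close>.\<close>
lemma good_step:
  assumes M: "even M" "1 < M" and qq': "dist_l1 q q' = 1"
    and ne: "p \<noteq> q" "p \<noteq> q'" and far: "dist_inf p q < M" "dist_inf p q' < M"
    and between: "\<And>t. tr M t p \<in> lattice L \<Longrightarrow> tr M t q \<in> lattice L \<Longrightarrow> tr M t q' \<in> lattice L"
    and L: "L \<ge> 1" and good: "good L K (fam M L p q')"
  shows "good L (K + 2 * 70) (fam M L p q)"
proof -
  obtain lo up B where lu: "{lo, up} = {q, q'}" and "\<forall>L\<ge>1. bond_class L 70 (B L)"
    and "\<forall>L t. tr M t lo \<in> lattice L \<longrightarrow> tr M t up \<in> lattice L \<longrightarrow> (tr M t lo, tr M t up) \<in> B L"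
    using unit_bonds[OF M(1) qq'] by blast
  then have B: "bond_class L 70 (B L)"
    and inB: "\<And>t. tr M t lo \<in> lattice L \<Longrightarrow> tr M t up \<in> lattice L \<Longrightarrow> (tr M t lo, tr M t up) \<in> B L"
    using L by blast+
  have "q \<noteq> q'" using qq' by (rule dist_l1_neq)
  then have lu_ne: "lo \<noteq> up" using lu by (metis insert_absorb2 doubleton_eq_iff)
  \<comment> \<open>The ends of a bond are at distance 1 < \<open>M\<close>, so bonds of different
    translates are disjoint.\<close>
  have lu_far: "dist_inf v w < M" if "v \<in> {lo, up}" "w \<in> {lo, up}" for v w
    using that dist_inf_unit[OF qq'] M(2) dist_inf_commute[of q q'] unfolding lu by auto
  define bset where "bset = {(tr M t lo, tr M t up) |t. tr M t lo \<in> lattice L \<and> tr M t up \<in> lattice L}"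
  have "bset \<subseteq> lattice L \<times> lattice L" unfolding bset_def by blast
  then have "finite bset" by (rule finite_subset) simp
  then obtain bs where bs: "set bs = bset" "distinct bs" using finite_distinct_list by blast
  have in_bs: "\<exists>t. b = (tr M t lo, tr M t up) \<and> tr M t lo \<in> lattice L \<and> tr M t up \<in> lattice L"
    if "b \<in> set bs" for b
    using that unfolding bs(1) bset_def by blast
  have disj: "{fst b, snd b} \<inter> {fst c, snd c} = {}" if bc: "b \<in> set bs" "c \<in> set bs" "b \<noteq> c" for b c
  proof -
    obtain t where t: "b = (tr M t lo, tr M t up)" using in_bs[OF bc(1)] by blast
    obtain t' where t': "c = (tr M t' lo, tr M t' up)" using in_bs[OF bc(2)] by blast
    have "t \<noteq> t'" using bc(3) t t' by auto
    then have "tr M t v \<noteq> tr M t' w" if "v \<in> {lo, up}" "w \<in> {lo, up}" for v w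
      using tr_collide[of M t v t' w] lu_far[OF that] by blast
    then show ?thesis unfolding t t' by simp
  qed
  let ?\<pi> = "layer_perm bs" and ?F = "oprod L (map (fswap L) bs)"
  have F: "fperm L ?\<pi> ?F"
  proof (rule fperm_layer)
    fix x y assume "(x, y) \<in> set bs"
    then obtain t where t: "x = tr M t lo" "y = tr M t up" "x \<in> lattice L" "y \<in> lattice L"
      using in_bs[of "(x, y)"] by auto
    have "x \<noteq> y" using tr_collide[of M t lo t up] lu_far[of lo up] lu_ne t by auto
    then show "x \<noteq> y \<and> x \<in> lattice L \<and> y \<in> lattice L" using t by simp
  qed
  have sub: "set bs \<subseteq> B L" using in_bs inB by blast
  have moved: "?\<pi> (tr M t q) = tr M t q'" if "tr M t q \<in> lattice L" "tr M t q' \<in> lattice L" for t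
  proof -
    have lat: "tr M t lo \<in> lattice L" "tr M t up \<in> lattice L"
      using lu that by (auto simp: doubleton_eq_iff)
    then have "(tr M t lo, tr M t up) \<in> set bs" unfolding bs(1) bset_def by blast
    then have "?\<pi> (tr M t lo) = tr M t up \<and> ?\<pi> (tr M t up) = tr M t lo"
      by (rule layer_perm_swap[OF bs(2) _ disj])
    then show ?thesis using lu by (auto simp: doubleton_eq_iff)
  qed
  have fixed: "?\<pi> (tr M t p) = tr M t p" for t
  proof (rule layer_perm_fixed)
    fix x y assume "(x, y) \<in> set bs"
    then obtain t' where t': "x = tr M t' lo" "y = tr M t' up" using in_bs[of "(x, y)"] by auto
    have "tr M t p \<noteq> tr M t' v" if "v \<in> {lo, up}" for v
    proof -
      have "p \<noteq> v" "dist_inf p v < M" using that ne far unfolding lu by auto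
      then show ?thesis using tr_collide[of M t p t' v] by blast
    qed
    then show "tr M t p \<noteq> x \<and> tr M t p \<noteq> y" unfolding t' by simp
  qed
  show ?thesis
  proof (rule good_route[OF F inj_on_subset[OF inj_layer_perm subset_UNIV] cheap_layer[OF B bs(2) sub] good])
    fix e assume "e \<in> fam M L p q"
    then obtain t where t: "e = {tr M t p, tr M t q}" "tr M t p \<in> lattice L" "tr M t q \<in> lattice L"
      unfolding fam_def by blast
    have q': "tr M t q' \<in> lattice L" by (rule between[OF t(2,3)])
    have "?\<pi> ` e = {tr M t p, tr M t q'}" unfolding t(1) using fixed moved[OF t(3) q'] by simp
    moreover have "{tr M t p, tr M t q'} \<in> fam M L p q'" unfolding fam_def using t(2) q' by blast
    ultimately show "e \<subseteq> lattice L \<and> ?\<pi> ` e \<in> fam M L p q'" using t by simp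
  qed
qed

text \<open>Induction on the l1-distance: each unit step towards \<open>p\<close> adds one swap
  layer and its inverse. The number of steps does not involve \<open>L\<close>, so \<open>K\<close>
  can be fixed before \<open>L\<close>.\<close>

lemma good_fam:
  assumes "even M" "1 < M" "dist_l1 p q = Suc n" "dist_inf p q < M"
  shows "\<exists>K. \<forall>L\<ge>1. good L K (fam M L p q)"
  using assms(3,4)
proof (induction n arbitrary: q)
  case 0
  obtain lo up B where lu: "{lo, up} = {p, q}" and B: "\<forall>L\<ge>1. bond_class L 70 (B L)"
    and inB: "\<forall>L t. tr M t lo \<in> lattice L \<longrightarrow> tr M t up \<in> lattice L \<longrightarrow> (tr M t lo, tr M t up) \<in> B L"
    using unit_bonds[OF assms(1), of p q] 0 by auto
  have "good L 70 (fam M L p q)" if "L \<ge> 1" for L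
  proof (rule good_bonds)
    show "bond_class L 70 (B L)" using B that by blast
    fix e assume "e \<in> fam M L p q"
    then obtain t where t: "e = {tr M t p, tr M t q}" "tr M t p \<in> lattice L" "tr M t q \<in> lattice L"
      unfolding fam_def by blast
    then have "tr M t lo \<in> lattice L" "tr M t up \<in> lattice L" "e = {tr M t lo, tr M t up}"
      using lu by (auto simp: doubleton_eq_iff)
    then show "\<exists>x y. (x, y) \<in> B L \<and> e = {x, y}" using inB by blast
  qed
  then show ?case by blast
next
  case (Suc n)
  have pq: "p \<noteq> q" using Suc.prems(1) by (auto simp: dist_l1_def ndist_def split: prod.splits)
  from closer_site[OF pq] obtain q' where q': "dist_l1 q q' = 1" "Suc (dist_l1 p q') = dist_l1 p q" "dist_inf p q' \<le> dist_inf p q"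
    "\<And>M L t. tr M t p \<in> lattice L \<Longrightarrow> tr M t q \<in> lattice L \<Longrightarrow> tr M t q' \<in> lattice L"
    by blast
  have far: "dist_inf p q' < M" using q'(3) Suc.prems(2) by simp
  have pq': "p \<noteq> q'" using q'(2) Suc.prems(1) by (auto simp: dist_l1_def ndist_def split: prod.splits)
  obtain K where K: "\<And>L. L \<ge> 1 \<Longrightarrow> good L K (fam M L p q')"
    using Suc.IH[of q'] q'(2) Suc.prems(1) far by auto
  have "good L (K + 2 * 70) (fam M L p q)" if "L \<ge> 1" for L
    by (rule good_step[OF assms(1,2) q'(1) pq pq' Suc.prems(2) far q'(4) that K[OF that]])
  then show ?case by blast
qed

text \<open>Dividing the smaller coordinate by \<open>M\<close> leaves a remainder below
  \<open>M\<close>, and the larger one exceeds it by less than \<open>M\<close>. So base points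
  below \<open>2 * M\<close> suffice, finitely many for all \<open>L\<close>.\<close>

lemma common_period:
  assumes "ndist a a' \<le> d" "d < (M::nat)"
  shows "\<exists>i u u'. a = M * i + u \<and> a' = M * i + u' \<and> u < 2 * M \<and> u' < 2 * M \<and> ndist u u' = ndist a a'"
proof -
  define i where "i = min a a' div M"
  have M: "M > 0" using assms(2) by simp
  have "M * i \<le> min a a'" unfolding i_def by (rule times_div_less_eq_dividend)
  then have le: "M * i \<le> a" "M * i \<le> a'" by simp_all
  have "min a a' - M * i < M"
    unfolding i_def using M by (simp add: minus_mult_div_eq_mod)
  then have "a - M * i < 2 * M" "a' - M * i < 2 * M"
    using assms le by (auto simp: ndist_def min_def split: if_splits)
  moreover have "ndist (a - M * i) (a' - M * i) = ndist a a'"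
    using le by (auto simp: ndist_def)
  ultimately show ?thesis
    using le by (intro exI[of _ i] exI[of _ "a - M * i"] exI[of _ "a' - M * i"]) auto
qed

lemma pairs_cover:
  assumes "e \<in> pairs L d" "d < M"
  shows "\<exists>p q. p \<in> lattice (2 * M) \<and> q \<in> lattice (2 * M) \<and> p \<noteq> q \<and> dist_inf p q < M \<and> e \<in> fam M L p q"
proof -
  obtain x y where e: "e = {x, y}" "x \<in> lattice L" "y \<in> lattice L" "x \<noteq> y" "dist_inf x y \<le> d"
    using assms(1) unfolding pairs_def by blast
  obtain a b c where x: "x = (a, b, c)" by (cases x)
  obtain a' b' c' where y: "y = (a', b', c')" by (cases y)
  have nd: "ndist a a' \<le> d" "ndist b b' \<le> d" "ndist c c' \<le> d" using e(5) by (auto simp: dist_inf_def x y)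
  obtain i u u' where 1: "a = M * i + u" "a' = M * i + u'" "u < 2 * M" "u' < 2 * M" "ndist u u' = ndist a a'"
    using common_period[OF nd(1) assms(2)] by blast
  obtain j v v' where 2: "b = M * j + v" "b' = M * j + v'" "v < 2 * M" "v' < 2 * M" "ndist v v' = ndist b b'"
    using common_period[OF nd(2) assms(2)] by blast
  obtain k w w' where 3: "c = M * k + w" "c' = M * k + w'" "w < 2 * M" "w' < 2 * M" "ndist w w' = ndist c c'"
    using common_period[OF nd(3) assms(2)] by blast
  have xy: "x = tr M (i, j, k) (u, v, w)" "y = tr M (i, j, k) (u', v', w')"
    using 1 2 3 by (simp_all add: x y tr_def)
  show ?thesis
  proof (intro exI conjI)
    show "(u, v, w) \<in> lattice (2 * M)" "(u', v', w') \<in> lattice (2 * M)"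
      using 1 2 3 by (simp_all add: lattice_def)
    show "(u, v, w) \<noteq> (u', v', w')" using e(4) xy by auto
    show "dist_inf (u, v, w) (u', v', w') < M"
      using nd assms(2) 1(5) 2(5) 3(5) by (simp add: dist_inf_def)
    show "e \<in> fam M L (u, v, w) (u', v', w')"
      using e(1-3) unfolding xy fam_def by blast
  qed
qed

text \<open>In contrast to \<open>good\<close> the order is now chosen, because terms from different
  families need not commute. Arbitrary subsets \<open>Q\<close> make the induction over families
  possible.\<close>

definition schedulable :: "nat \<Rightarrow> nat \<Rightarrow> site set set \<Rightarrow> bool" where
  "schedulable L K Fam \<longleftrightarrow> (\<forall>Q U. finite Q \<longrightarrow> Q \<subseteq> Fam \<longrightarrow> (\<forall>p\<in>Q. U p \<in> Agates L p) \<longrightarrow>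
     (\<exists>ps. distinct ps \<and> set ps = Q \<and> cheap L K (oprod L (map U ps))))"

lemma good_union:
  assumes "finite I" "\<And>i. i \<in> I \<Longrightarrow> \<exists>K. \<forall>L\<ge>1. good L K (G i L)"
  shows "\<exists>K. \<forall>L\<ge>1. schedulable L K (\<Union>i\<in>I. G i L)"
  using assms
proof (induction I)
  case empty
  have "cheap L 0 idm" for L unfolding cheap_def by (rule impl_mono[OF impl_idm]) auto
  then show ?case by (intro exI[of _ 0]) (auto simp: schedulable_def)
next
  case (insert i I)
  obtain K where K: "\<And>L. L \<ge> 1 \<Longrightarrow> schedulable L K (\<Union>i\<in>I. G i L)"
    using insert.IH insert.prems by (metis insertCI)
  obtain K' where K': "\<And>L. L \<ge> 1 \<Longrightarrow> good L K' (G i L)" using insert.prems by blast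
  have "\<exists>ps. distinct ps \<and> set ps = Q \<and> cheap L (K + K') (oprod L (map U ps))"
    if LQ: "L \<ge> 1" "finite Q" "Q \<subseteq> (\<Union>i\<in>insert i I. G i L)" "\<forall>p\<in>Q. U p \<in> Agates L p" for L Q U
  proof -
    \<comment> \<open>A pair that lies in several families is executed in one of them only.\<close>
    have Q1: "finite (Q - G i L)" "Q - G i L \<subseteq> (\<Union>i\<in>I. G i L)" "\<forall>p\<in>Q - G i L. U p \<in> Agates L p"
      using LQ by auto
    obtain ps where ps: "distinct ps" "set ps = Q - G i L" "cheap L K (oprod L (map U ps))"
      using K[OF LQ(1), unfolded schedulable_def, rule_format, OF Q1(1,2), of U] Q1(3) by blast
    obtain qs where qs: "set qs = Q \<inter> G i L" "distinct qs"
      using finite_distinct_list[of "Q \<inter> G i L"] \<open>finite Q\<close> by blast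
    have "cheap L K' (oprod L (map U qs))"
      by (rule K'[OF LQ(1), unfolded good_def, rule_format]) (use qs LQ in auto)
    then have "cheap L (K + K') (mmult L (oprod L (map U qs)) (oprod L (map U ps)))"
      by (rule cheap_seq[OF ps(3)])
    then have "cheap L (K + K') (oprod L (map U (ps @ qs)))"
      unfolding map_append by (rule cheap_cong) (rule opeq_sym[OF oprod_append])
    moreover have "distinct (ps @ qs)" "set (ps @ qs) = Q" using ps qs by auto
    ultimately show ?thesis by blast
  qed
  then show ?case unfolding schedulable_def by blast
qed

section \<open>The Jordan-Wigner isometry of the reference ordering\<close>

text \<open>In \<open>X + iY\<close> the transition that empties \<open>x\<close> is doubled and the
  one that fills it cancels; the Z string is the sign built into \<open>ann\<close>.\<close>

lemma JW_lowering:
  "opeq L (mmult L (smult (1/2) (madd (pauliX x) (smult \<i> (pauliY x)))) (Zstring L (ref_idx L) x)) (ann L x)"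
proof (rule opeqI)
  fix T S assume TS: "T \<subseteq> lattice L" "S \<subseteq> lattice L"
  have Z: "Zstring L (ref_idx L) x = dgop (\<lambda>S. (-1) ^ card {y \<in> S \<inter> lattice L. ref_idx L y < ref_idx L x})"
    by (auto simp: Zstring_def dgop_def fun_eq_iff)
  have S: "S \<inter> lattice L = S" using TS by blast
  show "mmult L (smult (1/2) (madd (pauliX x) (smult \<i> (pauliY x)))) (Zstring L (ref_idx L) x) T S = ann L x T S"
    unfolding Z mmult_dgop_right[OF TS(2)] S
    by (cases "x \<in> S") (simp_all add: smult_def madd_def pauliX_def pauliY_def ann_def)
qed

text \<open>By \<open>JW_lowering\<close> the operator \<Phi> commutes with every creation operator,
  and it fixes the vacuum; every basis state arises from the vacuum, up to sign, by creating
  particles one at a time.\<close>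

lemma is_JW_vacuum_unique:
  assumes "is_JW L (ref_idx L) \<Phi>" shows "opeq L \<Phi> idm"
proof -
  have u: "unitary_op L \<Phi>" and vac: "\<And>T. T \<subseteq> lattice L \<Longrightarrow> \<Phi> T {} = (if T = {} then 1 else 0)"
    using assms by (auto simp: is_JW_def)
  have cre: "intw L \<Phi> (cre L x) (cre L x)" if "x \<in> lattice L" for x
  proof -
    have "opeq L (ann L x) (mmult L (mmult L \<Phi> (ann L x)) (adj \<Phi>))"
      using assms that opeq_trans[OF _ JW_lowering] unfolding is_JW_def by (blast intro: opeq_sym)
    then have "intw L \<Phi> (ann L x) (ann L x)"
      by (intro conj_intw[OF u]) (simp add: mmult_assoc)
    then show ?thesis unfolding cre_def by (rule intw_adj[OF u])
  qed
  have "\<Phi> T S = idm T S" if "T \<subseteq> lattice L" "S \<subseteq> lattice L" for T S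
  proof -
    have "finite S" using that(2) finite_lattice by (rule finite_subset)
    then show ?thesis using that
    proof (induction S arbitrary: T)
      case empty
      then show ?case using vac by (simp add: idm_def)
    next
      case (insert x S)
      have x: "x \<in> lattice L" "insert x S \<subseteq> lattice L" "S \<subseteq> lattice L" using insert.prems by auto
      define e where "e = ((-1) ^ card {y \<in> insert x S. ref_idx L y < ref_idx L x} :: complex)"
      have e: "e \<noteq> 0" by (simp add: e_def)
      have c: "cre L x U S = (if U = insert x S then e else 0)" for U
      proof -
        have "x \<in> U \<and> S = U - {x} \<longleftrightarrow> U = insert x S" using insert.hyps(2) by blast
        then show ?thesis by (simp add: cre_def adj_def ann_def e_def)
      qed
      have "mmult L \<Phi> (cre L x) T S = (\<Sum>U\<in>Pow (lattice L). if U = insert x S then \<Phi> T U * e else 0)"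
        unfolding mmult_def c by (rule sum.cong) auto
      then have 1: "mmult L \<Phi> (cre L x) T S = \<Phi> T (insert x S) * e" using x(2) by simp
      have "mmult L (cre L x) \<Phi> T S = mmult L (cre L x) idm T S"
        unfolding mmult_def by (rule sum.cong) (use insert.IH x in auto)
      then have 2: "mmult L (cre L x) \<Phi> T S = cre L x T S"
        using opeqD[OF mmult_idm_right insert.prems(1) x(3)] by simp
      have "\<Phi> T (insert x S) * e = (if T = insert x S then e else 0)"
        using opeqD[OF cre[OF x(1), unfolded intw_def] insert.prems(1) x(3)] by (simp only: 1 2 c)
      then show ?case using e by (simp add: idm_def split: if_splits)
    qed
  qed
  then show ?thesis by (rule opeqI)
qed

lemma JW_ref_idx: "opeq L (JW L (ref_idx L)) idm"
proof -
  \<comment> \<open>The definite description asks for equality as functions, so the identity is cut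
    off outside the lattice, as \<open>supported\<close> demands.\<close>
  define R where "R = (\<lambda>T S. if T \<subseteq> lattice L \<and> S \<subseteq> lattice L then idm T S else 0)"
  have R: "opeq L R idm" by (rule opeqI) (simp add: R_def)
  have "is_JW L (ref_idx L) R"
    unfolding is_JW_def
  proof (intro conjI ballI)
    show "supported L R" by (auto simp: supported_def R_def)
    show "unitary_op L R" by (rule unitary_cong[OF unitary_idm opeq_sym[OF R]])
    show "R T {} = (if T = {} then 1 else 0)" if "T \<in> Pow (lattice L)" for T
      using that by (simp add: R_def idm_def)
    fix x
    have "opeq L (mmult L (mmult L R (ann L x)) (adj R)) (mmult L (mmult L idm (ann L x)) (adj idm))"
      by (intro opeq_mmult opeq_adj R opeq_refl)
    also have "opeq L \<dots> (mmult L idm (ann L x))" by simp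
    also have "opeq L \<dots> (ann L x)" by simp
    also have "opeq L \<dots> (mmult L (smult (1/2) (madd (pauliX x) (smult \<i> (pauliY x)))) (Zstring L (ref_idx L) x))"
      by (rule opeq_sym[OF JW_lowering])
    finally show "opeq L (mmult L (mmult L R (ann L x)) (adj R))
      (mmult L (smult (1/2) (madd (pauliX x) (smult \<i> (pauliY x)))) (Zstring L (ref_idx L) x))" .
  qed
  moreover have "\<Phi> = R" if "is_JW L (ref_idx L) \<Phi>" for \<Phi>
  proof (intro ext)
    fix T S
    show "\<Phi> T S = R T S"
    proof (cases "T \<subseteq> lattice L \<and> S \<subseteq> lattice L")
      case True
      then show ?thesis using opeqD[OF is_JW_vacuum_unique[OF that]] by (simp add: R_def)
    next
      case False
      then show ?thesis using that unfolding R_def is_JW_def supported_def by auto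
    qed
  qed
  ultimately have "JW L (ref_idx L) = R" unfolding JW_def by (rule the_equality)
  then show ?thesis using R by simp
qed

lemma canonical_ordering_ref_idx: "canonical_ordering L (ref_idx L)"
proof -
  have inj: "inj_on (ref_idx L) (lattice L)" by (rule inj_onI) (simp add: ref_idx_eq_iff)
  have "ref_idx L x < L ^ 3" if "x \<in> lattice L" for x
  proof -
    obtain a b c where x: "x = (a, b, c)" by (cases x)
    have lt: "a < L" "b < L" "c < L" using that by (auto simp: x lattice_def)
    have "a * L + b < L * L + 0" using mult_add_less_iff[of b L 0 a L] lt by simp
    then have "(a * L + b) * L + c < (L * L) * L + 0"
      using mult_add_less_iff[of c L 0 "a * L + b" "L * L"] lt by simp
    then show ?thesis by (simp add: x ref_idx_def power3_eq_cube algebra_simps)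
  qed
  then have "ref_idx L ` lattice L \<subseteq> {0..<L ^ 3}" by auto
  moreover have "card (ref_idx L ` lattice L) = card {0..<L ^ 3}"
    by (simp add: card_image[OF inj] card_lattice)
  ultimately have "ref_idx L ` lattice L = {0..<L ^ 3}" by (intro card_subset_eq) auto
  then show ?thesis using inj by (simp add: canonical_ordering_def bij_betw_def)
qed

lemma evolution_oprod:
  "evolution L H \<theta> ps = oprod L (map (\<lambda>p. mexp L (smult (- \<i> * complex_of_real (\<theta> p)) (H p))) ps)"
  by (simp add: evolution_def oprod_def foldl_map)

theorem mainTheorem14:
  fixes \<delta> :: nat
  assumes "\<delta> \<ge> 1"
  shows "\<exists>K::nat. \<forall>L::nat. \<forall>(H :: site set \<Rightarrow> op) (\<theta> :: site set \<Rightarrow> real).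
    (\<forall>x y. {x, y} \<in> pairs L \<delta> \<longrightarrow> admissible_term L x y (H {x, y})) \<longrightarrow>
    (\<exists>m0 m1 (ps :: site set list) (V :: circuit).
       canonical_ordering L m0 \<and> canonical_ordering L m1 \<and>
       distinct ps \<and> set ps = pairs L \<delta> \<and>
       valid_circuit L V \<and> gate_count V \<le> K * L^3 \<and> depth V \<le> K * L \<and>
       opeq L (mmult L (circ_op L V) (JW L m0)) (mmult L (JW L m1) (evolution L H \<theta> ps)))"
proof -
  define M where "M = 2 * Suc \<delta>"
  have M: "even M" "1 < M" "\<delta> < M" by (auto simp: M_def)
  \<comment> \<open>\<open>I\<close> depends on \<delta> only, which is why \<open>K\<close> can be
    chosen before \<open>L\<close>.\<close>
  define I where "I = {(p, q). p \<in> lattice (2 * M) \<and> q \<in> lattice (2 * M) \<and> p \<noteq> q \<and> dist_inf p q < M}"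
  have "I \<subseteq> lattice (2 * M) \<times> lattice (2 * M)" unfolding I_def by blast
  then have finI: "finite I" by (rule finite_subset) simp
  let ?G = "\<lambda>(p, q) L. fam M L p q"
  have "\<exists>K. \<forall>L\<ge>1. good L K (?G i L)" if "i \<in> I" for i
  proof -
    obtain p q where i: "i = (p, q)" by (cases i)
    have pq: "p \<noteq> q" "dist_inf p q < M" using that by (auto simp: i I_def)
    have "\<exists>n. dist_l1 p q = Suc n" using closer_site[OF pq(1)] by metis
    then show ?thesis using good_fam[OF M(1,2) _ pq(2)] i by auto
  qed
  from good_union[OF finI this] obtain K where K: "\<forall>L\<ge>1. schedulable L K (\<Union>i\<in>I. ?G i L)" ..
  have main: "\<exists>m0 m1 (ps :: site set list) (V :: circuit).
       canonical_ordering L m0 \<and> canonical_ordering L m1 \<and>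
       distinct ps \<and> set ps = pairs L \<delta> \<and>
       valid_circuit L V \<and> gate_count V \<le> K * L^3 \<and> depth V \<le> K * L \<and>
       opeq L (mmult L (circ_op L V) (JW L m0)) (mmult L (JW L m1) (evolution L H \<theta> ps))"
    if H: "\<forall>x y. {x, y} \<in> pairs L \<delta> \<longrightarrow> admissible_term L x y (H {x, y})"
    for L H and \<theta> :: "site set \<Rightarrow> real"
  proof -
    let ?U = "\<lambda>p. mexp L (smult (- \<i> * complex_of_real (\<theta> p)) (H p))"
    have "\<exists>ps. distinct ps \<and> set ps = pairs L \<delta> \<and> cheap L K (oprod L (map ?U ps))"
    proof (cases "L \<ge> 1")
      case True
      have "pairs L \<delta> \<subseteq> Pow (lattice L)" unfolding pairs_def by blast
      then have fin: "finite (pairs L \<delta>)" by (rule finite_subset) simp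
      have cover: "pairs L \<delta> \<subseteq> (\<Union>i\<in>I. ?G i L)"
      proof
        fix e assume "e \<in> pairs L \<delta>"
        from pairs_cover[OF this M(3)] obtain p q where "(p, q) \<in> I" "e \<in> fam M L p q"
          unfolding I_def by blast
        then show "e \<in> (\<Union>i\<in>I. ?G i L)" by (intro UN_I[of "(p, q)"]) simp_all
      qed
      have "?U p \<in> Agates L p" if p: "p \<in> pairs L \<delta>" for p
      proof -
        obtain x y where xy: "p = {x, y}" "x \<in> lattice L" "y \<in> lattice L" "x \<noteq> y"
          using p unfolding pairs_def by blast
        have "admissible_term L x y (H p)" using H p unfolding xy(1) by blast
        from AgatesI[OF xy(4,2,3) this opeq_refl] show ?thesis unfolding xy(1) .
      qed
      then show ?thesis
        using K[rule_format, OF True, unfolded schedulable_def, rule_format, OF fin cover, of ?U] by simp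
    next
      case False
      \<comment> \<open>On the empty lattice there is nothing to schedule, and the empty circuit
        meets the bounds, which are zero.\<close>
      then have "pairs L \<delta> = {}" by (simp add: pairs_def lattice_def)
      moreover have "cheap L K idm" unfolding cheap_def by (rule impl_mono[OF impl_idm]) auto
      ultimately show ?thesis by (intro exI[of _ "[]"]) simp
    qed
    then obtain ps where ps: "distinct ps" "set ps = pairs L \<delta>" "cheap L K (evolution L H \<theta> ps)"
      unfolding evolution_oprod by blast
    obtain V where V: "valid_circuit L V" "length V = K * L" "gate_count V \<le> K * L ^ 3"
      "opeq L (circ_op L V) (evolution L H \<theta> ps)"
      using ps(3) unfolding cheap_def impl_def realizes_def by blast
    have "opeq L (mmult L (circ_op L V) (JW L (ref_idx L))) (mmult L (evolution L H \<theta> ps) idm)"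
      by (rule opeq_mmult[OF V(4) JW_ref_idx])
    also have "opeq L \<dots> (evolution L H \<theta> ps)" by (rule mmult_idm_right)
    also have "opeq L \<dots> (mmult L idm (evolution L H \<theta> ps))" by (rule opeq_sym[OF mmult_idm_left])
    also have "opeq L \<dots> (mmult L (JW L (ref_idx L)) (evolution L H \<theta> ps))"
      by (rule opeq_mmult_l[OF opeq_sym[OF JW_ref_idx]])
    finally show ?thesis
      using ps(1,2) V(1-3) canonical_ordering_ref_idx
      by (intro exI[of _ "ref_idx L"] exI[of _ ps] exI[of _ V]) (simp add: depth_def)
  qed
  show ?thesis by (intro exI[of _ K] allI impI) (rule main)
qed

end
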